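(* Let $A_1$ and $A_2$ be two commuting bounded dissipative operators on a separable Hilbert space $\mathcal{H}$ such that $\operatorname{Im}(A_1-A_1^* )+\operatorname{Im}(A_2-A_2^* )$ is closed. Then the semigroup $(t_1,t_2)\mapsto e^{i(t_1A_1+t_2A_2)}$, $t_1,t_2\ge0$, that they generate admits a commutative unitary dilation.
   Context: $\operatorname{Im}$ of an operator denotes its range. An operator $A$ is dissipative if $\frac1{2i}(A-A^* )\ge0$. A commutative unitary dilation of the semigroup consists of a Hilbert space $\mathcal{K}$, an isometry $\iota:\mathcal{H}\to\mathcal{K}$ and a (strongly continuous) unitary representation $\rho$ of the group $\mathbb{R}^2$ on $\mathcal{K}$ such that $\iota^*\rho(t)\iota=e^{i(t_1A_1+t_2A_2)}$ for all $t=(t_1,t_2)\in\mathbb{R}^2_{\geq0}$. *)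

theory Defs
  imports "HOL-Analysis.Analysis" "HOL-Library.Complex_Order"
begin

section \<open>Complex Hilbert spaces as types\<close>

text \<open>Inner products are linear in the first and conjugate-linear in the second argument.
  Positive definiteness of \<open>cinner\<close> is inherited from the norm.\<close>

class complex_hilbert_space = banach +
  fixes scaleC :: "complex \<Rightarrow> 'a \<Rightarrow> 'a" (infixr \<open>*\<^sub>C\<close> 75)
    and cinner :: "'a \<Rightarrow> 'a \<Rightarrow> complex"
  assumes scaleC_add_right: "c *\<^sub>C (x + y) = c *\<^sub>C x + c *\<^sub>C y"
    and scaleC_add_left: "(c + d) *\<^sub>C x = c *\<^sub>C x + d *\<^sub>C x"
    and scaleC_scaleC: "c *\<^sub>C (d *\<^sub>C x) = (c * d) *\<^sub>C x"
    and scaleC_of_real: "complex_of_real r *\<^sub>C x = r *\<^sub>R x"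
    and cinner_commute: "cinner x y = cnj (cinner y x)"
    and cinner_add_left: "cinner (x + y) z = cinner x z + cinner y z"
    and cinner_scaleC_left: "cinner (c *\<^sub>C x) y = c * cinner x y"
    and norm_eq_sqrt_cinner: "norm x = sqrt (Re (cinner x x))"

definition bounded_clinear ::
    "('a::complex_hilbert_space \<Rightarrow> 'b::complex_hilbert_space) \<Rightarrow> bool" where
  "bounded_clinear A \<longleftrightarrow> bounded_linear A \<and> (\<forall>c x. A (c *\<^sub>C x) = c *\<^sub>C A x)"

definition cadjoint ::
    "('a::complex_hilbert_space \<Rightarrow> 'b::complex_hilbert_space) \<Rightarrow> 'b \<Rightarrow> 'a" where
  "cadjoint A = (THE B. \<forall>x y. cinner (A x) y = cinner x (B y))"

text \<open>The order on \<^typ>\<open>complex\<close> is the one of \<^theory>\<open>HOL-Library.Complex_Order\<close>: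
  \<open>0 \<le> z\<close> means that \<open>z\<close> is real and nonnegative.\<close>

definition positive_operator :: "('a::complex_hilbert_space \<Rightarrow> 'a) \<Rightarrow> bool" where
  "positive_operator B \<longleftrightarrow> (\<forall>x. 0 \<le> cinner (B x) x)"

definition dissipative :: "('a::complex_hilbert_space \<Rightarrow> 'a) \<Rightarrow> bool" where
  "dissipative A \<longleftrightarrow> positive_operator (\<lambda>x. (1 / (2 * \<i>)) *\<^sub>C (A x - cadjoint A x))"

text \<open>For bounded \<open>B\<close> the exponential series converges in operator norm, hence at every vector
  to the value of the operator exponential there.\<close>

definition op_exp :: "('a::complex_hilbert_space \<Rightarrow> 'a) \<Rightarrow> 'a \<Rightarrow> 'a" where
  "op_exp B x = (\<Sum>n. (B ^^ n) x /\<^sub>R fact n)"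

section \<open>Complex Hilbert spaces as objects\<close>

text \<open>The dilation space is existentially quantified, which a type cannot be; it is therefore
  a structure on a carrier set.\<close>

record 'k hilbert =
  hcarrier :: "'k set"
  hzero :: 'k
  hadd :: "'k \<Rightarrow> 'k \<Rightarrow> 'k"
  hscale :: "complex \<Rightarrow> 'k \<Rightarrow> 'k"
  hinner :: "'k \<Rightarrow> 'k \<Rightarrow> complex"

definition hnorm :: "'k hilbert \<Rightarrow> 'k \<Rightarrow> real" where
  "hnorm K x = sqrt (Re (hinner K x x))"

text \<open>\<^locale>\<open>Metric_space\<close> asks for symmetry and nonnegativity also off the carrier, hence the
  guard.\<close>

definition hdist :: "'k hilbert \<Rightarrow> 'k \<Rightarrow> 'k \<Rightarrow> real" where
  "hdist K x y = (if x \<in> hcarrier K \<and> y \<in> hcarrier K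
     then hnorm K (hadd K x (hscale K (-1) y)) else 0)"

locale inner_product_space =
  fixes K :: "'k hilbert"
  assumes zero_closed: "hzero K \<in> hcarrier K"
    and add_closed: "\<lbrakk>x \<in> hcarrier K; y \<in> hcarrier K\<rbrakk> \<Longrightarrow> hadd K x y \<in> hcarrier K"
    and scale_closed: "x \<in> hcarrier K \<Longrightarrow> hscale K c x \<in> hcarrier K"
    and add_assoc: "\<lbrakk>x \<in> hcarrier K; y \<in> hcarrier K; z \<in> hcarrier K\<rbrakk>
      \<Longrightarrow> hadd K (hadd K x y) z = hadd K x (hadd K y z)"
    and add_commute: "\<lbrakk>x \<in> hcarrier K; y \<in> hcarrier K\<rbrakk> \<Longrightarrow> hadd K x y = hadd K y x"
    and add_zero: "x \<in> hcarrier K \<Longrightarrow> hadd K x (hzero K) = x"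
    and add_inverse: "x \<in> hcarrier K \<Longrightarrow> hadd K x (hscale K (-1) x) = hzero K"
    and scale_add_right: "\<lbrakk>x \<in> hcarrier K; y \<in> hcarrier K\<rbrakk>
      \<Longrightarrow> hscale K c (hadd K x y) = hadd K (hscale K c x) (hscale K c y)"
    and scale_add_left: "x \<in> hcarrier K
      \<Longrightarrow> hscale K (c + d) x = hadd K (hscale K c x) (hscale K d x)"
    and scale_scale: "x \<in> hcarrier K \<Longrightarrow> hscale K c (hscale K d x) = hscale K (c * d) x"
    and scale_one: "x \<in> hcarrier K \<Longrightarrow> hscale K 1 x = x"
    and inner_commute: "\<lbrakk>x \<in> hcarrier K; y \<in> hcarrier K\<rbrakk>
      \<Longrightarrow> hinner K x y = cnj (hinner K y x)"
    and inner_add_left: "\<lbrakk>x \<in> hcarrier K; y \<in> hcarrier K; z \<in> hcarrier K\<rbrakk>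
      \<Longrightarrow> hinner K (hadd K x y) z = hinner K x z + hinner K y z"
    and inner_scale_left: "\<lbrakk>x \<in> hcarrier K; y \<in> hcarrier K\<rbrakk>
      \<Longrightarrow> hinner K (hscale K c x) y = c * hinner K x y"
    and inner_pos: "\<lbrakk>x \<in> hcarrier K; x \<noteq> hzero K\<rbrakk> \<Longrightarrow> 0 < hinner K x x"
begin

lemma inner_add_right:
  assumes "x \<in> hcarrier K" "y \<in> hcarrier K" "z \<in> hcarrier K"
  shows "hinner K x (hadd K y z) = hinner K x y + hinner K x z"
  using assms by (metis add_closed complex_cnj_add inner_add_left inner_commute)

lemma inner_scale_right:
  assumes "x \<in> hcarrier K" "y \<in> hcarrier K"
  shows "hinner K x (hscale K c y) = cnj c * hinner K x y"
  using assms by (metis complex_cnj_mult inner_commute inner_scale_left scale_closed)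

lemma inner_zero: "hinner K (hzero K) (hzero K) = 0"
  by (metis add_cancel_right_left add_zero inner_add_left zero_closed)

lemma inner_ge_0: "x \<in> hcarrier K \<Longrightarrow> 0 \<le> hinner K x x"
  using inner_pos inner_zero by (metis order.order_iff_strict)

lemma inner_self:
  assumes "x \<in> hcarrier K"
  shows "hinner K x x = complex_of_real ((hnorm K x)\<^sup>2)" "0 \<le> hnorm K x"
  using inner_ge_0[OF assms] by (auto simp: hnorm_def less_eq_complex_def complex_eq_iff)

lemma hnorm_eq_0:
  assumes "x \<in> hcarrier K"
  shows "hnorm K x = 0 \<longleftrightarrow> x = hzero K"
proof
  assume "hnorm K x = 0"
  then have "hinner K x x = 0"
    using inner_self(1)[OF assms] by simp
  then show "x = hzero K"
    using inner_pos[OF assms] by force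
qed (simp add: hnorm_def inner_zero)

lemma hnorm_scale:
  assumes "x \<in> hcarrier K"
  shows "hnorm K (hscale K c x) = cmod c * hnorm K x"
proof -
  have "hinner K (hscale K c x) (hscale K c x) = c * cnj c * hinner K x x"
    using assms by (simp add: inner_scale_left inner_scale_right scale_closed)
  also have "\<dots> = complex_of_real ((cmod c * hnorm K x)\<^sup>2)"
    unfolding inner_self(1)[OF assms] complex_norm_square[symmetric]
    by (simp only: power_mult_distrib of_real_mult)
  finally have "hnorm K (hscale K c x) = sqrt ((cmod c * hnorm K x)\<^sup>2)"
    by (simp only: hnorm_def[of K "hscale K c x"] Re_complex_of_real)
  then show ?thesis
    using inner_self(2)[OF assms] by simp
qed

lemma Re_inner_le:
  assumes x: "x \<in> hcarrier K" and y: "y \<in> hcarrier K"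
  shows "Re (hinner K x y) \<le> hnorm K x * hnorm K y"
proof (cases "hnorm K x = 0 \<or> hnorm K y = 0")
  case True
  then have "x = hzero K \<or> y = hzero K"
    using x y hnorm_eq_0 by blast
  moreover have "hinner K (hzero K) y = 0" "hinner K x (hzero K) = 0"
    using x y zero_closed
    by (metis add_cancel_right_left add_zero inner_add_left,
        metis add_cancel_right_left add_zero inner_add_right zero_closed)
  ultimately show ?thesis
    using inner_self(2) x y by fastforce
next
  case False
  define a b where "a = hnorm K x" and "b = hnorm K y"
  have ab: "0 < a" "0 < b"
    using False inner_self(2)[OF x] inner_self(2)[OF y] by (auto simp: a_def b_def)
  let ?u = "hscale K (complex_of_real b) x" and ?v = "hscale K (- complex_of_real a) y"
  have "0 \<le> Re (hinner K (hadd K ?u ?v) (hadd K ?u ?v))"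
    using inner_ge_0[of "hadd K ?u ?v"] x y
    by (simp add: add_closed scale_closed less_eq_complex_def)
  also have "hinner K (hadd K ?u ?v) (hadd K ?u ?v)
      = b * b * hinner K x x - b * a * hinner K x y - a * b * cnj (hinner K x y)
        + a * a * hinner K y y"
    using x y inner_commute[OF y x]
    by (simp add: inner_add_left inner_add_right inner_scale_left inner_scale_right
        add_closed scale_closed algebra_simps)
  also have "Re \<dots> = 2 * (a * b) * (a * b - Re (hinner K x y))"
    by (simp add: inner_self(1)[OF x] inner_self(1)[OF y] flip: a_def b_def)
       (simp add: power2_eq_square algebra_simps)
  finally have "0 \<le> a * b - Re (hinner K x y)"
    using ab by (metis mult_pos_pos zero_le_mult_iff zero_less_numeral not_le)
  then show ?thesis
    by (simp add: a_def b_def)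
qed

lemma hnorm_triangle:
  assumes x: "x \<in> hcarrier K" and y: "y \<in> hcarrier K"
  shows "hnorm K (hadd K x y) \<le> hnorm K x + hnorm K y"
proof (rule power2_le_imp_le)
  have "complex_of_real ((hnorm K (hadd K x y))\<^sup>2) = hinner K (hadd K x y) (hadd K x y)"
    using inner_self(1) add_closed x y by simp
  also have "\<dots> = hinner K x x + hinner K x y + cnj (hinner K x y) + hinner K y y"
    using x y inner_commute[OF y x] by (simp add: inner_add_left inner_add_right add_closed)
  finally have "(hnorm K (hadd K x y))\<^sup>2
      = Re (hinner K x x + hinner K x y + cnj (hinner K x y) + hinner K y y)"
    by (metis Re_complex_of_real)
  also have "\<dots> = (hnorm K x)\<^sup>2 + 2 * Re (hinner K x y) + (hnorm K y)\<^sup>2"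
    by (simp add: inner_self(1)[OF x] inner_self(1)[OF y])
  also have "\<dots> \<le> (hnorm K x + hnorm K y)\<^sup>2"
    using Re_inner_le[OF x y] by (simp add: power2_sum)
  finally show "(hnorm K (hadd K x y))\<^sup>2 \<le> (hnorm K x + hnorm K y)\<^sup>2" .
qed (use inner_self(2) x y in simp)

lemma diff_diff:
  assumes "x \<in> hcarrier K" "y \<in> hcarrier K" "z \<in> hcarrier K"
  shows "hadd K x (hscale K (-1) z)
    = hadd K (hadd K x (hscale K (-1) y)) (hadd K y (hscale K (-1) z))"
proof -
  have "hadd K (hscale K (-1) y) (hadd K y (hscale K (-1) z)) = hscale K (-1) z"
    using assms
    by (metis add_assoc add_commute add_inverse add_zero scale_closed zero_closed)
  then show ?thesis
    using assms by (simp add: add_assoc add_closed scale_closed)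
qed

sublocale Metric_space "hcarrier K" "hdist K"
proof
  fix x y z
  have neg: "hadd K v (hscale K (-1) u) = hscale K (-1) (hadd K u (hscale K (-1) v))"
    if "u \<in> hcarrier K" "v \<in> hcarrier K" for u v
    using that by (simp add: scale_add_right scale_scale scale_one scale_closed add_commute)
  show "0 \<le> hdist K x y"
    by (simp add: hdist_def inner_self(2) add_closed scale_closed)
  show "hdist K x y = hdist K y x"
    using neg[of x y] hnorm_scale[of "hadd K x (hscale K (-1) y)" "-1"]
    by (auto simp: hdist_def add_closed scale_closed)
  assume x: "x \<in> hcarrier K" and y: "y \<in> hcarrier K"
  have "x = y" if "hadd K x (hscale K (-1) y) = hzero K"
    using diff_diff[OF x y zero_closed] that x y
    by (metis add_assoc add_commute add_inverse add_zero scale_closed zero_closed)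
  then show "hdist K x y = 0 \<longleftrightarrow> x = y"
    using x y add_inverse by (auto simp: hdist_def hnorm_eq_0 add_closed scale_closed)
  assume z: "z \<in> hcarrier K"
  show "hdist K x z \<le> hdist K x y + hdist K y z"
    using x y z diff_diff[OF x y z] by (simp add: hdist_def hnorm_triangle add_closed scale_closed)
qed

end

locale hilbert_space = inner_product_space +
  assumes complete: "mcomplete"

abbreviation htopology :: "'k hilbert \<Rightarrow> 'k topology" where
  "htopology K \<equiv> Metric_space.mtopology (hcarrier K) (hdist K)"

definition isometry_into ::
    "'k hilbert \<Rightarrow> ('a::complex_hilbert_space \<Rightarrow> 'k) \<Rightarrow> bool" where
  "isometry_into K \<iota> \<longleftrightarrow>
     (\<forall>x. \<iota> x \<in> hcarrier K) \<and>
     (\<forall>x y. \<iota> (x + y) = hadd K (\<iota> x) (\<iota> y)) \<and>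
     (\<forall>c x. \<iota> (c *\<^sub>C x) = hscale K c (\<iota> x)) \<and>
     (\<forall>x. hnorm K (\<iota> x) = norm x)"

definition adjoint_from ::
    "'k hilbert \<Rightarrow> ('a::complex_hilbert_space \<Rightarrow> 'k) \<Rightarrow> 'k \<Rightarrow> 'a" where
  "adjoint_from K \<iota> k = (THE h. \<forall>x. hinner K (\<iota> x) k = cinner x h)"

definition unitary_on :: "'k hilbert \<Rightarrow> ('k \<Rightarrow> 'k) \<Rightarrow> bool" where
  "unitary_on K U \<longleftrightarrow>
     bij_betw U (hcarrier K) (hcarrier K) \<and>
     (\<forall>x\<in>hcarrier K. \<forall>y\<in>hcarrier K. U (hadd K x y) = hadd K (U x) (U y)) \<and>
     (\<forall>c. \<forall>x\<in>hcarrier K. U (hscale K c x) = hscale K c (U x)) \<and>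
     (\<forall>x\<in>hcarrier K. \<forall>y\<in>hcarrier K. hinner K (U x) (U y) = hinner K x y)"

definition unitary_representation ::
    "'k hilbert \<Rightarrow> (real \<times> real \<Rightarrow> 'k \<Rightarrow> 'k) \<Rightarrow> bool" where
  "unitary_representation K \<rho> \<longleftrightarrow>
     (\<forall>t. unitary_on K (\<rho> t)) \<and>
     (\<forall>x\<in>hcarrier K. \<rho> 0 x = x) \<and>
     (\<forall>s t. \<forall>x\<in>hcarrier K. \<rho> (s + t) x = \<rho> s (\<rho> t x)) \<and>
     (\<forall>x\<in>hcarrier K. continuous_map euclidean (htopology K) (\<lambda>t. \<rho> t x))"

definition commutative_unitary_dilation ::
    "(real \<times> real \<Rightarrow> 'a \<Rightarrow> 'a::complex_hilbert_space) \<Rightarrow>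
     'k hilbert \<Rightarrow> ('a \<Rightarrow> 'k) \<Rightarrow> (real \<times> real \<Rightarrow> 'k \<Rightarrow> 'k) \<Rightarrow> bool" where
  "commutative_unitary_dilation T K \<iota> \<rho> \<longleftrightarrow>
     hilbert_space K \<and> isometry_into K \<iota> \<and> unitary_representation K \<rho> \<and>
     (\<forall>t1 t2. 0 \<le> t1 \<longrightarrow> 0 \<le> t2 \<longrightarrow>
        (\<forall>x. adjoint_from K \<iota> (\<rho> (t1, t2) (\<iota> x)) = T (t1, t2) x))"

text \<open>The elements of the dilation space are taken from the type \<^typ>\<open>real \<times> real \<Rightarrow> 'a\<close>, at no
  loss of generality: a dilation \<open>(K, \<iota>, \<rho>)\<close> on any type restricts to the closed linear span of
  all \<open>\<rho> t (\<iota> x)\<close>, and there \<open>k \<mapsto> (\<lambda>t. \<iota>\<^sup>* (\<rho> t k))\<close> is injective, so that the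
  structure can be transported to a set of functions of this type.\<close>

definition admits_commutative_unitary_dilation ::
    "(real \<times> real \<Rightarrow> 'a \<Rightarrow> 'a::complex_hilbert_space) \<Rightarrow> bool" where
  "admits_commutative_unitary_dilation T \<longleftrightarrow>
     (\<exists>(K :: (real \<times> real \<Rightarrow> 'a) hilbert) \<iota> \<rho>. commutative_unitary_dilation T K \<iota> \<rho>)"

end

theory Submission
  imports Defs "HOL-Library.Function_Algebras"
begin

text \<open>By Ando's theorem a pair of commuting contractions has a commuting unitary dilation, and this
  passes to two-parameter semigroups (Slocinski). Put \<open>B\<^sub>j = i A\<^sub>j\<close>. Dissipativity
  makes the damped Euler steps \<open>T\<^sub>j = r\<^sub>n (1 + B\<^sub>j / n)\<close>, \<open>r\<^sub>n = n\<^sup>2 / (n\<^sup>2 + C\<^sup>2 + 1)\<close>, strict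
  contractions. For these Ando's construction is algebraic: finitely supported sequences suffice, and
  invertibility of \<open>1 - T\<^sup>* T\<close> replaces the usual dimension count. It gives a positive definite
  function on \<open>\<int>\<^sup>2\<close> extending \<open>(a, b) \<mapsto> T\<^sub>1\<^sup>a T\<^sub>2\<^sup>b\<close>. Rescaling by \<open>1 / n\<close> and taking a weak
  cluster point yields a positive definite function on \<open>\<real>\<^sup>2\<close> that extends the semigroup. Its
  reproducing kernel Hilbert space, with translations acting, is the dilation; strong continuity is
  inherited from the semigroup at \<open>0\<close>.\<close>

section \<open>Inner products and adjoints\<close>

text \<open>The dilation spaces of the discrete pairs are unrelated for different \<open>n\<close>,
  so the limit is taken of their kernels: the scalars \<open>\<psi> n g x y\<close> are bounded by
  \<open>norm x * norm y\<close>, and being Hermitian, sesquilinear and positive survives pointwise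
  limits. On the closed quadrant the limit is forced, because Euler products converge; elsewhere any
  cluster value will do. The damping reconciles two demands. Dissipativity alone leaves the factor
  \<open>1 + C\<^sup>2 / n\<^sup>2\<close> in the bound for the squared norm of an Euler step, so
  each step has to be shrunk; yet about \<open>n\<close> steps are composed per unit of time, so the
  shrinking must be of smaller order than \<open>1 / n\<close>. The excess is of order
  \<open>1 / n\<^sup>2\<close>, which leaves room for both and for strictness. Strictness lets
  square roots and inverses be found as fixed points of contractions and gives Ando's unitary an
  explicit formula. Commuting isometries then determine the positive definite function, since
  negative exponents can be moved to the other argument of the inner product.\<close>

context inner_product_space
begin

text \<open>The bound for the real part, applied after a unimodular factor on \<open>x\<close> has
  made the inner product equal to its modulus.\<close>

lemma cmod_inner_le:
  assumes x: "x \<in> hcarrier K" and y: "y \<in> hcarrier K"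
  shows "cmod (hinner K x y) \<le> hnorm K x * hnorm K y"
proof (cases "hinner K x y = 0")
  case False
  define c where "c = cnj (sgn (hinner K x y))"
  have c: "cmod c = 1"
    using False by (simp add: c_def norm_sgn)
  have "cmod (hinner K x y) = Re (c * hinner K x y)"
    using False by (simp add: c_def sgn_eq complex_norm_square[symmetric] power2_eq_square
        mult.commute[of "cnj _"] flip: of_real_mult)
  also have "\<dots> = Re (hinner K (hscale K c x) y)"
    using x y by (simp add: inner_scale_left)
  also have "\<dots> \<le> hnorm K (hscale K c x) * hnorm K y"
    using x y by (intro Re_inner_le scale_closed)
  finally show ?thesis
    using x c by (simp add: hnorm_scale)
qed (use inner_self(2) x y in simp)

end

text \<open>Views a type of the class as an object, so that Cauchy-Schwarz and homogeneity of the
  norm carry over from the locale to types.\<close>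

definition type_hilbert :: "'a::complex_hilbert_space hilbert" where
  "type_hilbert = \<lparr>hcarrier = UNIV, hzero = 0, hadd = (+), hscale = (*\<^sub>C), hinner = cinner\<rparr>"

lemma cinner_add_right: "cinner x (y + z) = cinner x y + cinner x z"
  by (metis cinner_add_left cinner_commute complex_cnj_add)

lemma cinner_scaleC_right: "cinner x (c *\<^sub>C y) = cnj c * cinner x y"
  by (metis cinner_scaleC_left cinner_commute complex_cnj_mult)

lemma cinner_zero_left [simp]: "cinner 0 x = 0"
  by (metis add_cancel_right_right cinner_add_left add.right_neutral)

lemma cinner_zero_right [simp]: "cinner x 0 = 0"
  by (metis add_cancel_right_right cinner_add_right add.right_neutral)

lemma cinner_minus_left [simp]: "cinner (- x) y = - cinner x y"
  by (metis add.inverse_inverse cinner_add_left cinner_zero_left eq_neg_iff_add_eq_0)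

lemma cinner_minus_right [simp]: "cinner x (- y) = - cinner x y"
  by (metis cinner_commute cinner_minus_left complex_cnj_minus)

lemma cinner_diff_left: "cinner (x - y) z = cinner x z - cinner y z"
  using cinner_add_left[of x "- y" z] by simp

lemma cinner_diff_right: "cinner x (y - z) = cinner x y - cinner x z"
  using cinner_add_right[of x y "- z"] by simp

lemma cinner_scaleR_left: "cinner (r *\<^sub>R x) y = r * cinner x y"
  by (metis cinner_scaleC_left scaleC_of_real)

lemma cinner_scaleR_right: "cinner x (r *\<^sub>R y) = r * cinner x y"
  by (metis cinner_scaleC_right scaleC_of_real complex_cnj_complex_of_real)

lemma scaleC_one [simp]: "1 *\<^sub>C x = x"
  using scaleC_of_real[of 1 x] by simp

lemma scaleC_zero_left [simp]: "0 *\<^sub>C x = 0"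
  using scaleC_of_real[of 0 x] by simp

lemma scaleC_zero_right [simp]: "c *\<^sub>C 0 = 0"
  by (metis add_cancel_right_right scaleC_add_right add.right_neutral)

lemma scaleC_minus_one: "(-1) *\<^sub>C x = - x"
  using scaleC_of_real[of "-1" x] by simp

lemma scaleC_minus_right: "c *\<^sub>C (- x) = - (c *\<^sub>C x)"
  by (metis add.right_inverse eq_neg_iff_add_eq_0 add.commute scaleC_add_right scaleC_zero_right)

lemma scaleC_diff_right: "c *\<^sub>C (x - y) = c *\<^sub>C x - c *\<^sub>C y"
  using scaleC_add_right[of c x "- y"] by (simp add: scaleC_minus_right)

lemma scaleC_scaleR_commute: "c *\<^sub>C (r *\<^sub>R x) = r *\<^sub>R (c *\<^sub>C x)"
  by (metis mult.commute scaleC_of_real scaleC_scaleC)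

lemma cinner_self: "cinner x x = complex_of_real ((norm x)\<^sup>2)"
proof -
  have "Im (cinner x x) = 0"
    using cinner_commute[of x x] by (metis complex_cnj_cancel_iff complex_cnj_complex_of_real
        complex_is_Real_iff Reals_cnj_iff)
  \<comment> \<open>\<open>sqrt\<close> is negative on negative reals, so the sign of the norm
    decides the sign of its argument.\<close>
  moreover have "0 \<le> Re (cinner x x)"
    using norm_eq_sqrt_cinner[of x] norm_ge_zero[of x] by (metis real_sqrt_ge_0_iff)
  ultimately show ?thesis
    using norm_eq_sqrt_cinner[of x] by (simp add: complex_eq_iff)
qed

interpretation type_hilbert: inner_product_space type_hilbert
proof
  fix x y :: 'a
  show "0 < hinner type_hilbert x x"
    if "x \<in> hcarrier type_hilbert" "x \<noteq> hzero type_hilbert"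
    using that by (simp add: type_hilbert_def cinner_self less_complex_def)
  show "hinner type_hilbert x y = cnj (hinner type_hilbert y x)"
    by (simp add: type_hilbert_def cinner_commute[of x y])
qed (auto simp: type_hilbert_def scaleC_minus_one add_ac scaleC_add_right scaleC_add_left
    scaleC_scaleC cinner_add_left cinner_scaleC_left)

lemma cmod_cinner_le: "cmod (cinner x y) \<le> norm x * norm y"
  using type_hilbert.cmod_inner_le[of x y]
  by (simp add: type_hilbert_def hnorm_def norm_eq_sqrt_cinner)

lemma norm_scaleC: "norm (c *\<^sub>C x) = cmod c * norm x"
  using type_hilbert.hnorm_scale[of x c]
  by (simp add: type_hilbert_def hnorm_def norm_eq_sqrt_cinner)

lemma norm_add_sq:
  "(norm (x + y))\<^sup>2 = (norm x)\<^sup>2 + 2 * Re (cinner x y) + (norm y)\<^sup>2"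
proof -
  have "complex_of_real ((norm (x + y))\<^sup>2)
      = (norm x)\<^sup>2 + (cinner x y + cnj (cinner x y)) + (norm y)\<^sup>2"
    unfolding cinner_self[symmetric] cinner_commute[of y x, symmetric]
    by (simp add: cinner_add_left cinner_add_right)
  then have "Re (complex_of_real ((norm (x + y))\<^sup>2))
      = Re ((norm x)\<^sup>2 + (cinner x y + cnj (cinner x y)) + (norm y)\<^sup>2)"
    by simp
  then show ?thesis
    by simp
qed

lemma norm_diff_sq:
  "(norm (x - y))\<^sup>2 = (norm x)\<^sup>2 - 2 * Re (cinner x y) + (norm y)\<^sup>2"
  using norm_add_sq[of x "- y"] by simp

lemma bounded_linear_cinner_left: "bounded_linear (\<lambda>x. cinner x y)"
  by (rule bounded_linear_intro[where K = "norm y"])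
    (auto simp: cinner_add_left cinner_scaleR_left scaleR_conv_of_real cmod_cinner_le)

lemma bounded_linear_cinner_right: "bounded_linear (\<lambda>y. cinner x y)"
  by (rule bounded_linear_intro[where K = "norm x"])
    (auto simp: cinner_add_right cinner_scaleR_right scaleR_conv_of_real mult.commute
      intro: order_trans[OF cmod_cinner_le])

lemmas tendsto_cinner_left = bounded_linear.tendsto[OF bounded_linear_cinner_left]

lemma bounded_linear_scaleC: "bounded_linear (\<lambda>x::'a::complex_hilbert_space. c *\<^sub>C x)"
  by (rule bounded_linear_intro[where K = "cmod c"])
    (auto simp: scaleC_add_right scaleC_scaleR_commute norm_scaleC mult.commute)

lemma cinner_eqI: "(\<And>z. cinner x z = cinner y z) \<Longrightarrow> x = y"
  by (metis cinner_diff_left cinner_self eq_iff_diff_eq_0 norm_eq_zero of_real_eq_0_iff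
      power_eq_0_iff)

lemma cinner_eqI2: "(\<And>z. cinner z x = cinner z y) \<Longrightarrow> x = y"
  by (metis cinner_commute cinner_eqI)

text \<open>The representing vector minimises \<open>u \<mapsto> \<parallel>u\<parallel>\<^sup>2 - 2 Re (f u)\<close>; by the parallelogram law
  minimising sequences are Cauchy.\<close>

lemma riesz_representation:
  fixes f :: "'a::complex_hilbert_space \<Rightarrow> complex"
  assumes add: "\<And>x y. f (x + y) = f x + f y" and scale: "\<And>c x. f (c *\<^sub>C x) = c * f x"
    and bound: "\<And>x. cmod (f x) \<le> K * norm x"
  shows "\<exists>!u. \<forall>x. f x = cinner x u"
proof (rule ex_ex1I)
  have f_scaleR: "f (r *\<^sub>R x) = r * f x" for r x
    by (metis scale scaleC_of_real)
  have lin: "bounded_linear f"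
    by (rule bounded_linear_intro[where K = K])
      (auto simp: add f_scaleR scaleR_conv_of_real bound mult.commute[of _ K])
  define J where "J u = (norm u)\<^sup>2 - 2 * Re (f u)" for u
  have J_lower: "- K\<^sup>2 \<le> J u" for u
  proof -
    have "Re (f u) \<le> K * norm u"
      using bound[of u] complex_Re_le_cmod order_trans by blast
    moreover have "0 \<le> (norm u - K)\<^sup>2"
      by simp
    ultimately show ?thesis
      by (simp add: J_def power2_diff algebra_simps)
  qed
  define m where "m = Inf (range J)"
  have bdd: "bdd_below (range J)"
    using J_lower by (intro bdd_belowI[where m = "- K\<^sup>2"]) auto
  have m_le: "m \<le> J u" for u
    unfolding m_def by (rule cInf_lower) (auto simp: bdd)
  have "\<exists>u. J u < m + inverse (Suc n)" for n
    using cInf_lessD[of "range J" "m + inverse (Suc n)"] unfolding m_def by force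
  then obtain u where u: "J (u n) < m + inverse (Suc n)" for n
    by metis
  \<comment> \<open>The midpoint of \<open>v\<close> and \<open>w\<close> also has \<open>J\<close>
    at least \<open>m\<close>; in the parallelogram law this bounds their distance by the excess of
    \<open>J\<close> over its infimum.\<close>
  have diff: "(norm (v - w))\<^sup>2 \<le> 2 * (J v - m) + 2 * (J w - m)" for v w
  proof -
    have "(norm (v + w))\<^sup>2 + (norm (v - w))\<^sup>2 = 2 * (norm v)\<^sup>2 + 2 * (norm w)\<^sup>2"
      by (simp add: norm_add_sq norm_diff_sq)
    moreover have "m \<le> J ((1/2) *\<^sub>R (v + w))"
      by (rule m_le)
    then have "4 * m \<le> (norm (v + w))\<^sup>2 - 4 * Re (f v + f w)"
      by (simp add: J_def f_scaleR add power_divide) (simp add: field_simps)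
    ultimately show ?thesis
      by (simp add: J_def)
  qed
  have "Cauchy u"
  proof (rule metric_CauchyI)
    fix e :: real assume "e > 0"
    then obtain N where N: "inverse (Suc N) < e\<^sup>2 / 4"
      using reals_Archimedean[of "e\<^sup>2 / 4"] by auto
    have "dist (u k) (u l) < e" if "k \<ge> N" "l \<ge> N" for k l
    proof -
      have "inverse (real (Suc j)) \<le> inverse (Suc N)" if "j \<ge> N" for j
        using that by (simp add: field_simps)
      then have J_small: "J (u j) - m < e\<^sup>2 / 4" if "j \<ge> N" for j
        using u[of j] N that by (smt (verit))
      have "(norm (u k - u l))\<^sup>2 < e\<^sup>2"
        using diff[of "u k" "u l"] add_strict_mono[OF J_small[OF that(1)] J_small[OF that(2)]]
        by (simp add: field_simps)
      then show ?thesis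
        using \<open>e > 0\<close> by (simp add: dist_norm power_less_imp_less_base)
    qed
    then show "\<exists>M. \<forall>k\<ge>M. \<forall>l\<ge>M. dist (u k) (u l) < e"
      by blast
  qed
  then obtain v where v: "u \<longlonglongrightarrow> v"
    using Cauchy_convergent convergent_def by blast
  have "(\<lambda>n. J (u n)) \<longlonglongrightarrow> J v"
    unfolding J_def by (intro tendsto_intros v bounded_linear.tendsto[OF lin])
  moreover have "(\<lambda>n. m + inverse (real (Suc n))) \<longlonglongrightarrow> m + 0"
    by (intro tendsto_intros LIMSEQ_inverse_real_of_nat)
  ultimately have "J v \<le> m"
    using u by (intro LIMSEQ_le[of "\<lambda>n. J (u n)" "J v" "\<lambda>n. m + inverse (real (Suc n))" m])
      (auto intro!: exI[of _ 0] less_imp_le)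
  then have min: "J v \<le> J w" for w
    using m_le[of w] by simp
  \<comment> \<open>Minimality of \<open>J\<close> on the line through \<open>v\<close> in direction
    \<open>x\<close> makes a quadratic in \<open>t\<close> without constant term nonnegative, so its
    linear coefficient \<open>b\<close> vanishes.\<close>
  have Re0: "Re (cinner x v) = Re (f x)" for x
  proof -
    define b where "b = Re (cinner x v) - Re (f x)"
    have *: "0 \<le> 2 * t * b + t\<^sup>2 * (norm x)\<^sup>2" for t
    proof -
      have "Re (cinner v x) = Re (cinner x v)"
        using cinner_commute[of v x] by simp
      then show ?thesis
        using min[of "v + t *\<^sub>R x"]
        by (simp add: J_def norm_add_sq add f_scaleR cinner_scaleR_right b_def algebra_simps
            power_mult_distrib)
    qed
    show ?thesis
    proof (rule ccontr)
      assume "Re (cinner x v) \<noteq> Re (f x)"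
      then have "b \<noteq> 0"
        by (simp add: b_def)
      \<comment> \<open>The minimiser of the quadratic, up to the added \<open>1\<close> that keeps
        the denominator positive.\<close>
      define t where "t = - b / ((norm x)\<^sup>2 + 1)"
      have "t * ((norm x)\<^sup>2 + 1) = - b"
        by (simp add: t_def add_nonneg_eq_0_iff)
      then have "t\<^sup>2 * (norm x)\<^sup>2 = - b * t - t\<^sup>2"
        by (simp add: power2_eq_square) algebra
      then have "t * b \<ge> t\<^sup>2"
        using *[of t] by (simp add: algebra_simps)
      moreover have "t * b \<le> 0"
        by (simp add: t_def divide_nonpos_pos add_nonneg_pos)
      ultimately have "t = 0"
        by (metis order_trans power2_less_eq_zero_iff)
      then show False
        using \<open>b \<noteq> 0\<close> \<open>t * ((norm x)\<^sup>2 + 1) = - b\<close> by simp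
    qed
  qed
  have "f x = cinner x v" for x
  proof (rule complex_eqI)
    \<comment> \<open>Multiplication by \<open>\<i>\<close> turns imaginary parts into real parts up
      to sign.\<close>
    show "Im (f x) = Im (cinner x v)"
      using Re0[of "\<i> *\<^sub>C x"] by (simp add: cinner_scaleC_left scale)
  qed (simp add: Re0)
  then show "\<exists>u. \<forall>x. f x = cinner x u"
    by blast
qed (metis cinner_eqI2)

section \<open>Adjoints and dissipativity\<close>

lemma bounded_clinear_simps:
  assumes "bounded_clinear A"
  shows "A (x + y) = A x + A y" "A (x - y) = A x - A y" "A (c *\<^sub>C x) = c *\<^sub>C A x"
    "A (r *\<^sub>R x) = r *\<^sub>R A x" "A (- x) = - A x" "A 0 = 0"
  using assms unfolding bounded_clinear_def
  by (auto simp: bounded_linear.linear linear_add linear_diff linear_scale linear_neg linear_0)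

text \<open>For each \<open>y\<close>, Riesz represents the functional
  \<open>\<lambda>x. cinner (A x) y\<close>; uniqueness of the representing vector makes the
  definite description in \<open>cadjoint\<close> denote.\<close>

lemma cadjoint:
  fixes A :: "'a::complex_hilbert_space \<Rightarrow> 'b::complex_hilbert_space"
  assumes "bounded_clinear A"
  shows "cinner (A x) y = cinner x (cadjoint A y)"
proof -
  note A = bounded_clinear_simps[OF assms]
  obtain K where K: "norm (A x) \<le> norm x * K" for x
    using assms bounded_linear.bounded unfolding bounded_clinear_def by blast
  have "\<exists>!u. \<forall>x. cinner (A x) y = cinner x u" for y
  proof (rule riesz_representation[where K = "K * norm y"])
    show "cmod (cinner (A x) y) \<le> K * norm y * norm x" for x
      using cmod_cinner_le[of "A x" y] mult_right_mono[OF K[of x], of "norm y"]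
      by (simp add: mult_ac)
  qed (auto simp: A cinner_add_left cinner_scaleC_left)
  then obtain B where B: "\<And>x y. cinner (A x) y = cinner x (B y)"
    by metis
  have "\<forall>x y. cinner (A x) y = cinner x (cadjoint A y)"
    unfolding cadjoint_def
  proof (rule theI[where a = B])
    show "C = B" if "\<forall>x y. cinner (A x) y = cinner x (C y)" for C
      using that B by (metis cinner_eqI2 ext)
  qed (use B in blast)
  then show ?thesis
    by blast
qed

text \<open>The quadratic form in the definition of dissipativity is the imaginary part of
  \<open>cinner (A x) x\<close>. For \<open>\<i> *\<^sub>C A x\<close> it becomes the negative of a
  real part.\<close>

lemma dissipative_Im_nonneg:
  assumes "bounded_clinear A" "dissipative A"
  shows "0 \<le> Im (cinner (A x) x)"
proof -
  have "0 \<le> cinner ((1 / (2 * \<i>)) *\<^sub>C (A x - cadjoint A x)) x"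
    using assms(2) by (auto simp: dissipative_def positive_operator_def)
  moreover have "cinner (cadjoint A x) x = cnj (cinner (A x) x)"
    using cadjoint[OF assms(1), of x x] by (metis cinner_commute)
  ultimately show ?thesis
    by (simp add: cinner_scaleC_left cinner_diff_left less_eq_complex_def field_simps Re_divide
        Im_divide)
qed

section \<open>Square roots and unitary extensions\<close>

text \<open>Having an adjoint already forces linearity of both maps
  (\<open>adjoint_pair_linear\<close>). Operators are therefore carried along with an explicit
  adjoint, which is easy to write down for sums and compositions.\<close>

definition adjoint_pair ::
    "('a::complex_hilbert_space \<Rightarrow> 'b::complex_hilbert_space) \<Rightarrow> ('b \<Rightarrow> 'a) \<Rightarrow> bool" where
  "adjoint_pair A B \<longleftrightarrow> (\<forall>x y. cinner (A x) y = cinner x (B y))"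

lemma adjoint_pairD: "adjoint_pair A B \<Longrightarrow> cinner (A x) y = cinner x (B y)"
  by (simp add: adjoint_pair_def)

lemma adjoint_pair_sym: "adjoint_pair A B \<Longrightarrow> adjoint_pair B A"
  unfolding adjoint_pair_def by (metis cinner_commute)

lemma adjoint_pair_compose:
  "\<lbrakk>adjoint_pair A B; adjoint_pair C D\<rbrakk> \<Longrightarrow> adjoint_pair (\<lambda>x. A (C x)) (\<lambda>y. D (B y))"
  by (simp add: adjoint_pair_def)

lemma adjoint_pair_linear:
  assumes "adjoint_pair A B"
  shows "A (x + y) = A x + A y" "A (x - y) = A x - A y" "A (c *\<^sub>C x) = c *\<^sub>C A x"
    "A (r *\<^sub>R x) = r *\<^sub>R A x" "A 0 = 0"
proof -
  note AB = adjoint_pairD[OF assms]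
  show "A (x + y) = A x + A y" "A (x - y) = A x - A y" "A (c *\<^sub>C x) = c *\<^sub>C A x"
    "A (r *\<^sub>R x) = r *\<^sub>R A x" "A 0 = 0"
    by (rule cinner_eqI; simp add: AB cinner_add_left cinner_diff_left cinner_scaleC_left
        cinner_scaleR_left)+
qed

text \<open>\<open>R u\<close> is the fixed point of the contraction
  \<open>\<lambda>x. u + X x\<close>; self-adjointness passes from \<open>1 - X\<close> to its
  inverse.\<close>

lemma neumann_inverse:
  fixes X :: "'a::complex_hilbert_space \<Rightarrow> 'a"
  assumes X: "adjoint_pair X X" and q: "0 \<le> q" "q < 1" and bound: "\<And>u. norm (X u) \<le> q * norm u"
  obtains R where "adjoint_pair R R" "\<And>u. R u - X (R u) = u" "\<And>u. R (u - X u) = u"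
proof -
  note lin = adjoint_pair_linear[OF X]
  have ex: "\<exists>!x. u + X x = x" for u
  proof (rule banach_fix_type[OF q])
    show "\<forall>x y. dist (u + X x) (u + X y) \<le> q * dist x y"
      using bound by (auto simp: dist_norm simp flip: lin(2))
  qed
  then obtain R where R: "u + X (R u) = R u" for u
    by metis
  have 1: "R u - X (R u) = u" for u
    using R[of u] by (metis add_diff_cancel_right')
  have 2: "R (u - X u) = u" for u
    using ex[of "u - X u"] R[of "u - X u"] by (metis diff_add_cancel)
  have "cinner (R u) v = cinner u (R v)" for u v
  proof -
    have "cinner (R u) v = cinner (R u) (R v - X (R v))"
      by (simp only: 1)
    also have "\<dots> = cinner (R u - X (R u)) (R v)"
      by (simp add: cinner_diff_left cinner_diff_right adjoint_pairD[OF X])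
    finally show ?thesis
      by (simp only: 1)
  qed
  then show ?thesis
    using that[of R] 1 2 by (simp add: adjoint_pair_def)
qed

text \<open>If \<open>2 Y = X + Y\<^sup>2\<close> then \<open>1 - Y\<close> is a square root of \<open>1 - X\<close>, and \<open>Y\<close> is the fixed point
  of a contraction of the ball of radius \<open>1 - \<surd>(1 - q)\<close>.\<close>

lemma sqrt_one_minus:
  fixes X :: "'a::complex_hilbert_space \<Rightarrow> 'a"
  assumes X: "adjoint_pair X X" and q: "0 \<le> q" "q < 1" and bound: "\<And>u. norm (X u) \<le> q * norm u"
  obtains D where "adjoint_pair D D" "\<And>u. D (D u) = u - X u"
proof -
  \<comment> \<open>The smaller root of \<open>2 * \<rho> = q + \<rho> * \<rho>\<close>, the scalar
    form of the equation for \<open>Y\<close>. This makes the ball of radius \<open>\<rho>\<close>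
    invariant, and \<open>\<rho>\<close> is also the Lipschitz constant on it.\<close>
  define \<rho> where "\<rho> = 1 - sqrt (1 - q)"
  have \<rho>: "0 \<le> \<rho>" "\<rho> < 1" "(q + \<rho> * \<rho>) / 2 = \<rho>"
  proof -
    have *: "(q + (1 - s) * (1 - s)) / 2 = 1 - s" if "s * s = 1 - q" for s
      using that by (simp add: algebra_simps diff_divide_distrib)
    show "(q + \<rho> * \<rho>) / 2 = \<rho>"
      unfolding \<rho>_def by (rule *) (use q in simp)
  qed (use q in \<open>auto simp: \<rho>_def\<close>)
  have "bounded_linear X"
    using bound adjoint_pair_linear[OF X]
    by (intro bounded_linear_intro[where K = q]) (auto simp: mult.commute)
  then obtain Xb where Xb: "blinfun_apply Xb = X"
    using bounded_linear_Blinfun_apply by blast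
  have normX: "norm Xb \<le> q"
    using bound q by (intro norm_blinfun_bound) (auto simp: Xb)
  \<comment> \<open>Self-adjointness is a closed condition preserved by \<open>f\<close>, so putting
    it into the complete set makes the fixed point self-adjoint.\<close>
  define S where "S = cball 0 \<rho> \<inter> {y :: 'a \<Rightarrow>\<^sub>L 'a. adjoint_pair y y}"
  define f where "f y = (1/2) *\<^sub>R (Xb + (y o\<^sub>L y))" for y
  have "closed {y :: 'a \<Rightarrow>\<^sub>L 'a. adjoint_pair y y}"
    unfolding adjoint_pair_def
    by (intro closed_Collect_all closed_Collect_eq
        bounded_linear.continuous_on[OF bounded_linear_cinner_left]
        bounded_linear.continuous_on[OF bounded_linear_cinner_right] continuous_intros)
  then have "complete S"
    by (simp add: S_def closed_Int complete_eq_closed)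
  moreover have "S \<noteq> {}"
  proof -
    have "0 \<in> S"
      using \<rho> by (simp add: S_def adjoint_pair_def)
    then show ?thesis
      by blast
  qed
  moreover have "f ` S \<subseteq> S"
  proof safe
    fix y assume y: "y \<in> S"
    have ny: "norm y \<le> \<rho>"
      using y by (simp add: S_def)
    have "norm (y o\<^sub>L y) \<le> \<rho> * \<rho>"
      using order_trans[OF norm_blinfun_compose mult_mono[OF ny ny]] \<rho> by simp
    then have "norm (Xb + (y o\<^sub>L y)) \<le> q + \<rho> * \<rho>"
      using normX norm_triangle_ineq[of Xb "y o\<^sub>L y"] by linarith
    then have "norm (f y) \<le> \<rho>"
      using \<rho>(3) by (simp add: f_def)
    moreover have "adjoint_pair (f y) (f y)"
      using y X unfolding S_def f_def adjoint_pair_def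
      by (simp add: blinfun.bilinear_simps Xb cinner_scaleR_left cinner_scaleR_right
          cinner_add_left cinner_add_right)
    ultimately show "f y \<in> S"
      by (simp add: S_def)
  qed
  moreover have "dist (f y) (f z) \<le> \<rho> * dist y z" if "y \<in> S" "z \<in> S" for y z
  proof -
    have n: "norm y \<le> \<rho>" "norm z \<le> \<rho>"
      using that by (auto simp: S_def)
    \<comment> \<open>The difference of squares is split in a way that does not require
      \<open>y\<close> and \<open>z\<close> to commute.\<close>
    have "f y - f z = (1/2) *\<^sub>R ((y o\<^sub>L (y - z)) + ((y - z) o\<^sub>L z))"
      by (simp add: f_def blinfun_eqI blinfun.bilinear_simps algebra_simps)
    then have "norm (f y - f z) \<le> 1/2 * (norm (y o\<^sub>L (y - z)) + norm ((y - z) o\<^sub>L z))"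
      by (simp add: norm_triangle_ineq)
    also have "\<dots> \<le> 1/2 * (norm y * norm (y - z) + norm (y - z) * norm z)"
      by (intro mult_left_mono add_mono norm_blinfun_compose) auto
    also have "\<dots> \<le> 1/2 * (\<rho> * norm (y - z) + norm (y - z) * \<rho>)"
      using n by (intro mult_left_mono add_mono mult_right_mono) auto
    finally show ?thesis
      by (simp add: dist_norm mult.commute)
  qed
  ultimately obtain Y where Y: "Y \<in> S" "f Y = Y"
    using Banach_fix[of S \<rho> f] \<rho> by blast
  have fix_eq: "X u = 2 *\<^sub>R Y u - Y (Y u)" for u
  proof -
    have "Y u = (1/2) *\<^sub>R (X u + Y (Y u))"
      using arg_cong[OF Y(2), of "\<lambda>y. blinfun_apply y u"]
      by (simp add: f_def blinfun.bilinear_simps Xb)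
    then have "2 *\<^sub>R Y u = 2 *\<^sub>R ((1/2) *\<^sub>R (X u + Y (Y u)))"
      by (rule arg_cong)
    then show ?thesis
      by simp
  qed
  show ?thesis
  proof (rule that[of "\<lambda>u. u - Y u"])
    show "adjoint_pair (\<lambda>u. u - Y u) (\<lambda>u. u - Y u)"
      using Y(1) by (simp add: S_def adjoint_pair_def cinner_diff_left cinner_diff_right)
    show "u - Y u - Y (u - Y u) = u - X u" for u
      by (simp add: fix_eq blinfun.bilinear_simps scaleR_2)
  qed
qed

section \<open>Direct sums and unitary extension\<close>

instantiation prod :: (complex_hilbert_space, complex_hilbert_space) complex_hilbert_space
begin

definition scaleC_prod_def: "scaleC c x = (scaleC c (fst x), scaleC c (snd x))"
definition cinner_prod_def: "cinner x y = cinner (fst x) (fst y) + cinner (snd x) (snd y)"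

instance
proof
  fix c d :: complex and r :: real and x y z :: "'a \<times> 'b"
  show "c *\<^sub>C (x + y) = c *\<^sub>C x + c *\<^sub>C y" "(c + d) *\<^sub>C x = c *\<^sub>C x + d *\<^sub>C x"
    "c *\<^sub>C (d *\<^sub>C x) = (c * d) *\<^sub>C x" "complex_of_real r *\<^sub>C x = r *\<^sub>R x"
    by (simp_all add: scaleC_prod_def scaleC_add_right scaleC_add_left scaleC_scaleC
        scaleC_of_real scaleR_prod_def)
  show "cinner x y = cnj (cinner y x)"
    by (simp add: cinner_prod_def cinner_commute[of "fst x" "fst y"] cinner_commute[of "snd x" "snd
        y"])
  show "cinner (x + y) z = cinner x z + cinner y z" "cinner (c *\<^sub>C x) y = c * cinner x y"
    by (simp_all add: cinner_prod_def scaleC_prod_def cinner_add_left cinner_scaleC_left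
        algebra_simps)
  show "norm x = sqrt (Re (cinner x x))"
    by (simp only: cinner_prod_def cinner_self norm_prod_def plus_complex.sel Re_complex_of_real)
qed

end

lemma cinner_Pair [simp]: "cinner (a, b) (c, d) = cinner a c + cinner b d"
  by (simp add: cinner_prod_def)

text \<open>The partial isometry \<open>u = F (E\<^sup>* E)\<inverse> E\<^sup>*\<close> maps \<open>E h\<close> to \<open>F h\<close>, and the Halmos matrix
  with rows \<open>u, 1 - u u\<^sup>*\<close> and \<open>1 - u\<^sup>* u, u\<^sup>*\<close> is a unitary extension of it.\<close>

lemma unitary_extension:
  fixes E F :: "'h::complex_hilbert_space \<Rightarrow> 'y::complex_hilbert_space"
  assumes E: "adjoint_pair E E'" and F: "adjoint_pair F F'"
    and EE: "\<And>h. E' (E h) = h - X h" and FF: "\<And>h. F' (F h) = h - X h"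
    and X: "adjoint_pair X X" and q: "0 \<le> q" "q < 1" and bound: "\<And>u. norm (X u) \<le> q * norm u"
  obtains G G' :: "'y \<times> 'y \<Rightarrow> 'y \<times> 'y"
  where "adjoint_pair G G'" "\<And>a. G (G' a) = a" "\<And>a. G' (G a) = a" "\<And>h. G (E h, 0) = (F h, 0)"
proof -
  obtain R where R: "adjoint_pair R R" and R1: "\<And>u. R u - X (R u) = u" and R2: "\<And>u. R (u - X u) = u"
    using neumann_inverse[OF X q bound] by blast
  define u where "u y = F (R (E' y))" for y
  define u' where "u' y = E (R (F' y))" for y
  have uu': "adjoint_pair u u'"
    unfolding u_def u'_def
    by (intro adjoint_pair_compose[OF F] adjoint_pair_compose[OF R] adjoint_pair_sym[OF E])
  \<comment> \<open>Since \<open>E' E\<close> and \<open>F' F\<close> are the same operator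
    \<open>1 - X\<close>, inverted by \<open>R\<close>, the maps \<open>u' u\<close> and
    \<open>u u'\<close> are the projections onto the ranges of \<open>E\<close> and
    \<open>F\<close>. These partial isometry laws are all that unitarity of \<open>G\<close>
    uses.\<close>
  have u: "u (u' (u y)) = u y" "u' (u (u' y)) = u' y" for y
    by (simp_all add: u_def u'_def EE FF R1)
  have uE: "u (E h) = F h" and u'F: "u' (F h) = E h" for h
    by (simp_all add: u_def u'_def EE FF R2)
  note lin = adjoint_pair_linear[OF uu'] adjoint_pair_linear[OF adjoint_pair_sym[OF uu']]
  define G where "G a = (u (fst a) + (snd a - u (u' (snd a))), fst a - u' (u (fst a)) + u' (snd a))"
    for a
  define G' where "G' a = (u' (fst a) + (snd a - u' (u (snd a))), fst a - u (u' (fst a))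
      + u (snd a))"
    for a
  show ?thesis
  proof (rule that[of G G'])
    have "cinner (u x) y = cinner x (u' y)" "cinner (u' x) y = cinner x (u y)" for x y
      using adjoint_pairD[OF uu'] adjoint_pairD[OF adjoint_pair_sym[OF uu']] by auto
    then show "adjoint_pair G G'"
      by (simp add: adjoint_pair_def G_def G'_def cinner_prod_def cinner_add_left cinner_add_right
          cinner_diff_left cinner_diff_right)
    show "G (G' a) = a" "G' (G a) = a" for a
      by (simp_all add: G_def G'_def lin u prod_eq_iff)
    \<comment> \<open>The second component is the part of \<open>E h\<close> off the range of
      \<open>E\<close>, hence zero.\<close>
    show "G (E h, 0) = (F h, 0)" for h
      by (simp add: G_def uE u'F lin)
  qed
qed

section \<open>Operator-valued positive definite functions\<close>

text \<open>Values are forms and not operators, so that every condition passes to pointwise limits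
  of scalars. Positivity is stated for lists, which may repeat a group element.\<close>

locale positive_definite =
  fixes \<phi> :: "'g::ab_group_add \<Rightarrow> 'a::complex_hilbert_space \<Rightarrow> 'a \<Rightarrow> complex"
  assumes add_left: "\<phi> g (x + y) z = \<phi> g x z + \<phi> g y z"
    and scale_left: "\<phi> g (c *\<^sub>C x) z = c * \<phi> g x z"
    and hermitian: "\<phi> g x y = cnj (\<phi> (- g) y x)"
    and at_zero: "\<phi> 0 x y = cinner x y"
    and pos: "0 \<le> Re (\<Sum>(g, x)\<leftarrow>v. \<Sum>(h, y)\<leftarrow>v. \<phi> (g - h) x y)"
begin

text \<open>In a dilation by unitaries \<open>U g\<close> a pair \<open>(g, x)\<close> stands for
  the vector \<open>U g x\<close>, and this is the inner product of the two sums of such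
  vectors.\<close>

definition gram :: "('g \<times> 'a) list \<Rightarrow> ('g \<times> 'a) list \<Rightarrow> complex" where
  "gram v w = (\<Sum>(g, x)\<leftarrow>v. \<Sum>(h, y)\<leftarrow>w. \<phi> (g - h) x y)"

definition scale_list :: "complex \<Rightarrow> ('g \<times> 'a) list \<Rightarrow> ('g \<times> 'a) list" where
  "scale_list c = map (\<lambda>(g, x). (g, c *\<^sub>C x))"

lemma gram_Nil [simp]: "gram [] w = 0"
  by (simp add: gram_def)

lemma gram_Cons: "gram (p # v) w = gram [p] w + gram v w"
  by (simp add: gram_def)

lemma gram_append_left: "gram (v @ v') w = gram v w + gram v' w"
  by (simp add: gram_def)

lemma gram_scale_left: "gram (scale_list c v) w = c * gram v w"
proof (induction v)
  case (Cons p v)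
  have "gram [(g, c *\<^sub>C x)] w = c * gram [(g, x)] w" for g x
    by (induction w) (auto simp: gram_def scale_left algebra_simps)
  then show ?case
    using Cons by (cases p) (simp add: scale_list_def gram_Cons[of _ v] gram_Cons[of _ "map _ v"]
        distrib_left)
qed (simp add: scale_list_def)

lemma gram_hermitian: "gram w v = cnj (gram v w)"
proof (induction v)
  case Nil
  show ?case
    by (induction w) (auto simp: gram_def)
next
  case (Cons p v)
  have "gram w (p # v) = gram w [p] + gram w v"
    by (cases p, induction w) (auto simp: gram_def)
  moreover have "gram w [p] = cnj (gram [p] w)"
  proof (induction w)
    case Nil
    show ?case
      by (cases p) (simp add: gram_def)
  next
    case (Cons q w)
    have "gram [q] [p] = cnj (gram [p] [q])"
      using hermitian[of "fst q - fst p"] by (cases p; cases q; simp add: gram_def)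
    moreover have "gram [p] (q # w) = gram [p] [q] + gram [p] w"
      by (cases p) (simp add: gram_def)
    ultimately show ?case
      using Cons by (simp add: gram_Cons[of q w])
  qed
  ultimately show ?case
    by (simp add: Cons gram_Cons[of p v])
qed

lemma gram_append_right: "gram w (v @ v') = gram w v + gram w v'"
  using gram_append_left gram_hermitian by (metis complex_cnj_add)

lemma gram_scale_right: "gram w (scale_list c v) = cnj c * gram w v"
  using gram_scale_left gram_hermitian by (metis complex_cnj_mult)

lemma gram_pos: "0 \<le> gram v v"
  using pos[of v] gram_hermitian[of v v] unfolding gram_def[symmetric] less_eq_complex_def
  by (metis Reals_cnj_iff complex_is_Real_iff zero_complex.sel)

lemma gram_self: "gram v v = complex_of_real (Re (gram v v))"
  using gram_pos[of v] by (simp add: less_eq_complex_def complex_eq_iff)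

text \<open>The form may be degenerate. Positivity is tested on \<open>v - t b w\<close> with
  \<open>b = gram v w\<close> and \<open>t\<close> real: \<open>t = 1 / c\<close> is optimal if
  \<open>c\<close> is positive, and for \<open>c = 0\<close> a large \<open>t\<close> forces
  \<open>b = 0\<close>.\<close>

lemma gram_cauchy_schwarz: "(cmod (gram v w))\<^sup>2 \<le> Re (gram v v) * Re (gram w w)"
proof -
  define a b c where "a = Re (gram v v)" and "b = gram v w" and "c = Re (gram w w)"
  have ge: "0 \<le> a" "0 \<le> c"
    using gram_pos by (auto simp: a_def c_def less_eq_complex_def)
  have *: "0 \<le> a - 2 * t * (cmod b)\<^sup>2 + t\<^sup>2 * (cmod b)\<^sup>2 * c" for t :: real
  proof -
    let ?z = "- complex_of_real t * b"
    have "0 \<le> Re (gram (v @ scale_list ?z w) (v @ scale_list ?z w))"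
      using gram_pos less_eq_complex_def by simp
    also have "gram (v @ scale_list ?z w) (v @ scale_list ?z w)
        = gram v v + cnj ?z * b + ?z * cnj b + ?z * cnj ?z * gram w w"
      by (simp add: gram_append_left gram_append_right gram_scale_left gram_scale_right
          gram_hermitian[of w v] flip: b_def) (simp add: algebra_simps)
    also have "\<dots> = complex_of_real a - 2 * complex_of_real t * (b * cnj b)
        + (complex_of_real t)\<^sup>2 * (b * cnj b) * complex_of_real c"
      using gram_self[of v] gram_self[of w] unfolding a_def[symmetric] c_def[symmetric]
      by (simp add: algebra_simps power2_eq_square)
    also have "\<dots> = complex_of_real (a - 2 * t * (cmod b)\<^sup>2 + t\<^sup>2 * (cmod b)\<^sup>2 * c)"
      unfolding complex_norm_square[symmetric] by simp
    finally show ?thesis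
      by simp
  qed
  have "(cmod b)\<^sup>2 \<le> a * c"
  proof (cases "c = 0")
    case True
    have "b = 0"
    proof (rule ccontr)
      assume "b \<noteq> 0"
      then show False
        using *[of "(a + 1) / (cmod b)\<^sup>2"] True ge by simp
    qed
    then show ?thesis
      using True by simp
  next
    case False
    then have "0 \<le> a - (cmod b)\<^sup>2 / c"
      using *[of "1 / c"] by (simp add: field_simps power2_eq_square)
    then show ?thesis
      using False ge by (simp add: field_simps)
  qed
  then show ?thesis
    by (simp add: a_def b_def c_def)
qed

text \<open>Boundedness is a consequence of positivity: Cauchy-Schwarz for \<open>U g x\<close> and
  \<open>y\<close>, whose norms are fixed by the value of \<open>\<phi>\<close> at zero.\<close>

lemma norm_bound: "cmod (\<phi> g x y) \<le> norm x * norm y"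
proof (rule power2_le_imp_le)
  show "(cmod (\<phi> g x y))\<^sup>2 \<le> (norm x * norm y)\<^sup>2"
    using gram_cauchy_schwarz[of "[(g, x)]" "[(0, y)]"]
    by (simp add: gram_def at_zero cinner_self power_mult_distrib flip: of_real_power)
qed simp

lemma minus_left: "\<phi> g (- x) z = - \<phi> g x z"
  using scale_left[of g "-1" x z] by (simp add: scaleC_minus_one)

lemma minus_right: "\<phi> g x (- z) = - \<phi> g x z"
  by (metis hermitian minus_left complex_cnj_minus)

lemma Re_uminus: "Re (\<phi> (- g) x x) = Re (\<phi> g x x)"
  using hermitian[of g x x] by simp

text \<open>Cauchy-Schwarz for \<open>U g x - U h x\<close> against \<open>y\<close>. The variation
  of \<open>\<phi>\<close> is thus controlled by its real part at the difference alone, which serves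
  both for rounding errors and for continuity.\<close>

lemma shift_bound:
  "(cmod (\<phi> g x y - \<phi> h x y))\<^sup>2 \<le> 2 * ((norm x)\<^sup>2 - Re (\<phi> (g - h) x x)) * (norm y)\<^sup>2"
proof -
  have "gram [(g, x), (h, - x)] [(0, y)] = \<phi> g x y - \<phi> h x y"
    by (simp add: gram_def minus_left)
  moreover have "Re (gram [(g, x), (h, - x)] [(g, x), (h, - x)])
      = 2 * ((norm x)\<^sup>2 - Re (\<phi> (g - h) x x))"
    using Re_uminus[of "g - h" x]
    by (simp add: gram_def minus_left minus_right at_zero cinner_self flip: of_real_power)
  moreover have "gram [(0, y)] [(0, y)] = (norm y)\<^sup>2"
    by (simp add: gram_def at_zero cinner_self)
  ultimately show ?thesis
    using gram_cauchy_schwarz[of "[(g, x), (h, - x)]" "[(0, y)]"] by simp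
qed

end

section \<open>Ando's dilation for strict contractions\<close>

type_synonym 'a state = "'a \<times> (nat \<Rightarrow> ('a \<times> 'a) \<times> ('a \<times> 'a))"

text \<open>The series is a finite sum as soon as one of the two states is finitely supported;
  otherwise its value may be meaningless, hence the restriction to \<open>finite_states\<close>
  below.\<close>

definition state_inner :: "'a::complex_hilbert_space state \<Rightarrow> 'a state \<Rightarrow> complex" where
  "state_inner s t = cinner (fst s) (fst t) + (\<Sum>k. cinner (snd s k) (snd t k))"

definition finite_states :: "'a::complex_hilbert_space state set" where
  "finite_states = {s. \<exists>N. \<forall>k\<ge>N. snd s k = 0}"

definition state_scale :: "complex \<Rightarrow> 'a::complex_hilbert_space state \<Rightarrow> 'a state" where
  "state_scale c s = (c *\<^sub>C fst s, \<lambda>k. c *\<^sub>C snd s k)"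

lemma summable_finite_states:
  assumes "s \<in> finite_states" and "\<And>k. snd s k = 0 \<Longrightarrow> f k = (0::complex)"
  shows "summable f"
proof -
  obtain N where "\<forall>k\<ge>N. snd s k = 0"
    using assms(1) by (auto simp: finite_states_def)
  then show ?thesis
    using assms(2) by (intro summable_finite[of "{..<N}"]) auto
qed

lemma finite_states_add: "s \<in> finite_states \<Longrightarrow> t \<in> finite_states \<Longrightarrow> s + t \<in> finite_states"
proof -
  assume "s \<in> finite_states" "t \<in> finite_states"
  then obtain M N where "\<forall>k\<ge>M. snd s k = 0" "\<forall>k\<ge>N. snd t k = 0"
    by (auto simp: finite_states_def)
  then have "\<forall>k\<ge>max M N. snd (s + t) k = 0"
    by simp
  then show ?thesis
    unfolding finite_states_def by blast
qed

lemma finite_states_zero: "0 \<in> finite_states"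
  by (simp add: finite_states_def)

lemma state_inner_commute:
  assumes "s \<in> finite_states"
  shows "state_inner t s = cnj (state_inner s t)"
proof -
  have "summable (\<lambda>k. cinner (snd s k) (snd t k))"
    using assms by (rule summable_finite_states) simp
  then have "(\<lambda>k. cnj (cinner (snd s k) (snd t k))) sums cnj (\<Sum>k. cinner (snd s k) (snd t k))"
    by (simp only: sums_cnj summable_sums)
  moreover have "cnj (cinner (snd s k) (snd t k)) = cinner (snd t k) (snd s k)" for k
    by (simp add: cinner_commute[of "snd t k" "snd s k"])
  ultimately show ?thesis
    unfolding state_inner_def using cinner_commute[of "fst t" "fst s"]
    by (simp add: sums_iff)
qed

lemma state_inner_add_left:
  assumes "s \<in> finite_states" "s' \<in> finite_states"
  shows "state_inner (s + s') t = state_inner s t + state_inner s' t"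
proof -
  have "summable (\<lambda>k. cinner (snd s k) (snd t k))" "summable (\<lambda>k. cinner (snd s' k) (snd t k))"
    using assms by (auto intro: summable_finite_states)
  then show ?thesis
    by (simp add: state_inner_def cinner_add_left suminf_add[symmetric])
qed

lemma state_inner_scale_left:
  assumes "s \<in> finite_states"
  shows "state_inner (state_scale c s) t = c * state_inner s t"
proof -
  have "summable (\<lambda>k. cinner (snd s k) (snd t k))"
    using assms by (auto intro: summable_finite_states)
  then show ?thesis
    by (simp add: state_inner_def state_scale_def cinner_scaleC_left suminf_mult distrib_left)
qed

lemma state_inner_zero_left [simp]: "state_inner 0 t = 0"
  by (simp add: state_inner_def)

lemma state_inner_self_nonneg: "s \<in> finite_states \<Longrightarrow> 0 \<le> Re (state_inner s s)"
proof -
  assume "s \<in> finite_states"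
  then have s: "summable (\<lambda>k. cinner (snd s k) (snd s k))"
    by (auto intro: summable_finite_states)
  then have "Re (\<Sum>k. cinner (snd s k) (snd s k)) = (\<Sum>k. (norm (snd s k))\<^sup>2)"
    by (simp add: Re_suminf cinner_self)
  moreover have "summable (\<lambda>k. (norm (snd s k))\<^sup>2)"
    using summable_Re[OF s] by (simp add: cinner_self)
  ultimately show ?thesis
    by (simp add: state_inner_def cinner_self suminf_nonneg)
qed

lemma finite_states_sum_list:
  "(\<And>p. p \<in> set v \<Longrightarrow> S p \<in> finite_states) \<Longrightarrow> (\<Sum>p\<leftarrow>v. S p) \<in> finite_states"
  by (induction v) (auto simp: finite_states_zero finite_states_add)

lemma state_inner_sum_list:
  assumes "\<And>p. p \<in> set v \<Longrightarrow> S p \<in> finite_states" "\<And>p. p \<in> set w \<Longrightarrow> S p \<in> finite_states"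
  shows "state_inner (\<Sum>p\<leftarrow>v. S p) (\<Sum>q\<leftarrow>w. S q) = (\<Sum>p\<leftarrow>v. \<Sum>q\<leftarrow>w. state_inner (S p) (S q))"
  using assms
proof (induction v)
  case (Cons p v)
  have "state_inner (S p) (\<Sum>q\<leftarrow>w. S q) = (\<Sum>q\<leftarrow>w. state_inner (S p) (S q))"
    using Cons.prems(2)
  proof (induction w)
    case Nil
    show ?case
      using state_inner_commute[OF finite_states_zero, of "S p"] by simp
  next
    case (Cons q w)
    have "state_inner (S p) (S q + (\<Sum>q\<leftarrow>w. S q))
        = cnj (state_inner (S q) (S p)) + cnj (state_inner (\<Sum>q\<leftarrow>w. S q) (S p))"
      using Cons.prems state_inner_commute[of "S q + (\<Sum>q\<leftarrow>w. S q)" "S p"]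
      by (simp add: state_inner_add_left finite_states_add finite_states_sum_list)
    also have "\<dots> = state_inner (S p) (S q) + state_inner (S p) (\<Sum>q\<leftarrow>w. S q)"
      using Cons.prems state_inner_commute[of "S q" "S p"]
        state_inner_commute[of "\<Sum>q\<leftarrow>w. S q" "S p"]
      by (simp add: finite_states_sum_list)
    finally show ?case
      using Cons by simp
  qed
  then show ?case
    using Cons by (simp add: state_inner_add_left finite_states_sum_list)
qed simp

section \<open>Commuting isometries and their positive definite functions\<close>

definition state_isometry :: "('a::complex_hilbert_space state \<Rightarrow> 'a state) \<Rightarrow> bool" where
  "state_isometry V \<longleftrightarrow>
    (\<forall>s\<in>finite_states. V s \<in> finite_states) \<and>
    (\<forall>s\<in>finite_states. \<forall>t\<in>finite_states. state_inner (V s) (V t) = state_inner s t) \<and>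
    (\<forall>s t. V (s + t) = V s + V t) \<and> (\<forall>c s. V (state_scale c s) = state_scale c (V s))"

lemma state_isometryD:
  assumes "state_isometry V"
  shows "s \<in> finite_states \<Longrightarrow> V s \<in> finite_states"
    "\<lbrakk>s \<in> finite_states; t \<in> finite_states\<rbrakk> \<Longrightarrow> state_inner (V s) (V t) = state_inner s t"
    "V (s + t) = V s + V t" "V (state_scale c s) = state_scale c (V s)"
  using assms unfolding state_isometry_def by blast+

lemma state_isometry_compose:
  "state_isometry V \<Longrightarrow> state_isometry W \<Longrightarrow> state_isometry (V \<circ> W)"
  by (simp add: state_isometry_def del: split_paired_All)

lemma state_isometry_funpow: "state_isometry V \<Longrightarrow> state_isometry (V ^^ n)"
  by (induction n) (auto simp: state_isometry_compose, simp add: state_isometry_def)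

lemma funpow_commute:
  "f \<circ> g = g \<circ> f \<Longrightarrow> (f ^^ m) ((g ^^ n) x) = (g ^^ n) ((f ^^ m) x)"
proof -
  assume fg: "f \<circ> g = g \<circ> f"
  have 1: "f ((g ^^ n) x) = (g ^^ n) (f x)" for x
    by (induction n) (use fg in \<open>auto simp: fun_eq_iff\<close>)
  show ?thesis
    by (induction m) (auto simp: 1)
qed

definition initial_state :: "'a::complex_hilbert_space \<Rightarrow> 'a state" where
  "initial_state x = (x, \<lambda>_. 0)"

text \<open>Isometries have no negative powers, but in \<open>\<psi> (m, n)\<close> the negative
  exponents can be put on the second argument. By commutativity common factors cancel, so all
  exponents of a finite family can be raised by one large \<open>N\<close>; the kernel then is a
  Gram matrix of vectors.\<close>

lemma positive_definite_commuting_isometries: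
  fixes V1 V2 :: "'a::complex_hilbert_space state \<Rightarrow> 'a state"
  assumes V1: "state_isometry V1" and V2: "state_isometry V2" and comm: "V1 \<circ> V2 = V2 \<circ> V1"
  obtains \<psi> :: "int \<times> int \<Rightarrow> 'a \<Rightarrow> 'a \<Rightarrow> complex"
  where "positive_definite \<psi>"
    "\<And>a b x y. \<psi> (int a, int b) x y = cinner (fst ((V1 ^^ a) ((V2 ^^ b) (initial_state x)))) y"
proof -
  define P where "P a b = (V1 ^^ a) \<circ> (V2 ^^ b)" for a b
  have P: "state_isometry (P a b)" for a b
    unfolding P_def by (intro state_isometry_compose state_isometry_funpow V1 V2)
  have P_add: "P (a + c) (b + d) s = P c d (P a b s)" for a b c d s
    using funpow_commute[OF comm] by (simp add: P_def funpow_add add.commute[of _ c] add.commute[of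
        _ d])
  have E: "initial_state x \<in> finite_states" for x :: 'a
    by (simp add: initial_state_def finite_states_def)
  have PE: "P a b (initial_state x) \<in> finite_states" for a b x
    by (rule state_isometryD(1)[OF P E])
  define \<psi> where "\<psi> = (\<lambda>(m, n) x y. state_inner (P (nat m) (nat n) (initial_state x)) (P (nat (- m))
      (nat (- n)) (initial_state y)))"
  have \<psi>: "\<psi> (int a - int a', int b - int b') x y
      = state_inner (P a b (initial_state x)) (P a' b' (initial_state y))"
    for a a' b b' x y
  proof -
    \<comment> \<open>Splits off the common power, which as an isometry drops out of the inner
      product; what remains are the positive and negative parts of the difference.\<close>
    have "a = nat (int a - int a') + min a a'" "a' = nat (- (int a - int a')) + min a a'"
      "b = nat (int b - int b') + min b b'" "b' = nat (- (int b - int b')) + min b b'"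
      by auto
    then have "P a b s = P (min a a') (min b b') (P (nat (int a - int a')) (nat (int b
        - int b')) s)"
      "P a' b' s = P (min a a') (min b b') (P (nat (- (int a - int a'))) (nat (- (int b
          - int b'))) s)" for s
      by (metis P_add)+
    then show ?thesis
      using PE by (simp add: \<psi>_def state_isometryD(2)[OF P])
  qed
  have embed_add: "initial_state (x + y) = initial_state x + initial_state y"
    and embed_scale: "initial_state (c *\<^sub>C x) = state_scale c (initial_state x)" for x y :: 'a and c
    by (simp_all add: initial_state_def state_scale_def fun_eq_iff)
  have inner_embed: "state_inner s (initial_state x) = cinner (fst s) x" for s :: "'a state" and x
    by (simp add: state_inner_def initial_state_def)
  show ?thesis
  proof
    show "positive_definite \<psi>"
    proof
      fix g :: "int \<times> int" and x y z :: 'a and c :: complex and v :: "((int \<times> int) \<times> 'a) list"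
      obtain m n where g: "g = (m, n)"
        by fastforce
      show "\<psi> g (x + y) z = \<psi> g x z + \<psi> g y z"
        using PE by (simp add: g \<psi>_def embed_add state_isometryD(3)[OF P] state_inner_add_left)
      show "\<psi> g (c *\<^sub>C x) z = c * \<psi> g x z"
        using PE by (simp add: g \<psi>_def embed_scale state_isometryD(4)[OF P] state_inner_scale_left)
      show "\<psi> g x y = cnj (\<psi> (- g) y x)"
        by (simp add: g \<psi>_def) (rule state_inner_commute[OF PE])
      show "\<psi> 0 x y = cinner x y"
        by (simp add: zero_prod_def \<psi>_def P_def inner_embed) (simp add: initial_state_def)
      \<comment> \<open>A crude bound for all coordinates in \<open>v\<close>, large enough to make
        every shifted exponent nonnegative.\<close>
      define N where "N = (\<Sum>((m, n), x)\<leftarrow>v. nat \<bar>m\<bar> + nat \<bar>n\<bar>)"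
      have N: "\<bar>m\<bar> \<le> int N" "\<bar>n\<bar> \<le> int N" if "((m, n), x) \<in> set v" for m n x
        using member_le_sum_list[of "nat \<bar>m\<bar> + nat \<bar>n\<bar>" "map (\<lambda>((m, n), x). nat \<bar>m\<bar>
            + nat \<bar>n\<bar>) v"] that
        by (force simp: N_def)+
      define S where "S = (\<lambda>((m, n), x). P (nat (m + int N)) (nat (n + int N)) (initial_state x))"
      have S: "S p \<in> finite_states" for p
        by (auto simp: S_def PE split: prod.splits)
      have "\<psi> (g - h) x y = state_inner (S (g, x)) (S (h, y))"
        if "(g, x) \<in> set v" "(h, y) \<in> set v" for g h x y
      proof -
        obtain m n m' n' where gh: "g = (m, n)" "h = (m', n')"
          by fastforce
        have "m = int (nat (m + int N)) - int N" "n = int (nat (n + int N)) - int N"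
          "m' = int (nat (m' + int N)) - int N" "n' = int (nat (n' + int N)) - int N"
          using N[of m n x] N[of m' n' y] that gh by auto
        then have "g - h = (int (nat (m + int N)) - int (nat (m' + int N)), int (nat (n
            + int N)) - int (nat (n' + int N)))"
          by (simp add: gh)
        then show ?thesis
          by (simp only: \<psi>) (simp add: S_def gh)
      qed
      then have "(\<Sum>(g, x)\<leftarrow>v. \<Sum>(h, y)\<leftarrow>v. \<psi> (g - h) x y) = (\<Sum>p\<leftarrow>v. \<Sum>q\<leftarrow>v. state_inner (S p) (S q))"
        by (intro arg_cong[of _ _ sum_list] map_cong refl) (auto intro!: arg_cong[of _ _ sum_list]
            map_cong)
      also have "\<dots> = state_inner (\<Sum>p\<leftarrow>v. S p) (\<Sum>q\<leftarrow>v. S q)"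
        by (rule state_inner_sum_list[symmetric]) (auto simp: S)
      finally show "0 \<le> Re (\<Sum>(g, x)\<leftarrow>v. \<Sum>(h, y)\<leftarrow>v. \<psi> (g - h) x y)"
        by (simp add: state_inner_self_nonneg finite_states_sum_list S)
    qed
    show "\<psi> (int a, int b) x y = cinner (fst ((V1 ^^ a) ((V2 ^^ b) (initial_state x)))) y"
        for a b x y
      by (simp add: \<psi>_def inner_embed P_def)
  qed
qed

text \<open>A state is a vector followed by a sequence of half blocks, two of which are stored in one
  entry: those of \<open>((y\<^sub>1, y\<^sub>2), (z\<^sub>1, z\<^sub>2))\<close> are \<open>(y\<^sub>1, z\<^sub>1)\<close> and \<open>(y\<^sub>2, z\<^sub>2)\<close>.
  Prepending the half block \<open>(D h, 0)\<close> makes \<open>T\<close> isometric when \<open>D\<^sup>2 = 1 - T\<^sup>* T\<close>, and two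
  such steps shift by one entry.\<close>

definition half_shift :: "('a \<Rightarrow> 'a) \<Rightarrow> ('a \<Rightarrow> 'a) \<Rightarrow> 'a::complex_hilbert_space state \<Rightarrow> 'a state" where
  "half_shift T D s = (T (fst s), \<lambda>k. case k of
      0 \<Rightarrow> ((D (fst s), fst (fst (snd s 0))), (0, fst (snd (snd s 0))))
    | Suc j \<Rightarrow> ((snd (fst (snd s j)), fst (fst (snd s (Suc j)))),
               (snd (snd (snd s j)), fst (snd (snd s (Suc j))))))"

text \<open>The grouping of half blocks into entries serves this map: the entry prepended by two
  half shifts has the form \<open>(E h, 0)\<close>, the argument at which
  \<open>unitary_extension\<close> prescribes \<open>G\<close>.\<close>

definition blockwise where "blockwise G s = (fst s, \<lambda>k. G (snd s k))"

lemma state_isometry_blockwise: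
  fixes G G' :: "('a::complex_hilbert_space \<times> 'a) \<times> ('a \<times> 'a) \<Rightarrow> ('a \<times> 'a) \<times> ('a \<times> 'a)"
  assumes G: "adjoint_pair G G'" and inv: "\<And>a. G' (G a) = a"
  shows "state_isometry (blockwise G)"
proof -
  note lin = adjoint_pair_linear[OF G]
  have "cinner (G a) (G b) = cinner a b" for a b
    by (simp add: adjoint_pairD[OF G] inv)
  then show ?thesis
    unfolding state_isometry_def finite_states_def
    by (auto simp: blockwise_def lin state_inner_def state_scale_def fun_eq_iff)
      (metis lin(5))
qed

text \<open>The squared norms of \<open>T h\<close> and \<open>D h\<close> add up to that of
  \<open>h\<close>, and the half blocks of the sequence are only moved.\<close>

lemma state_isometry_half_shift:
  fixes T D :: "'a::complex_hilbert_space \<Rightarrow> 'a"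
  assumes T: "adjoint_pair T T'" and D: "adjoint_pair D D" and DD: "\<And>x. D (D x) = x - T' (T x)"
  shows "state_isometry (half_shift T D)"
  unfolding state_isometry_def
proof (intro conjI ballI allI)
  note lin = adjoint_pair_linear[OF T] adjoint_pair_linear[OF D]
  fix s t :: "'a state" and c :: complex
  show "half_shift T D (s + t) = half_shift T D s + half_shift T D t"
    by (auto simp: half_shift_def lin fun_eq_iff split: nat.split)
  show "half_shift T D (state_scale c s) = state_scale c (half_shift T D s)"
    by (auto simp: half_shift_def state_scale_def lin fun_eq_iff scaleC_prod_def split: nat.split)
next
  fix s :: "'a state" assume "s \<in> finite_states"
  then obtain N where N: "\<forall>k\<ge>N. snd s k = 0"
    by (auto simp: finite_states_def)
  have "snd (half_shift T D s) k = 0" if "k \<ge> Suc N" for k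
  proof (cases k)
    case (Suc j)
    then show ?thesis
      using N that by (simp add: half_shift_def zero_prod_def)
  qed (use that in simp)
  then show "half_shift T D s \<in> finite_states"
    unfolding finite_states_def by blast
next
  fix s t :: "'a state" assume s: "s \<in> finite_states" and t: "t \<in> finite_states"
  \<comment> \<open>\<open>a\<close> and \<open>b\<close> are the contributions of the first and
    second half blocks. After the shift an entry pairs the second half of its predecessor with its
    own first half, so the sums are the same in a different order.\<close>
  define a where "a k = cinner (fst (fst (snd s k))) (fst (fst (snd t k)))
    + cinner (fst (snd (snd s k))) (fst (snd (snd t k)))" for k
  define b where "b k = cinner (snd (fst (snd s k))) (snd (fst (snd t k)))
    + cinner (snd (snd (snd s k))) (snd (snd (snd t k)))" for k
  define f where "f k = cinner (snd (half_shift T D s) k) (snd (half_shift T D t) k)" for k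
  have f: "f 0 = cinner (D (fst s)) (D (fst t)) + a 0" "f (Suc k) = b k + a (Suc k)" for k
    by (simp_all add: f_def a_def b_def half_shift_def cinner_prod_def)
  have a: "summable a" and b: "summable b"
    using summable_finite_states[OF s] by (simp_all add: a_def b_def)
  then have "summable (\<lambda>k. f (Suc k))"
    by (simp add: f summable_add summable_Suc_iff)
  then have "suminf f = (\<Sum>k. f (Suc k)) + f 0"
    using suminf_split_head[of f] by (simp add: summable_Suc_iff)
  also have "(\<Sum>k. f (Suc k)) = suminf b + (suminf a - a 0)"
    using a b by (simp add: f suminf_add[symmetric] summable_Suc_iff suminf_split_head)
  finally have "suminf f = cinner (D (fst s)) (D (fst t)) + (suminf a + suminf b)"
    by (simp add: f)
  moreover have "(\<Sum>k. cinner (snd s k) (snd t k)) = suminf a + suminf b"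
    using a b by (simp add: suminf_add a_def b_def cinner_prod_def algebra_simps)
  moreover have "cinner (T (fst s)) (T (fst t)) + cinner (D (fst s)) (D (fst t))
      = cinner (fst s) (fst t)"
    by (simp add: adjoint_pairD[OF T] adjoint_pairD[OF D] DD cinner_diff_right)
  moreover have "state_inner (half_shift T D s) (half_shift T D t)
      = cinner (T (fst s)) (T (fst t)) + suminf f"
    by (simp add: state_inner_def f_def[abs_def] half_shift_def)
  ultimately show "state_inner (half_shift T D s) (half_shift T D t) = state_inner s t"
    by (simp add: state_inner_def flip: add.assoc)
qed

text \<open>Ando's idea: the half shifts of \<open>T1\<close> and \<open>T2\<close> are isometric
  but fail to commute, as one order prepends \<open>E h\<close> and the other \<open>F h\<close>.
  Both have the same Gram operator \<open>1 - T' T\<close>, so a unitary \<open>G\<close> can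
  exchange them, and inserting it repairs commutativity.\<close>

theorem ando_positive_definite:
  fixes T1 T2 :: "'a::complex_hilbert_space \<Rightarrow> 'a"
  assumes T1: "adjoint_pair T1 T1'" and T2: "adjoint_pair T2 T2'" and comm: "\<And>x. T1 (T2 x)
      = T2 (T1 x)"
    and r: "0 \<le> r" "r < 1" and bound: "\<And>x. norm (T1 x) \<le> r * norm x" "\<And>x. norm (T2 x) \<le> r * norm x"
  obtains \<psi> :: "int \<times> int \<Rightarrow> 'a \<Rightarrow> 'a \<Rightarrow> complex"
  where "positive_definite \<psi>"
    "\<And>a b x y. \<psi> (int a, int b) x y = cinner ((T1 ^^ a) ((T2 ^^ b) x)) y"
proof -
  have adj_bound: "norm (B x) \<le> r * norm x"
    if AB: "adjoint_pair A B" and A: "\<And>x. norm (A x) \<le> r * norm x" for A B :: "'a \<Rightarrow> 'a" and x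
  proof (cases "B x = 0")
    case False
    have "(norm (B x))\<^sup>2 = cmod (cinner (A (B x)) x)"
      using adjoint_pairD[OF AB, of "B x" x] cinner_self[of "B x"] by (simp add: norm_power)
    also have "\<dots> \<le> norm (A (B x)) * norm x"
      by (rule cmod_cinner_le)
    also have "\<dots> \<le> r * norm (B x) * norm x"
      using A by (rule mult_right_mono) simp
    finally show ?thesis
      using False by (simp add: power2_eq_square mult_ac)
  qed (use r in simp)
  have comp_bound: "norm (A (B x)) \<le> r * norm x"
    if "\<And>x. norm (A x) \<le> r * norm x" "\<And>x. norm (B x) \<le> r * norm x" for A B :: "'a \<Rightarrow> 'a" and x
  proof -
    have "norm (A (B x)) \<le> r * (r * norm x)"
      using that(1)[of "B x"] mult_left_mono[OF that(2)[of x] r(1)] by linarith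
    also have "\<dots> \<le> 1 * (r * norm x)"
      using r by (intro mult_right_mono) auto
    finally show ?thesis
      by simp
  qed
  note sa = adjoint_pair_compose[OF adjoint_pair_sym[OF T1] T1]
    adjoint_pair_compose[OF adjoint_pair_sym[OF T2] T2]
  obtain D1 where D1: "adjoint_pair D1 D1" "\<And>x. D1 (D1 x) = x - T1' (T1 x)"
    using sqrt_one_minus[OF sa(1) r comp_bound[OF adj_bound[OF T1 bound(1)] bound(1)]] by blast
  obtain D2 where D2: "adjoint_pair D2 D2" "\<And>x. D2 (D2 x) = x - T2' (T2 x)"
    using sqrt_one_minus[OF sa(2) r comp_bound[OF adj_bound[OF T2 bound(2)] bound(2)]] by blast
  define T where "T x = T1 (T2 x)" for x
  define T' where "T' x = T2' (T1' x)" for x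
  have T: "adjoint_pair T T'"
    unfolding T_def T'_def by (rule adjoint_pair_compose[OF T1 T2])
  \<comment> \<open>Adjoints are unique, so the adjoints of commuting maps commute. \<open>F\<close>
    needs this order of the factors.\<close>
  have T'_alt: "T' x = T1' (T2' x)" for x
  proof (rule cinner_eqI2)
    show "cinner z (T' x) = cinner z (T1' (T2' x))" for z
      using adjoint_pairD[OF T, of z x] adjoint_pairD[OF adjoint_pair_compose[OF T2 T1], of z x]
      by (simp add: T_def comm)
  qed
  have T_bound: "norm (T x) \<le> r * norm x" for x
    unfolding T_def by (rule comp_bound[OF bound])
  note lin = adjoint_pair_linear[OF adjoint_pair_sym[OF T1]] adjoint_pair_linear[OF
      adjoint_pair_sym[OF T2]]
  define E where "E h = (D1 (T2 h), D2 h)" for h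
  define E' where "E' y = T2' (D1 (fst y)) + D2 (snd y)" for y
  define F where "F h = (D2 (T1 h), D1 h)" for h
  define F' where "F' y = T1' (D2 (fst y)) + D1 (snd y)" for y
  have E: "adjoint_pair E E'" and F: "adjoint_pair F F'"
    using adjoint_pairD[OF T1] adjoint_pairD[OF T2] adjoint_pairD[OF D1(1)] adjoint_pairD[OF D2(1)]
    by (auto simp: adjoint_pair_def E_def E'_def F_def F'_def cinner_prod_def cinner_add_right)
  \<comment> \<open>Telescopes: \<open>T2' (1 - T1' T1) T2\<close> and \<open>1 - T2' T2\<close> add
    up to \<open>1 - T' T\<close>.\<close>
  have EE: "E' (E h) = h - T' (T h)" for h
    by (simp add: E_def E'_def D1 D2 lin T_def T'_def)
  have FF: "F' (F h) = h - T' (T h)" for h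
    by (simp add: F_def F'_def D1 D2 lin T_def T'_alt comm)
  obtain G G' :: "('a \<times> 'a) \<times> ('a \<times> 'a) \<Rightarrow> ('a \<times> 'a) \<times> ('a \<times> 'a)"
    where G: "adjoint_pair G G'" "\<And>a. G (G' a) = a" "\<And>a. G' (G a) = a" "\<And>h. G (E h, 0) = (F h, 0)"
    using unitary_extension[OF E F EE FF adjoint_pair_compose[OF adjoint_pair_sym[OF T] T] r
        comp_bound[OF adj_bound[OF T T_bound] T_bound]] by blast
  \<comment> \<open>In \<open>V2 \<circ> V1\<close> the factors \<open>G'\<close> and
    \<open>G\<close> meet and cancel, so commutation amounts to the exchange rule shown
    next.\<close>
  define V1 where "V1 = blockwise G \<circ> half_shift T1 D1"
  define V2 where "V2 = half_shift T2 D2 \<circ> blockwise G'"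
  have V: "state_isometry V1" "state_isometry V2"
    unfolding V1_def V2_def
    by (intro state_isometry_compose state_isometry_blockwise[OF G(1,3)]
        state_isometry_blockwise[OF adjoint_pair_sym[OF G(1)] G(2)]
        state_isometry_half_shift[OF T1 D1] state_isometry_half_shift[OF T2 D2])+
  \<comment> \<open>Two half shifts move the sequence by exactly one entry, so \<open>G\<close> acts
    equally on it before and after. Only the prepended entry is at issue, where \<open>G\<close>
    turns \<open>(E h, 0)\<close> into \<open>(F h, 0)\<close>.\<close>
  have "blockwise G (half_shift T1 D1 (half_shift T2 D2 s))
      = half_shift T2 D2 (half_shift T1 D1 (blockwise G s))" for s
  proof -
    have "G ((D1 (T2 h), D2 h), (0, 0)) = ((D2 (T1 h), D1 h), (0, 0))" for h
      using G(4)[of h] by (simp add: E_def F_def zero_prod_def)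
    then show ?thesis
      by (auto simp: blockwise_def half_shift_def comm fun_eq_iff split: nat.split)
  qed
  then have "V1 \<circ> V2 = V2 \<circ> V1"
    by (auto simp: V1_def V2_def fun_eq_iff blockwise_def G)
  then obtain \<psi> where \<psi>: "positive_definite \<psi>"
    "\<And>a b x y. \<psi> (int a, int b) x y = cinner (fst ((V1 ^^ a) ((V2 ^^ b) (initial_state x)))) y"
    using positive_definite_commuting_isometries[OF V] by blast
  \<comment> \<open>The sequence never feeds back into the first component, so powers of the
    isometries compress to powers of the contractions.\<close>
  have "fst (V1 s) = T1 (fst s)" "fst (V2 s) = T2 (fst s)" for s
    by (simp_all add: V1_def V2_def blockwise_def half_shift_def)
  then have "fst ((V1 ^^ a) s) = (T1 ^^ a) (fst s)" "fst ((V2 ^^ a) s) = (T2 ^^ a) (fst s)" for a s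
    by (induction a) auto
  then show ?thesis
    using that[OF \<psi>(1)] \<psi>(2) by (simp add: initial_state_def)
qed

section \<open>Exponentials as limits of Euler products\<close>

text \<open>Telescoping; \<open>1 \<le> M\<close> allows the crude exponent \<open>n\<close> in
  place of \<open>n - 1\<close>.\<close>

lemma norm_power_diff_le:
  fixes x y :: "'b::real_normed_algebra_1"
  assumes "norm x \<le> M" "norm y \<le> M" "1 \<le> M"
  shows "norm (x ^ n - y ^ n) \<le> n * M ^ n * norm (x - y)"
proof (induction n)
  case (Suc n)
  have ny: "norm (y ^ n) \<le> M ^ n"
    using order_trans[OF norm_power_ineq power_mono] assms by auto
  have "x ^ Suc n - y ^ Suc n = x * (x ^ n - y ^ n) + (x - y) * y ^ n"
    by (simp add: algebra_simps)
  then have "norm (x ^ Suc n - y ^ Suc n) \<le> norm x * norm (x ^ n - y ^ n)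
      + norm (x - y) * norm (y ^ n)"
    by (metis norm_triangle_mono norm_mult_ineq)
  also have "\<dots> \<le> M * (n * M ^ n * norm (x - y)) + norm (x - y) * M ^ n"
    using Suc ny assms by (intro add_mono mult_mono) auto
  also have "\<dots> \<le> M * (n * M ^ n * norm (x - y)) + norm (x - y) * M ^ Suc n"
    using assms by (intro add_left_mono mult_left_mono power_increasing) auto
  finally show ?case
    by (simp add: algebra_simps)
qed simp

lemma exp_power:
  fixes X :: "'b::{real_normed_algebra_1,banach}"
  shows "exp X ^ n = exp (real n *\<^sub>R X)"
proof (induction n)
  case (Suc n)
  have "exp (X + real n *\<^sub>R X) = exp X * exp (real n *\<^sub>R X)"
    by (rule exp_add_commuting) simp
  then show ?case
    using Suc by (simp add: scaleR_left_distrib)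
qed simp

text \<open>The derivative of the one-parameter group at zero, sampled at the times
  \<open>1 / n\<close>.\<close>

lemma exp_difference_quotient:
  fixes X :: "'b::{real_normed_algebra_1,banach}"
  shows "(\<lambda>n. real n *\<^sub>R (exp (X /\<^sub>R real n) - 1)) \<longlonglongrightarrow> X"
proof -
  have "((\<lambda>t. exp (t *\<^sub>R X)) has_derivative (\<lambda>h. h *\<^sub>R X)) (at 0)"
    using exp_scaleR_has_vector_derivative_right[of X 0 UNIV]
        by (simp add: has_vector_derivative_def)
  then have lim: "((\<lambda>h. norm (exp (h *\<^sub>R X) - 1 - h *\<^sub>R X) / norm h) \<longlongrightarrow> 0) (at 0)"
    unfolding has_derivative_at by simp
  have "filterlim (\<lambda>n. inverse (real n)) (at 0) sequentially"
    unfolding filterlim_at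
  proof
    show "\<forall>\<^sub>F n in sequentially. inverse (real n) \<in> UNIV \<and> inverse (real n) \<noteq> 0"
      by (rule eventually_sequentiallyI[of 1]) simp
  qed (rule lim_inverse_n)
  from filterlim_compose[OF lim this]
  have "(\<lambda>n. norm (exp (inverse n *\<^sub>R X) - 1 - inverse n *\<^sub>R X) / norm (inverse (real n))) \<longlonglongrightarrow> 0" .
  moreover have "\<forall>\<^sub>F n in sequentially. norm (exp (inverse n *\<^sub>R X) - 1
      - inverse n *\<^sub>R X) / norm (inverse (real n))
      = norm (real n *\<^sub>R (exp (X /\<^sub>R real n) - 1) - X)"
  proof (rule eventually_sequentiallyI[of 1])
    fix n :: nat assume "1 \<le> n"
    then have "real n *\<^sub>R (exp (X /\<^sub>R real n) - 1) - X
        = real n *\<^sub>R (exp (inverse n *\<^sub>R X) - 1 - inverse n *\<^sub>R X)"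
      by (simp add: scaleR_diff_right)
    then show "norm (exp (inverse n *\<^sub>R X) - 1 - inverse n *\<^sub>R X) / norm (inverse (real n))
      = norm (real n *\<^sub>R (exp (X /\<^sub>R real n) - 1) - X)"
      by (simp add: divide_inverse mult.commute)
  qed
  ultimately have "(\<lambda>n. norm (real n *\<^sub>R (exp (X /\<^sub>R real n) - 1) - X)) \<longlonglongrightarrow> 0"
    by (rule Lim_transform_eventually)
  then show ?thesis
    by (rule LIM_zero_cancel[OF tendsto_norm_zero_cancel])
qed

text \<open>\<open>Z n\<close> and \<open>exp (X / n)\<close> have the same first order term and
  differ by less than the order of \<open>1 / n\<close>. Both have norm at most
  \<open>1 + C / n\<close>, so taking powers of order \<open>n\<close> magnifies the difference by a
  factor of that order only.\<close>

lemma power_tendsto_exp: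
  fixes X :: "'b::{real_normed_algebra_1,banach}" and a :: "nat \<Rightarrow> nat"
  assumes Z: "(\<lambda>n. real n *\<^sub>R (Z n - 1)) \<longlonglongrightarrow> X" and a: "(\<lambda>n. a n / n) \<longlonglongrightarrow> t"
  shows "(\<lambda>n. Z n ^ a n) \<longlonglongrightarrow> exp (t *\<^sub>R X)"
proof -
  define E where "E n = exp (X /\<^sub>R real n)" for n
  have E: "(\<lambda>n. real n *\<^sub>R (E n - 1)) \<longlonglongrightarrow> X"
    unfolding E_def by (rule exp_difference_quotient)
  obtain C1 C2 where C1: "\<And>n. norm (real n *\<^sub>R (Z n - 1))
      \<le> C1" and C2: "\<And>n. norm (real n *\<^sub>R (E n - 1)) \<le> C2"
    using convergent_imp_Bseq[OF convergentI[OF Z]] convergent_imp_Bseq[OF convergentI[OF E]]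
    by (auto simp: Bseq_def)
  obtain K where K: "\<And>n. norm (a n / real n) \<le> K"
    using convergent_imp_Bseq[OF convergentI[OF a]] by (auto simp: Bseq_def)
  define C where "C = max 0 (max C1 C2)"
  have C: "0 \<le> C" "C1 \<le> C" "C2 \<le> C"
    by (auto simp: C_def)
  have near_one: "norm Y \<le> 1 + C / n" if "norm (real n *\<^sub>R (Y - 1))
      \<le> C" "n \<ge> 1" for Y :: 'b and n :: nat
  proof -
    have "norm (Y - 1) \<le> C / n"
      using that by (simp only: norm_scaleR) (simp add: field_simps)
    then show ?thesis
      using norm_triangle_ineq[of "Y - 1" 1] by simp
  qed
  have bound: "norm (Z n ^ a n - E n ^ a n) \<le> K * exp (C * K) * norm (real n *\<^sub>R (Z n - 1)
      - real n *\<^sub>R (E n - 1))"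
    if n: "n \<ge> 1" for n
  proof -
    have K': "real (a n) / n \<le> K"
      using K[of n] by simp
    have "norm (Z n ^ a n - E n ^ a n) \<le> a n * (1 + C / n) ^ a n * norm (Z n - E n)"
      using near_one[of n "Z n"] near_one[of n "E n"] C1[of n] C2[of n] C n
      by (intro norm_power_diff_le) auto
    also have "(1 + C / n) ^ a n \<le> exp (C / n) ^ a n"
      using C by (intro power_mono exp_ge_add_one_self) auto
    also have "exp (C / n) ^ a n = exp (C * (a n / n))"
      by (simp add: exp_of_nat_mult[symmetric])
    also have "\<dots> \<le> exp (C * K)"
      using mult_left_mono[OF K' C(1)] by simp
    also have "a n * exp (C * K) * norm (Z n - E n)
        = (a n / n) * exp (C * K) * norm (real n *\<^sub>R (Z n - E n))"
      using n by simp
    also have "\<dots> \<le> K * exp (C * K) * norm (real n *\<^sub>R (Z n - E n))"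
      using K' by (intro mult_right_mono) auto
    finally show ?thesis
      by (simp add: mult_left_mono mult_right_mono scaleR_diff_right)
  qed
  have "(\<lambda>n. K * exp (C * K) * norm (real n *\<^sub>R (Z n - 1) - real n *\<^sub>R (E n - 1)))
      \<longlonglongrightarrow> K * exp (C * K) * norm (X - X)"
    by (intro tendsto_intros Z E)
  then have lim0: "(\<lambda>n. K * exp (C * K) * norm (real n *\<^sub>R (Z n - 1) - real n *\<^sub>R (E n - 1))) \<longlonglongrightarrow> 0"
    by simp
  have "\<forall>\<^sub>F n in sequentially. norm (Z n ^ a n - E n ^ a n)
      \<le> K * exp (C * K) * norm (real n *\<^sub>R (Z n - 1) - real n *\<^sub>R (E n - 1))"
    by (rule eventually_sequentiallyI[of 1]) (rule bound)
  then have "(\<lambda>n. Z n ^ a n - E n ^ a n) \<longlonglongrightarrow> 0"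
    using lim0 by (rule Lim_null_comparison)
  moreover have "(\<lambda>n. E n ^ a n) \<longlonglongrightarrow> exp (t *\<^sub>R X)"
  proof -
    have "isCont (\<lambda>t. exp (t *\<^sub>R X)) t"
      using exp_scaleR_has_vector_derivative_right[of X t UNIV]
      by (rule has_vector_derivative_continuous)
    then have "(\<lambda>n. exp ((a n / n) *\<^sub>R X)) \<longlonglongrightarrow> exp (t *\<^sub>R X)"
      using isCont_tendsto_compose a by blast
    moreover have "E n ^ a n = exp ((a n / n) *\<^sub>R X)" for n
      by (simp add: E_def exp_power divide_inverse)
    ultimately show ?thesis
      by simp
  qed
  ultimately show ?thesis
    by (rule Lim_transform[rotated])
qed

text \<open>Bounded operators on \<open>'a \<times> real\<close> rather than on \<open>'a\<close>: the unit of a normed algebra has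
  norm \<open>1\<close>, which fails for operators on the zero space.\<close>

typedef (overloaded) 'a operator =
  "UNIV :: (('a::real_normed_vector \<times> real) \<Rightarrow>\<^sub>L ('a \<times> real)) set"
  morphisms blinfun_of Operator ..

setup_lifting type_definition_operator

instantiation operator :: (real_normed_vector) real_normed_algebra_1
begin

lift_definition zero_operator :: "'a operator" is 0 .
lift_definition one_operator :: "'a operator" is id_blinfun .
lift_definition plus_operator :: "'a operator \<Rightarrow> 'a operator \<Rightarrow> 'a operator" is "(+)" .
lift_definition minus_operator :: "'a operator \<Rightarrow> 'a operator \<Rightarrow> 'a operator" is "(-)" .
lift_definition uminus_operator :: "'a operator \<Rightarrow> 'a operator" is uminus .
lift_definition times_operator :: "'a operator \<Rightarrow> 'a operator \<Rightarrow> 'a operator" is "(o\<^sub>L)" .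
lift_definition scaleR_operator :: "real \<Rightarrow> 'a operator \<Rightarrow> 'a operator" is "(*\<^sub>R)" .
lift_definition norm_operator :: "'a operator \<Rightarrow> real" is norm .
definition dist_operator :: "'a operator \<Rightarrow> 'a operator \<Rightarrow> real" where
  "dist_operator x y = norm (x - y)"
definition sgn_operator :: "'a operator \<Rightarrow> 'a operator" where
  "sgn_operator x = scaleR (inverse (norm x)) x"
definition uniformity_operator :: "('a operator \<times> 'a operator) filter" where
  "uniformity_operator = (INF e\<in>{0 <..}. principal {(x, y). dist x y < e})"
definition open_operator :: "'a operator set \<Rightarrow> bool" where
  "open_operator U = (\<forall>x\<in>U. \<forall>\<^sub>F (x', y) in uniformity. x' = x \<longrightarrow> y \<in> U)"

instance
proof
  fix x y z :: "'a operator" and r s :: real and U :: "'a operator set"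
  show "x + y + z = x + (y + z)" "x + y = y + x" "0 + x = x" "- x + x = 0" "x - y = x + - y"
    "r *\<^sub>R (x + y) = r *\<^sub>R x + r *\<^sub>R y" "(r + s) *\<^sub>R x = r *\<^sub>R x + s *\<^sub>R x"
    "r *\<^sub>R s *\<^sub>R x = (r * s) *\<^sub>R x" "1 *\<^sub>R x = x"
    by (transfer; simp add: algebra_simps)+
  show "x * y * z = x * (y * z)" "(x + y) * z = x * z + y * z" "x * (y + z) = x * y + x * z"
    "r *\<^sub>R x * y = r *\<^sub>R (x * y)" "x * r *\<^sub>R y = r *\<^sub>R (x * y)" "1 * x = x" "x * 1 = x"
    by (transfer; simp add: blinfun_eqI blinfun.bilinear_simps)+
  have norm_id: "norm (id_blinfun :: ('a \<times> real) \<Rightarrow>\<^sub>L ('a \<times> real)) = 1"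
  proof (rule antisym)
    show "norm (id_blinfun :: ('a \<times> real) \<Rightarrow>\<^sub>L ('a \<times> real)) \<le> 1"
      by (rule norm_blinfun_bound) auto
    show "1 \<le> norm (id_blinfun :: ('a \<times> real) \<Rightarrow>\<^sub>L ('a \<times> real))"
      using norm_blinfun[of "id_blinfun :: ('a \<times> real) \<Rightarrow>\<^sub>L ('a \<times> real)" "(0, 1)"]
          by (simp add: norm_Pair)
  qed
  show "norm (1 :: 'a operator) = 1"
    by (transfer) (rule norm_id)
  then show "(0 :: 'a operator) \<noteq> 1"
    by transfer auto
  show "dist x y = norm (x - y)" "sgn x = scaleR (inverse (norm x)) x"
    by (simp_all add: dist_operator_def sgn_operator_def)
  show "uniformity = (INF e\<in>{0 <..}. principal {(x :: 'a operator, y). dist x y < e})"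
    by (rule uniformity_operator_def)
  show "open U = (\<forall>x\<in>U. \<forall>\<^sub>F (x', y) in uniformity. x' = x \<longrightarrow> y \<in> U)"
    by (rule open_operator_def)
  show "norm x = 0 \<longleftrightarrow> x = 0" "norm (r *\<^sub>R x) = \<bar>r\<bar> * norm x"
    by (transfer; simp)+
  show "norm (x + y) \<le> norm x + norm y"
    by transfer (rule norm_triangle_ineq)
  show "norm (x * y) \<le> norm x * norm y"
    by transfer (rule norm_blinfun_compose)
qed

end

instance operator :: (banach) banach
proof
  fix X :: "nat \<Rightarrow> 'a operator" assume X: "Cauchy X"
  have dist: "dist (blinfun_of x) (blinfun_of y) = dist x y" for x y :: "'a operator"
    unfolding dist_norm by (transfer; simp)
  have "Cauchy (\<lambda>n. blinfun_of (X n))"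
    using X by (simp add: Cauchy_def dist)
  then obtain L where "(\<lambda>n. blinfun_of (X n)) \<longlonglongrightarrow> L"
    using Cauchy_convergent convergent_def by blast
  then have "X \<longlonglongrightarrow> Operator L"
    by (simp add: tendsto_iff flip: dist) (simp add: Operator_inverse)
  then show "convergent X"
    by (rule convergentI)
qed

section \<open>Operators as elements of the algebra\<close>

lift_definition corner :: "'a::real_normed_vector operator \<Rightarrow> 'a \<Rightarrow> 'a" is
  "\<lambda>X x. fst (blinfun_apply X (x, 0))" .

lift_definition extend_operator :: "('a::real_normed_vector \<Rightarrow>\<^sub>L 'a) \<Rightarrow> 'a operator" is
  "\<lambda>B. Blinfun (\<lambda>p. (blinfun_apply B (fst p), 0))" .

lemma bounded_linear_corner: "bounded_linear (\<lambda>X. corner X x)"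
proof (rule bounded_linear_intro[where K = "norm x"])
  show "norm (corner X x) \<le> norm X * norm x" for X
  proof transfer
    show "norm (fst (blinfun_apply X (x, 0)))
        \<le> norm X * norm x" for X :: "('a \<times> real) \<Rightarrow>\<^sub>L ('a \<times> real)" and x
      using norm_fst_le[of "fst (blinfun_apply X (x, 0))" "snd (blinfun_apply X (x, 0))"]
        norm_blinfun[of X "(x, 0)"] by (simp add: norm_Pair)
  qed
qed (transfer, simp add: blinfun.bilinear_simps)+

lemma blinfun_apply_extend: "blinfun_apply (blinfun_of (extend_operator B)) p
    = (blinfun_apply B (fst p), 0)"
  unfolding extend_operator.rep_eq
  by (subst bounded_linear_Blinfun_apply) (auto intro!: bounded_linear_intros
      blinfun.bounded_linear_right)

lemma corner_one: "corner 1 x = x"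
  by transfer simp

text \<open>Compression to the first summand is not multiplicative in general, but an extended right
  factor maps into that summand. Products are therefore evaluated by peeling factors off from the
  right.\<close>

lemma corner_mult_extend: "corner (X * extend_operator B) x = corner X (blinfun_apply B x)"
  by (simp add: corner.rep_eq times_operator.rep_eq blinfun_apply_extend)

lemma corner_add_right: "corner X (x + y) = corner X x + corner X y"
  and corner_scaleR_right: "corner X (r *\<^sub>R x) = r *\<^sub>R corner X x"
  using blinfun.add_right[of "blinfun_of X" "(x, 0)" "(y, 0)"]
    blinfun.scaleR_right[of "blinfun_of X" r "(x, 0)"]
  by (simp_all add: corner.rep_eq)

lemma extend_operator_commute:
  assumes "\<And>x. blinfun_apply B (blinfun_apply C x) = blinfun_apply C (blinfun_apply B x)"
  shows "extend_operator B * extend_operator C = extend_operator C * extend_operator B"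
proof -
  have "blinfun_of (extend_operator B) o\<^sub>L blinfun_of (extend_operator C)
      = blinfun_of (extend_operator C) o\<^sub>L blinfun_of (extend_operator B)"
    by (rule blinfun_eqI) (simp add: blinfun_apply_extend assms)
  then show ?thesis
    by (simp flip: blinfun_of_inject times_operator.rep_eq)
qed

lemma extend_operator_add: "extend_operator (B + C) = extend_operator B + extend_operator C"
  and extend_operator_scaleR: "extend_operator (r *\<^sub>R B) = r *\<^sub>R extend_operator B"
  by (auto simp: plus_operator.rep_eq scaleR_operator.rep_eq blinfun_apply_extend
      blinfun.bilinear_simps simp flip: blinfun_of_inject intro!: blinfun_eqI)

text \<open>Links the exponential of the algebra with the vectorwise series \<open>op_exp\<close>:
  compression at \<open>x\<close> is bounded and linear, so it acts termwise.\<close>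

lemma corner_exp_extend: "corner (exp (extend_operator B)) x = op_exp (blinfun_apply B) x"
proof -
  have pow: "corner (extend_operator B ^ n) x = (blinfun_apply B ^^ n) x" for n x
    by (induction n arbitrary: x)
      (simp_all add: corner_one corner_mult_extend power_Suc2 funpow_Suc_right del: power_Suc
          funpow.simps(2))
  have "(\<lambda>n. corner (extend_operator B ^ n /\<^sub>R fact n) x) sums corner (exp (extend_operator B)) x"
    unfolding exp_def
    by (rule bounded_linear.sums[OF bounded_linear_corner summable_sums[OF summable_exp_generic]])
  moreover have "corner (extend_operator B ^ n /\<^sub>R fact n) x
      = (blinfun_apply B ^^ n) x /\<^sub>R fact n" for n
    by (simp add: linear_scale[OF bounded_linear.linear[OF bounded_linear_corner]] pow)
  ultimately show ?thesis
    by (simp add: op_exp_def sums_iff)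
qed

text \<open>A factor \<open>r n\<close> that is \<open>1\<close> up to less than the order of
  \<open>1 / n\<close> does not alter the first order term, so \<open>power_tendsto_exp\<close>
  applies to the damped steps. Commutativity merges the two exponentials.\<close>

lemma euler_products_tendsto_op_exp:
  fixes B1 B2 :: "'a::complex_hilbert_space \<Rightarrow> 'a" and a b :: "nat \<Rightarrow> nat"
  assumes B: "bounded_linear B1" "bounded_linear B2" and comm: "\<And>x. B1 (B2 x) = B2 (B1 x)"
    and r: "(\<lambda>n. real n * (r n - 1)) \<longlonglongrightarrow> 0"
    and a: "(\<lambda>n. a n / n) \<longlonglongrightarrow> s" and b: "(\<lambda>n. b n / n) \<longlonglongrightarrow> t"
  shows "(\<lambda>n. ((\<lambda>x. r n *\<^sub>R (x + B1 x /\<^sub>R n)) ^^ a n) (((\<lambda>x. r n *\<^sub>R (x + B2 x /\<^sub>R n)) ^^ b n) x))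
    \<longlonglongrightarrow> op_exp (\<lambda>x. s *\<^sub>R B1 x + t *\<^sub>R B2 x) x"
proof -
  obtain C1 C2 where C: "blinfun_apply C1 = B1" "blinfun_apply C2 = B2"
    using B bounded_linear_Blinfun_apply by metis
  define X1 X2 where "X1 = extend_operator C1" and "X2 = extend_operator C2"
  have X: "X1 * X2 = X2 * X1"
    unfolding X1_def X2_def by (rule extend_operator_commute) (simp add: C comm)
  define Z where "Z X n = r n *\<^sub>R (1 + X /\<^sub>R real n)" for X :: "'a operator" and n
  have r1: "r \<longlonglongrightarrow> 1"
  proof -
    have "(\<lambda>n. inverse (real n) * (real n * (r n - 1))) \<longlonglongrightarrow> 0 * 0"
      by (intro tendsto_intros r lim_inverse_n)
    moreover have "\<forall>\<^sub>F n in sequentially. inverse (real n) * (real n * (r n - 1)) = r n - 1"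
      by (rule eventually_sequentiallyI[of 1]) simp
    ultimately have "(\<lambda>n. r n - 1) \<longlonglongrightarrow> 0 * 0"
      by (rule Lim_transform_eventually)
    then show ?thesis
      by (simp add: LIM_zero_iff)
  qed
  have Z: "(\<lambda>n. real n *\<^sub>R (Z X n - 1)) \<longlonglongrightarrow> X" for X
  proof -
    have "(\<lambda>n. (real n * (r n - 1)) *\<^sub>R 1 + r n *\<^sub>R X) \<longlonglongrightarrow> 0 *\<^sub>R 1 + 1 *\<^sub>R X"
      by (intro tendsto_intros r r1)
    moreover have "\<forall>\<^sub>F n in sequentially. (real n * (r n - 1)) *\<^sub>R 1 + r n *\<^sub>R X
        = real n *\<^sub>R (Z X n - 1)"
      by (rule eventually_sequentiallyI[of 1]) (simp add: Z_def scaleR_right_distrib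
          scaleR_diff_right
          scaleR_left_diff_distrib right_diff_distrib)
    ultimately have "(\<lambda>n. real n *\<^sub>R (Z X n - 1)) \<longlonglongrightarrow> 0 *\<^sub>R 1 + 1 *\<^sub>R X"
      by (rule Lim_transform_eventually)
    then show ?thesis
      by simp
  qed
  have "(\<lambda>n. Z X1 n ^ a n * Z X2 n ^ b n) \<longlonglongrightarrow> exp (s *\<^sub>R X1) * exp (t *\<^sub>R X2)"
    by (intro tendsto_mult power_tendsto_exp Z a b)
  also have "exp (s *\<^sub>R X1) * exp (t *\<^sub>R X2) = exp (extend_operator (s *\<^sub>R C1 + t *\<^sub>R C2))"
    using X by (simp add: exp_add_commuting extend_operator_add extend_operator_scaleR flip: X1_def
        X2_def)
  finally have "(\<lambda>n. corner (Z X1 n ^ a n * Z X2 n ^ b n) x)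
      \<longlonglongrightarrow> corner (exp (extend_operator (s *\<^sub>R C1 + t *\<^sub>R C2))) x"
    by (rule bounded_linear.tendsto[OF bounded_linear_corner])
  moreover have "corner (exp (extend_operator (s *\<^sub>R C1 + t *\<^sub>R C2))) x
      = op_exp (\<lambda>x. s *\<^sub>R B1 x + t *\<^sub>R B2 x) x"
    unfolding corner_exp_extend by (rule arg_cong[of _ _ "\<lambda>B. op_exp B x"])
      (simp add: fun_eq_iff blinfun.bilinear_simps C)
  ultimately have L: "(\<lambda>n. corner (Z X1 n ^ a n * Z X2 n ^ b n) x)
      \<longlonglongrightarrow> op_exp (\<lambda>x. s *\<^sub>R B1 x + t *\<^sub>R B2 x) x"
    by (simp only:)
  have pow: "corner (Y * Z (extend_operator C) n ^ k) x
      = corner Y (((\<lambda>x. r n *\<^sub>R (x + blinfun_apply C x /\<^sub>R n)) ^^ k) x)" for Y C n k x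
  proof (induction k arbitrary: x)
    case (Suc k)
    have "corner (Y' * Z (extend_operator C) n) x
        = corner Y' (r n *\<^sub>R (x + blinfun_apply C x /\<^sub>R n))" for Y' x
    proof -
      note lin = bounded_linear.linear[OF bounded_linear_corner]
      show ?thesis
        by (simp add: Z_def distrib_left linear_add[OF lin] linear_scale[OF lin] corner_mult_extend
            corner_add_right corner_scaleR_right)
    qed
    from this[of "Y * Z (extend_operator C) n ^ k" x] show ?case
      by (simp add: Suc.IH power_Suc2 funpow_Suc_right mult.assoc del: power_Suc funpow.simps(2))
  qed simp
  have "corner (Z X1 n ^ a n * Z X2 n ^ b n) x
      = ((\<lambda>x. r n *\<^sub>R (x + B1 x /\<^sub>R n)) ^^ a n) (((\<lambda>x. r n *\<^sub>R (x + B2 x /\<^sub>R n)) ^^ b n) x)" for n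
    using pow[of "Z X1 n ^ a n" C2 n "b n" x] pow[of 1 C1 n "a n"]
    by (simp only: X1_def X2_def C corner_one mult_1_left)
  with L show ?thesis
    by (simp only:)
qed

section \<open>Completion of inner product spaces of functions\<close>

text \<open>Conditions under which the completion consists of functions of the same type, as the
  prescribed type of the dilation space requires. Bounded evaluations give Cauchy sequences a
  pointwise limit; \<open>weak_null\<close> makes this limit determine the element.\<close>

locale pointwise_space = inner_product_space K
  for K :: "('s \<Rightarrow> 'a::complex_hilbert_space) hilbert" +
  fixes C :: "'s \<Rightarrow> real"
  assumes pointwise [simp]: "hzero K = 0" "hadd K = (+)" "hscale K = (\<lambda>c f s. c *\<^sub>C f s)"
    and norm_apply_le: "f \<in> hcarrier K \<Longrightarrow> norm (f s) \<le> C s * hnorm K f"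
    and weak_null: "\<lbrakk>\<And>n. u n \<in> hcarrier K; \<And>s. (\<lambda>n. u n s) \<longlonglongrightarrow> 0; g \<in> hcarrier K\<rbrakk>
      \<Longrightarrow> (\<lambda>n. hinner K (u n) g) \<longlonglongrightarrow> 0"
begin

lemma diff_eq: "f - g = hadd K f (hscale K (-1) g)"
  by (simp add: fun_eq_iff scaleC_minus_one)

lemma diff_closed: "f \<in> hcarrier K \<Longrightarrow> g \<in> hcarrier K \<Longrightarrow> f - g \<in> hcarrier K"
  unfolding diff_eq by (intro add_closed scale_closed)

lemma sum_closed: "f \<in> hcarrier K \<Longrightarrow> g \<in> hcarrier K \<Longrightarrow> f + g \<in> hcarrier K"
  using add_closed by simp

lemma inner_sum_left:
  "\<lbrakk>f \<in> hcarrier K; g \<in> hcarrier K; h \<in> hcarrier K\<rbrakk>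
      \<Longrightarrow> hinner K (f + g) h = hinner K f h + hinner K g h"
  using inner_add_left by simp

lemma inner_diff_left:
  "\<lbrakk>f \<in> hcarrier K; g \<in> hcarrier K; h \<in> hcarrier K\<rbrakk>
      \<Longrightarrow> hinner K (f - g) h = hinner K f h - hinner K g h"
  unfolding diff_eq by (simp only: inner_add_left inner_scale_left scale_closed) simp

lemma inner_diff_right:
  "\<lbrakk>f \<in> hcarrier K; g \<in> hcarrier K; h \<in> hcarrier K\<rbrakk>
      \<Longrightarrow> hinner K h (f - g) = hinner K h f - hinner K h g"
  unfolding diff_eq by (simp only: inner_add_right inner_scale_right scale_closed) simp

lemma hnorm_nonneg: "f \<in> hcarrier K \<Longrightarrow> 0 \<le> hnorm K f"
  by (rule inner_self(2))

lemma hnorm_sum_le: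
  "f \<in> hcarrier K \<Longrightarrow> g \<in> hcarrier K \<Longrightarrow> hnorm K (f + g) \<le> hnorm K f + hnorm K g"
  using hnorm_triangle by simp

section \<open>Cauchy sequences with a pointwise limit\<close>

definition approx :: "('s \<Rightarrow> 'a) \<Rightarrow> (nat \<Rightarrow> 's \<Rightarrow> 'a) \<Rightarrow> bool" where
  "approx f u \<longleftrightarrow> (\<forall>n. u n \<in> hcarrier K) \<and>
    (\<forall>e>0. \<exists>M. \<forall>m\<ge>M. \<forall>n\<ge>M. hnorm K (u m - u n) < e) \<and> (\<forall>s. (\<lambda>n. u n s) \<longlonglongrightarrow> f s)"

lemma approxD:
  assumes "approx f u"
  shows "u n \<in> hcarrier K" "(\<lambda>n. u n s) \<longlonglongrightarrow> f s"
    "0 < e \<Longrightarrow> \<exists>M. \<forall>m\<ge>M. \<forall>n\<ge>M. hnorm K (u m - u n) < e"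
  using assms by (auto simp: approx_def)

lemma approx_const: "f \<in> hcarrier K \<Longrightarrow> approx f (\<lambda>n. f)"
  using hnorm_eq_0[OF zero_closed] by (auto simp: approx_def)

lemma approx_add:
  assumes u: "approx f u" and v: "approx g v"
  shows "approx (f + g) (\<lambda>n. u n + v n)"
  unfolding approx_def
proof (intro conjI allI impI)
  fix e :: real assume e: "e > 0"
  obtain M where M: "\<And>m n. m \<ge> M \<Longrightarrow> n \<ge> M \<Longrightarrow> hnorm K (u m - u n) < e / 2"
    using approxD(3)[OF u half_gt_zero[OF e]] by blast
  obtain N where N: "\<And>m n. m \<ge> N \<Longrightarrow> n \<ge> N \<Longrightarrow> hnorm K (v m - v n) < e / 2"
    using approxD(3)[OF v half_gt_zero[OF e]] by blast
  have "hnorm K (u m + v m - (u n + v n)) < e" if "m \<ge> max M N" "n \<ge> max M N" for m n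
  proof -
    have "u m + v m - (u n + v n) = (u m - u n) + (v m - v n)"
      by simp
    then have "hnorm K (u m + v m - (u n + v n)) \<le> hnorm K (u m - u n) + hnorm K (v m - v n)"
      using hnorm_sum_le approxD(1)[OF u] approxD(1)[OF v] by (simp only: diff_closed)
    then show ?thesis
      using M[of m n] N[of m n] that by simp
  qed
  then show "\<exists>M. \<forall>m\<ge>M. \<forall>n\<ge>M. hnorm K (u m + v m - (u n + v n)) < e"
    by blast
qed (auto intro!: sum_closed tendsto_add approxD[OF u] approxD[OF v])

lemma approx_scale:
  assumes u: "approx f u"
  shows "approx (\<lambda>s. c *\<^sub>C f s) (\<lambda>n s. c *\<^sub>C u n s)"
  unfolding approx_def
proof (intro conjI allI impI)
  show "(\<lambda>s. c *\<^sub>C u n s) \<in> hcarrier K" for n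
    using scale_closed[OF approxD(1)[OF u, of n], of c] by simp
  show "(\<lambda>n. c *\<^sub>C u n s) \<longlonglongrightarrow> c *\<^sub>C f s" for s
    by (rule bounded_linear.tendsto[OF bounded_linear_scaleC approxD(2)[OF u]])
  fix e :: real assume "e > 0"
  then obtain M where M: "\<And>m n. m \<ge> M \<Longrightarrow> n \<ge> M \<Longrightarrow> hnorm K (u m - u n) < e / (cmod c + 1)"
    using approxD(3)[OF u, of "e / (cmod c + 1)"] by (auto simp: add_nonneg_pos)
  have "hnorm K ((\<lambda>s. c *\<^sub>C u m s) - (\<lambda>s. c *\<^sub>C u n s)) < e" if "m \<ge> M" "n \<ge> M" for m n
  proof -
    have "(\<lambda>s. c *\<^sub>C u m s) - (\<lambda>s. c *\<^sub>C u n s) = hscale K c (u m - u n)"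
      by (simp add: fun_eq_iff scaleC_diff_right)
    then have "hnorm K ((\<lambda>s. c *\<^sub>C u m s) - (\<lambda>s. c *\<^sub>C u n s)) = cmod c * hnorm K (u m - u n)"
      using hnorm_scale approxD(1)[OF u] by (simp only: diff_closed)
    also have "\<dots> \<le> (cmod c + 1) * hnorm K (u m - u n)"
      by (simp add: mult_right_mono hnorm_nonneg diff_closed approxD(1)[OF u])
    also have "\<dots> < e"
      using M[OF that] by (simp add: pos_less_divide_eq add_nonneg_pos mult.commute)
    finally show ?thesis .
  qed
  then show "\<exists>M. \<forall>m\<ge>M. \<forall>n\<ge>M. hnorm K ((\<lambda>s. c *\<^sub>C u m s) - (\<lambda>s. c *\<^sub>C u n s)) < e"
    by blast
qed

lemma approx_diff:
  assumes "approx f u" "approx g v"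
  shows "approx (f - g) (\<lambda>n. u n - v n)"
proof -
  have "(\<lambda>s. f s + (- 1) *\<^sub>C g s) = f - g" "(\<lambda>s. u n s + (- 1) *\<^sub>C v n s) = u n - v n" for n
    by (simp_all add: fun_eq_iff scaleC_minus_one)
  then show ?thesis
    using approx_add[OF assms(1) approx_scale[OF assms(2), of "-1"]] by (simp add: plus_fun_def)
qed

lemma approx_bounded:
  assumes u: "approx f u"
  obtains B where "0 < B" "\<And>n. hnorm K (u n) \<le> B"
proof -
  obtain M where M: "\<And>m n. m \<ge> M \<Longrightarrow> n \<ge> M \<Longrightarrow> hnorm K (u m - u n) < 1"
    using approxD(3)[OF u, of 1] by auto
  define B where "B = 1 + (\<Sum>n\<le>M. hnorm K (u n))"
  have nn: "0 \<le> hnorm K (u n)" for n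
    by (intro hnorm_nonneg approxD(1)[OF u])
  have le: "hnorm K (u n) \<le> B - 1" if "n \<le> M" for n
    unfolding B_def using nn that member_le_sum[of n "{..M}" "\<lambda>n. hnorm K (u n)"] by simp
  have "hnorm K (u n) \<le> B" for n
  proof (cases "n \<le> M")
    case False
    have "u n = (u n - u M) + u M"
      by simp
    then have "hnorm K (u n) \<le> hnorm K (u n - u M) + hnorm K (u M)"
      using hnorm_sum_le approxD(1)[OF u] diff_closed by metis
    then show ?thesis
      using M[of n M] le[of M] False by simp
  qed (use le in fastforce)
  moreover have "0 < B"
    using nn by (simp add: B_def add_pos_nonneg sum_nonneg)
  ultimately show ?thesis
    using that by blast
qed

text \<open>Injectivity of the passage to functions. The square of the norm of \<open>u n\<close> is
  its inner product with \<open>u n - u M\<close> plus that with \<open>u M\<close>: the former is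
  small by the Cauchy property and boundedness, the latter by \<open>weak_null\<close> for fixed
  \<open>M\<close>.\<close>

lemma approx_zero:
  assumes u: "approx 0 u"
  shows "(\<lambda>n. hnorm K (u n)) \<longlonglongrightarrow> 0"
proof -
  obtain B where B: "0 < B" "\<And>n. hnorm K (u n) \<le> B"
    using approx_bounded[OF u] by blast
  have "(\<lambda>n. (hnorm K (u n))\<^sup>2) \<longlonglongrightarrow> 0"
  proof (rule LIMSEQ_I)
    fix e :: real assume e: "e > 0"
    obtain M where M: "\<And>m n. m \<ge> M \<Longrightarrow> n \<ge> M \<Longrightarrow> hnorm K (u m - u n) < e / (2 * B)"
      using approxD(3)[OF u, of "e / (2 * B)"] e B by auto
    have "(\<lambda>n. hinner K (u n) (u M)) \<longlonglongrightarrow> 0"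
      using approxD[OF u] by (intro weak_null) auto
    from LIMSEQ_D[OF this, of "e / 2"] obtain N where N: "\<And>n. n \<ge> N
        \<Longrightarrow> cmod (hinner K (u n) (u M)) < e / 2"
      using e by auto
    have "(hnorm K (u n))\<^sup>2 < e" if "n \<ge> max M N" for n
    proof -
      note cl = approxD(1)[OF u] diff_closed[OF approxD(1)[OF u] approxD(1)[OF u]]
      have "complex_of_real ((hnorm K (u n))\<^sup>2) = hinner K (u n) (u n - u M) + hinner K (u n) (u M)"
        using inner_self(1)[OF cl(1)] by (simp add: inner_diff_right cl)
      then have "(hnorm K (u n))\<^sup>2 \<le> cmod (hinner K (u n) (u n - u M))
          + cmod (hinner K (u n) (u M))"
        by (metis norm_of_real abs_power2 norm_triangle_ineq)
      also have "cmod (hinner K (u n) (u n - u M)) \<le> hnorm K (u n) * hnorm K (u n - u M)"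
        by (intro cmod_inner_le cl)
      also have "\<dots> \<le> B * (e / (2 * B))"
        using B M[of n M] that hnorm_nonneg[OF cl(1)] hnorm_nonneg[OF cl(2)]
        by (intro mult_mono) (auto intro: less_imp_le)
      also have "\<dots> = e / 2"
        using B by simp
      finally show ?thesis
        using N[of n] that by simp
    qed
    then show "\<exists>no. \<forall>n\<ge>no. norm ((hnorm K (u n))\<^sup>2 - 0) < e"
      by (intro exI[of _ "max M N"]) simp
  qed
  then have "(\<lambda>n. sqrt ((hnorm K (u n))\<^sup>2)) \<longlonglongrightarrow> sqrt 0"
    by (rule tendsto_real_sqrt)
  then show ?thesis
    using hnorm_nonneg[OF approxD(1)[OF u]] by simp
qed

lemma inner_diff_le:
  assumes "f \<in> hcarrier K" "f' \<in> hcarrier K" "g \<in> hcarrier K" "g' \<in> hcarrier K"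
  shows "cmod (hinner K f g - hinner K f' g')
      \<le> hnorm K (f - f') * hnorm K g + hnorm K f' * hnorm K (g - g')"
proof -
  have "hinner K f g - hinner K f' g' = hinner K (f - f') g + hinner K f' (g - g')"
    using assms by (simp add: inner_diff_left inner_diff_right)
  then show ?thesis
    using norm_triangle_le add_mono cmod_inner_le assms diff_closed by metis
qed

lemma approx_inner_Cauchy:
  assumes u: "approx f u" and v: "approx g v"
  shows "convergent (\<lambda>n. hinner K (u n) (v n))"
proof (rule Cauchy_convergent, rule metric_CauchyI)
  fix e :: real assume e: "e > 0"
  obtain A where A: "0 < A" "\<And>n. hnorm K (u n) \<le> A"
    using approx_bounded[OF u] by blast
  obtain B where B: "0 < B" "\<And>n. hnorm K (v n) \<le> B"
    using approx_bounded[OF v] by blast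
  obtain M where M: "\<And>m n. m \<ge> M \<Longrightarrow> n \<ge> M \<Longrightarrow> hnorm K (u m - u n) < e / (2 * B)"
    using approxD(3)[OF u, of "e / (2 * B)"] e B by auto
  obtain N where N: "\<And>m n. m \<ge> N \<Longrightarrow> n \<ge> N \<Longrightarrow> hnorm K (v m - v n) < e / (2 * A)"
    using approxD(3)[OF v, of "e / (2 * A)"] e A by auto
  have "dist (hinner K (u m) (v m)) (hinner K (u n) (v n))
      < e" if "m \<ge> max M N" "n \<ge> max M N" for m n
  proof -
    note cl = approxD(1)[OF u] approxD(1)[OF v]
    have "dist (hinner K (u m) (v m)) (hinner K (u n) (v n))
      \<le> hnorm K (u m - u n) * hnorm K (v m) + hnorm K (u n) * hnorm K (v m - v n)"
      unfolding dist_norm by (intro inner_diff_le cl)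
    also have "\<dots> \<le> hnorm K (u m - u n) * B + A * hnorm K (v m - v n)"
      using A B by (intro add_mono mult_left_mono mult_right_mono hnorm_nonneg diff_closed cl)
    also have "\<dots> < e / (2 * B) * B + A * (e / (2 * A))"
      using M[of m n] N[of m n] that A B by (intro add_strict_mono mult_strict_right_mono
          mult_strict_left_mono) auto
    also have "\<dots> = e"
      using A B by simp
    finally show ?thesis .
  qed
  then show "\<exists>M. \<forall>m\<ge>M. \<forall>n\<ge>M. dist (hinner K (u m) (v m)) (hinner K (u n) (v n)) < e"
    by blast
qed

lemma approx_unique:
  assumes "approx f u" "approx f u'"
  shows "(\<lambda>n. hnorm K (u n - u' n)) \<longlonglongrightarrow> 0"
  using approx_diff[OF assms] by (intro approx_zero) simp

section \<open>The completed inner product\<close>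

definition completion_inner :: "('s \<Rightarrow> 'a) \<Rightarrow> ('s \<Rightarrow> 'a) \<Rightarrow> complex" where
  "completion_inner f g = lim (\<lambda>n. hinner K ((SOME u. approx f u) n) ((SOME v. approx g v) n))"

text \<open>The choices in \<open>completion_inner\<close> do not matter, as two sequences for the
  same function differ by one that tends to zero in norm.\<close>

lemma completion_inner_tendsto:
  assumes u: "approx f u" and v: "approx g v"
  shows "(\<lambda>n. hinner K (u n) (v n)) \<longlonglongrightarrow> completion_inner f g"
proof -
  define u' v' where "u' = (SOME u. approx f u)" and "v' = (SOME v. approx g v)"
  have u': "approx f u'" and v': "approx g v'"
    unfolding u'_def v'_def 
    by (rule someI[where P = "approx f", OF u], rule someI[where P = "approx g", OF v])
  obtain A where A: "0 < A" "\<And>n. hnorm K (u' n) \<le> A"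
    using approx_bounded[OF u'] by blast
  obtain B where B: "0 < B" "\<And>n. hnorm K (v n) \<le> B"
    using approx_bounded[OF v] by blast
  note cl = approxD(1)[OF u] approxD(1)[OF v] approxD(1)[OF u'] approxD(1)[OF v']
  have le: "cmod (hinner K (u n) (v n) - hinner K (u' n) (v' n))
    \<le> hnorm K (u n - u' n) * B + A * hnorm K (v n - v' n)" for n
  proof -
    have "hnorm K (u n - u' n) * hnorm K (v n) + hnorm K (u' n) * hnorm K (v n - v' n)
      \<le> hnorm K (u n - u' n) * B + A * hnorm K (v n - v' n)"
      using A B by (intro add_mono mult_left_mono mult_right_mono hnorm_nonneg diff_closed cl)
    then show ?thesis
      using inner_diff_le[of "u n" "u' n" "v n" "v' n"] cl by simp
  qed
  have "(\<lambda>n. hnorm K (u n - u' n) * B + A * hnorm K (v n - v' n)) \<longlonglongrightarrow> 0 * B + A * 0"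
    by (intro tendsto_intros approx_unique[OF u u'] approx_unique[OF v v'])
  then have lim0: "(\<lambda>n. hnorm K (u n - u' n) * B + A * hnorm K (v n - v' n)) \<longlonglongrightarrow> 0"
    by simp
  have "\<forall>\<^sub>F n in sequentially. cmod (hinner K (u n) (v n) - hinner K (u' n) (v' n))
      \<le> hnorm K (u n - u' n) * B + A * hnorm K (v n - v' n)"
    by (rule always_eventually) (rule allI, rule le)
  then have "(\<lambda>n. hinner K (u n) (v n) - hinner K (u' n) (v' n)) \<longlonglongrightarrow> 0"
    using lim0 by (rule Lim_null_comparison)
  moreover have "(\<lambda>n. hinner K (u' n) (v' n)) \<longlonglongrightarrow> completion_inner f g"
    using approx_inner_Cauchy[OF u' v'] unfolding completion_inner_def u'_def v'_def
    by (rule convergent_LIMSEQ_iff[THEN iffD1])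
  ultimately show ?thesis
    by (rule Lim_transform[rotated])
qed

definition completion :: "('s \<Rightarrow> 'a) hilbert" where
  "completion = \<lparr>hcarrier = {f. \<exists>u. approx f u}, hzero = 0, hadd = (+),
    hscale = (\<lambda>c f s. c *\<^sub>C f s), hinner = completion_inner\<rparr>"

lemma completion_simps [simp]:
  "f \<in> hcarrier completion \<longleftrightarrow> (\<exists>u. approx f u)" "hzero completion = 0" "hadd completion = (+)"
  "hscale completion = (\<lambda>c f s. c *\<^sub>C f s)" "hinner completion = completion_inner"
  by (simp_all add: completion_def)

lemma completion_hnorm_tendsto:
  assumes "approx f u"
  shows "(\<lambda>n. hnorm K (u n)) \<longlonglongrightarrow> hnorm completion f"
  unfolding hnorm_def completion_simps
  by (intro tendsto_real_sqrt tendsto_Re completion_inner_tendsto assms)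

lemma completion_norm_apply_le:
  assumes "approx f u"
  shows "norm (f s) \<le> C s * hnorm completion f"
proof (rule LIMSEQ_le[of "\<lambda>n. norm (u n s)" _ "\<lambda>n. C s * hnorm K (u n)"])
  show "(\<lambda>n. norm (u n s)) \<longlonglongrightarrow> norm (f s)"
    by (intro tendsto_norm approxD(2)[OF assms])
  show "(\<lambda>n. C s * hnorm K (u n)) \<longlonglongrightarrow> C s * hnorm completion f"
    by (intro tendsto_mult_left completion_hnorm_tendsto assms)
  have "norm (u n s) \<le> C s * hnorm K (u n)" for n
    by (intro norm_apply_le approxD(1)[OF assms])
  then show "\<exists>N. \<forall>n\<ge>N. norm (u n s) \<le> C s * hnorm K (u n)"
    by blast
qed

sublocale compl: inner_product_space completion
proof
  fix f g h :: "'s \<Rightarrow> 'a" and c d :: complex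
  show "hzero completion \<in> hcarrier completion"
    using approx_const[OF zero_closed] by auto
  assume f': "f \<in> hcarrier completion"
  then obtain u where u: "approx f u"
    by auto
  show "hscale completion c f \<in> hcarrier completion"
    using approx_scale[OF u] by auto
  show "hadd completion f (hzero completion) = f"
    "hadd completion f (hscale completion (-1) f) = hzero completion"
    "hscale completion (c + d) f = hadd completion (hscale completion c f) (hscale completion d f)"
    "hscale completion c (hscale completion d f) = hscale completion (c * d) f"
    "hscale completion 1 f = f"
    by (simp_all add: fun_eq_iff scaleC_minus_one scaleC_add_left scaleC_scaleC)
  have nonneg: "0 \<le> completion_inner f f"
  proof -
    have *: "hinner K (u n) (u n) = complex_of_real ((hnorm K (u n))\<^sup>2)" for n
      using inner_self(1) approxD(1)[OF u] by blast
    have "(\<lambda>n. complex_of_real ((hnorm K (u n))\<^sup>2)) \<longlonglongrightarrow> complex_of_real ((hnorm completion f)\<^sup>2)"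
      by (intro tendsto_of_real tendsto_power completion_hnorm_tendsto u)
    then have "completion_inner f f = complex_of_real ((hnorm completion f)\<^sup>2)"
      using completion_inner_tendsto[OF u u] unfolding * by (rule LIMSEQ_unique[rotated])
    then show ?thesis
      by (simp add: less_eq_complex_def)
  qed
  show "0 < hinner completion f f" if "f \<noteq> hzero completion"
  proof -
    have "completion_inner f f \<noteq> 0"
    proof
      assume "completion_inner f f = 0"
      then have "hnorm completion f = 0"
        by (simp add: hnorm_def)
      then have "norm (f s) \<le> 0" for s
        using completion_norm_apply_le[OF u, of s] by simp
      then show False
        using that by (simp add: fun_eq_iff)
    qed
    then show ?thesis
      using nonneg by (simp add: less_le)
  qed
  assume "g \<in> hcarrier completion"
  then obtain v where v: "approx g v"
    by auto
  show "hadd completion f g \<in> hcarrier completion"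
    using approx_add[OF u v] by auto
  show "hadd completion f g = hadd completion g f"
    "hscale completion c (hadd completion f g)
        = hadd completion (hscale completion c f) (hscale completion c g)"
    by (simp_all add: fun_eq_iff scaleC_add_right add.commute)
  show "hinner completion f g = cnj (hinner completion g f)"
  proof (rule LIMSEQ_unique)
    show "(\<lambda>n. cnj (hinner K (v n) (u n))) \<longlonglongrightarrow> cnj (hinner completion g f)"
      using completion_inner_tendsto[OF v u] by (simp add: tendsto_cnj)
    have "cnj (hinner K (v n) (u n)) = hinner K (u n) (v n)" for n
      using inner_commute[OF approxD(1)[OF u] approxD(1)[OF v]] by simp
    then show "(\<lambda>n. cnj (hinner K (v n) (u n))) \<longlonglongrightarrow> hinner completion f g"
      using completion_inner_tendsto[OF u v] by simp
  qed
  show "hinner completion (hscale completion c f) g = c * hinner completion f g"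
  proof (rule LIMSEQ_unique)
    have "hinner K (\<lambda>s. c *\<^sub>C u n s) (v n) = c * hinner K (u n) (v n)" for n
      using inner_scale_left[OF approxD(1)[OF u] approxD(1)[OF v]] by simp
    then show "(\<lambda>n. c * hinner K (u n) (v n)) \<longlonglongrightarrow> hinner completion (hscale completion c f) g"
      using completion_inner_tendsto[OF approx_scale[OF u, of c] v] by simp
    show "(\<lambda>n. c * hinner K (u n) (v n)) \<longlonglongrightarrow> c * hinner completion f g"
      using completion_inner_tendsto[OF u v] by (simp add: tendsto_mult_left)
  qed
  assume "h \<in> hcarrier completion"
  then obtain w where w: "approx h w"
    by auto
  show "hadd completion (hadd completion f g) h = hadd completion f (hadd completion g h)"
    by (simp add: add.assoc)
  show "hinner completion (hadd completion f g) h = hinner completion f h + hinner completion g h"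
  proof (rule LIMSEQ_unique)
    have "hinner K (u n + v n) (w n) = hinner K (u n) (w n) + hinner K (v n) (w n)" for n
      by (intro inner_sum_left approxD(1)[OF u] approxD(1)[OF v] approxD(1)[OF w])
    then show "(\<lambda>n. hinner K (u n) (w n) + hinner K (v n) (w n))
        \<longlonglongrightarrow> hinner completion (hadd completion f g) h"
      using completion_inner_tendsto[OF approx_add[OF u v] w] by simp
    show "(\<lambda>n. hinner K (u n) (w n) + hinner K (v n) (w n))
        \<longlonglongrightarrow> hinner completion f h + hinner completion g h"
      using completion_inner_tendsto[OF u w] completion_inner_tendsto[OF v w]
          by (simp add: tendsto_add)
  qed
qed

lemma completion_inner_eq:
  assumes "f \<in> hcarrier K" "g \<in> hcarrier K"
  shows "completion_inner f g = hinner K f g"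
  using completion_inner_tendsto[OF assms[THEN approx_const]] by (simp add: LIMSEQ_const_iff)

lemma completion_hnorm_eq: "f \<in> hcarrier K \<Longrightarrow> hnorm completion f = hnorm K f"
  by (simp add: hnorm_def completion_inner_eq)

lemma completion_carrier_mono: "f \<in> hcarrier K \<Longrightarrow> f \<in> hcarrier completion"
  using approx_const by auto

lemma completion_hdist:
  assumes "f \<in> hcarrier completion" "g \<in> hcarrier completion"
  shows "hdist completion f g = hnorm completion (f - g)"
proof -
  have "hadd completion f (hscale completion (-1) g) = f - g"
    by (simp add: fun_eq_iff scaleC_minus_one)
  then show ?thesis
    using assms by (simp only: hdist_def simp_thms if_True)
qed

lemma completion_dense:
  assumes u: "approx f u"
  shows "(\<lambda>m. hdist completion f (u m)) \<longlonglongrightarrow> 0"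
proof (rule LIMSEQ_I)
  fix e :: real assume e: "e > 0"
  obtain M where M: "\<And>m n. m \<ge> M \<Longrightarrow> n \<ge> M \<Longrightarrow> hnorm K (u m - u n) < e / 2"
    using approxD(3)[OF u, of "e / 2"] e by auto
  have "hdist completion f (u m) < e" if "m \<ge> M" for m
  proof -
    have "(\<lambda>n. hnorm K (u n - u m)) \<longlonglongrightarrow> hnorm completion (f - u m)"
      by (intro completion_hnorm_tendsto approx_diff u approx_const approxD(1)[OF u])
    then have "hnorm completion (f - u m) \<le> e / 2"
      using M that by (intro LIMSEQ_le_const2) (auto intro: less_imp_le)
    moreover have "hdist completion f (u m) = hnorm completion (f - u m)"
      using u completion_carrier_mono[OF approxD(1)[OF u, of m]] by (intro completion_hdist) auto
    ultimately show ?thesis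
      using e by simp
  qed
  then show "\<exists>no. \<forall>n\<ge>no. norm (hdist completion f (u n) - 0) < e"
    using compl.nonneg by auto
qed

text \<open>The terms of a Cauchy sequence are replaced by nearby elements \<open>w k\<close> of the
  original space. Evaluations are bounded and values lie in a complete space, so \<open>w\<close>
  has a pointwise limit, which it approximates by definition.\<close>

theorem hilbert_space_completion: "hilbert_space completion"
proof (intro hilbert_space.intro hilbert_space_axioms.intro)
  show "compl.mcomplete"
    unfolding compl.mcomplete_def
  proof (intro allI impI)
    fix \<sigma> assume \<sigma>: "compl.MCauchy \<sigma>"
    then have \<sigma>_cl: "\<sigma> n \<in> hcarrier completion" for n
      unfolding compl.MCauchy_def by (metis range_subsetD)
    have "\<exists>w\<in>hcarrier K. hdist completion (\<sigma> k) w < inverse (Suc k)" for k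
    proof -
      obtain u where u: "approx (\<sigma> k) u"
        using \<sigma>_cl[of k] by auto
      have "\<forall>\<^sub>F m in sequentially. hdist completion (\<sigma> k) (u m) < inverse (Suc k)"
        using completion_dense[OF u] by (rule order_tendstoD) simp
      then obtain m where "hdist completion (\<sigma> k) (u m) < inverse (Suc k)"
        using eventually_happens' sequentially_bot by blast
      then show ?thesis
        using approxD(1)[OF u] by blast
    qed
    then obtain w where w: "\<And>k. w k \<in> hcarrier K" "\<And>k. hdist completion (\<sigma> k) (w k)
        < inverse (Suc k)"
      by metis
    have w_cl: "w k \<in> hcarrier completion" for k
      by (rule completion_carrier_mono[OF w(1)])
    have Cauchy_w: "\<exists>M. \<forall>m\<ge>M. \<forall>n\<ge>M. hnorm K (w m - w n) < e" if e: "e > 0" for e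
    proof -
      obtain M where M: "\<And>m n. m \<ge> M \<Longrightarrow> n \<ge> M \<Longrightarrow> hdist completion (\<sigma> m) (\<sigma> n) < e / 3"
        using \<sigma> e unfolding compl.MCauchy_def by (metis divide_pos_pos zero_less_numeral)
      obtain N where N: "inverse (Suc N) < e / 3"
        using reals_Archimedean[of "e / 3"] e by auto
      have "hnorm K (w m - w n) < e" if "m \<ge> max M N" "n \<ge> max M N" for m n
      proof -
        have inv: "inverse (real (Suc k)) < e / 3" if "k \<ge> N" for k
          using N that by (smt (verit) inverse_le_imp_le of_nat_0_less_iff of_nat_Suc of_nat_mono
              zero_less_Suc
              inverse_positive_iff_positive le_imp_inverse_le of_nat_le_iff Suc_le_mono)
        have "hdist completion (w m) (w n) \<le> hdist completion (w m) (\<sigma> m)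
            + (hdist completion (\<sigma> m) (\<sigma> n) + hdist completion (\<sigma> n) (w n))"
          using compl.triangle[OF w_cl[of m] \<sigma>_cl[of m] w_cl[of n]]
            compl.triangle[OF \<sigma>_cl[of m] \<sigma>_cl[of n] w_cl[of n]] by linarith
        also have "\<dots> < e / 3 + (e / 3 + e / 3)"
          using M[of m n] w(2)[of m] w(2)[of n] inv[of m] inv[of n] that compl.commute[of "w m" "\<sigma>
              m"] by simp
        finally have "hdist completion (w m) (w n) < e"
          by simp
        moreover have "hdist completion (w m) (w n) = hnorm K (w m - w n)"
          using completion_hdist[OF w_cl w_cl] completion_hnorm_eq[OF diff_closed[OF w(1) w(1)]]
              by simp
        ultimately show ?thesis
          by simp
      qed
      then show ?thesis
        by blast
    qed
    have "\<exists>l. (\<lambda>n. w n s) \<longlonglongrightarrow> l" for s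
    proof -
      have "Cauchy (\<lambda>n. w n s)"
      proof (rule metric_CauchyI)
        fix e :: real assume e: "e > 0"
        obtain M where M: "\<And>m n. m \<ge> M \<Longrightarrow> n \<ge> M \<Longrightarrow> hnorm K (w m - w n) < e / (\<bar>C s\<bar> + 1)"
          using Cauchy_w[of "e / (\<bar>C s\<bar> + 1)"] e by (auto simp: add_nonneg_pos)
        have "dist (w m s) (w n s) < e" if "m \<ge> M" "n \<ge> M" for m n
        proof -
          have d: "w m - w n \<in> hcarrier K"
            by (intro diff_closed w)
          have "dist (w m s) (w n s) \<le> C s * hnorm K (w m - w n)"
            using norm_apply_le[OF d, of s] by (simp add: dist_norm)
          also have "\<dots> \<le> (\<bar>C s\<bar> + 1) * hnorm K (w m - w n)"
            by (intro mult_right_mono hnorm_nonneg d) auto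
          also have "\<dots> < e"
            using M[OF that] by (simp add: pos_less_divide_eq add_nonneg_pos mult.commute)
          finally show ?thesis .
        qed
        then show "\<exists>M. \<forall>m\<ge>M. \<forall>n\<ge>M. dist (w m s) (w n s) < e"
          by blast
      qed
      then show ?thesis
        using Cauchy_convergent convergent_def by blast
    qed
    then obtain f where f: "\<And>s. (\<lambda>n. w n s) \<longlonglongrightarrow> f s"
      by metis
    have approx_f: "approx f w"
      using w(1) Cauchy_w f by (auto simp: approx_def)
    then have f_cl: "f \<in> hcarrier completion"
      by auto
    have "(\<lambda>n. hdist completion (\<sigma> n) f) \<longlonglongrightarrow> 0"
    proof (rule Lim_null_comparison)
      have "norm (hdist completion (\<sigma> n) f) \<le> inverse (Suc n) + hdist completion f (w n)" for n
        using compl.triangle[OF \<sigma>_cl[of n] w_cl[of n] f_cl] w(2)[of n] compl.commute[of f "w n"]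
          compl.nonneg[of "\<sigma> n" f] by simp
      then show "\<forall>\<^sub>F n in sequentially. norm (hdist completion (\<sigma> n) f)
          \<le> inverse (real (Suc n)) + hdist completion f (w n)"
        by simp
      show "(\<lambda>n. inverse (real (Suc n)) + hdist completion f (w n)) \<longlonglongrightarrow> 0"
        using tendsto_add[OF LIMSEQ_inverse_real_of_nat completion_dense[OF approx_f]] by simp
    qed
    then have "limitin compl.mtopology \<sigma> f sequentially"
      unfolding compl.limitin_metric_dist_null using f_cl \<sigma>_cl by auto
    then show "\<exists>x. limitin compl.mtopology \<sigma> x sequentially"
      by blast
  qed
qed (rule compl.inner_product_space_axioms)

end

section \<open>The dilation of a positive definite function\<close>

context positive_definite
begin

text \<open>\<open>\<phi> g x\<close> is conjugate-linear in its second argument, so it is the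
  conjugate that Riesz represents.\<close>

definition operator_at :: "'g \<Rightarrow> 'a \<Rightarrow> 'a" where
  "operator_at g x = (THE u. \<forall>y. cnj (\<phi> g x y) = cinner y u)"

lemma operator_at: "cinner (operator_at g x) y = \<phi> g x y"
proof -
  have "\<exists>!u. \<forall>y. cnj (\<phi> g x y) = cinner y u"
  proof (rule riesz_representation[where K = "norm x"])
    have "cnj (\<phi> g x y) = \<phi> (- g) y x" for y
      using hermitian[of g x y] by simp
    then show "cnj (\<phi> g x (y + z)) = cnj (\<phi> g x y) + cnj (\<phi> g x z)"
      "cnj (\<phi> g x (c *\<^sub>C y)) = c * cnj (\<phi> g x y)" for y z c
      by (simp_all add: add_left scale_left)
    show "cmod (cnj (\<phi> g x y)) \<le> norm x * norm y" for y
      by (simp add: norm_bound)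
  qed
  from theI'[OF this] have "cnj (\<phi> g x y) = cinner y (operator_at g x)"
    unfolding operator_at_def by blast
  then show ?thesis
    using cinner_commute[of "operator_at g x" y] by (metis complex_cnj_cnj)
qed

lemma operator_at_linear:
  "operator_at g (x + y) = operator_at g x + operator_at g y"
  "operator_at g (c *\<^sub>C x) = c *\<^sub>C operator_at g x"
  by (rule cinner_eqI; simp add: operator_at cinner_add_left cinner_scaleC_left add_left
      scale_left)+

text \<open>The vector \<open>k\<close> that \<open>v\<close> stands for in a dilation, encoded as
  the function that compresses \<open>U s k\<close> to the original space for every
  \<open>s\<close>. In this picture \<open>U a\<close> is translation by \<open>a\<close>.\<close>

definition kernel_sum :: "('g \<times> 'a) list \<Rightarrow> 'g \<Rightarrow> 'a" where
  "kernel_sum v s = (\<Sum>(t, x)\<leftarrow>v. operator_at (s + t) x)"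

lemma kernel_sum_Nil [simp]: "kernel_sum [] = 0"
  by (simp add: kernel_sum_def fun_eq_iff)

lemma kernel_sum_append: "kernel_sum (v @ w) = kernel_sum v + kernel_sum w"
  by (simp add: kernel_sum_def fun_eq_iff)

lemma kernel_sum_scale: "kernel_sum (scale_list c v) = (\<lambda>s. c *\<^sub>C kernel_sum v s)"
proof
  show "kernel_sum (scale_list c v) s = c *\<^sub>C kernel_sum v s" for s
    by (induction v) (auto simp: kernel_sum_def scale_list_def operator_at_linear scaleC_add_right)
qed

text \<open>The reproducing property: evaluation at \<open>s\<close> is the inner product with
  \<open>U (- s) y\<close>.\<close>

lemma cinner_kernel_sum: "cinner (kernel_sum v s) y = gram v [(- s, y)]"
  by (induction v) (auto simp: kernel_sum_def gram_def cinner_add_left operator_at add.commute)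

lemma gram_kernel_sum: "gram v w = (\<Sum>(t, y)\<leftarrow>w. cinner (kernel_sum v (- t)) y)"
proof (induction w)
  case Nil
  show ?case
    using gram_hermitian[of v "[]"] by simp
next
  case (Cons p w)
  have "gram v ([p] @ w) = gram v [p] + gram v w"
    by (rule gram_append_right)
  then show ?case
    using Cons by (cases p) (simp add: cinner_kernel_sum)
qed

text \<open>Makes the inner product well defined on functions; passing from lists to functions thus
  divides out the null vectors of \<open>gram\<close>.\<close>

lemma gram_cong_left: "kernel_sum v = kernel_sum v' \<Longrightarrow> gram v w = gram v' w"
  by (simp add: gram_kernel_sum)

lemma gram_cong_right: "kernel_sum w = kernel_sum w' \<Longrightarrow> gram v w = gram v w'"
  using gram_cong_left gram_hermitian by metis

definition kernel_space :: "('g \<Rightarrow> 'a) hilbert" where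
  "kernel_space = \<lparr>hcarrier = range kernel_sum, hzero = 0, hadd = (+), hscale = (\<lambda>c f s. c *\<^sub>C f s),
    hinner = (\<lambda>f g. gram (SOME v. kernel_sum v = f) (SOME w. kernel_sum w = g))\<rparr>"

lemma kernel_space_simps [simp]:
  "hcarrier kernel_space = range kernel_sum" "hzero kernel_space = 0" "hadd kernel_space = (+)"
  "hscale kernel_space = (\<lambda>c f s. c *\<^sub>C f s)"
  by (simp_all add: kernel_space_def)

lemma kernel_space_inner [simp]: "hinner kernel_space (kernel_sum v) (kernel_sum w) = gram v w"
proof -
  have "kernel_sum (SOME v'. kernel_sum v' = kernel_sum v)
      = kernel_sum v" "kernel_sum (SOME w'. kernel_sum w' = kernel_sum w) = kernel_sum w"
    by (rule someI[where P = "\<lambda>v'. kernel_sum v' = kernel_sum v"], rule refl)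
      (rule someI[where P = "\<lambda>w'. kernel_sum w' = kernel_sum w"], rule refl)
  then have "gram (SOME v'. kernel_sum v' = kernel_sum v) (SOME w'. kernel_sum w' = kernel_sum w)
      = gram v w"
    using gram_cong_left gram_cong_right by metis
  then show ?thesis
    by (simp add: kernel_space_def)
qed

lemma kernel_space_hnorm: "hnorm kernel_space (kernel_sum v) = sqrt (Re (gram v v))"
  by (simp add: hnorm_def)

text \<open>Cauchy-Schwarz in the reproducing property, with the value at \<open>s\<close> itself as
  the test vector; one factor of its squared norm cancels.\<close>

lemma norm_kernel_sum_le: "norm (kernel_sum v s) \<le> hnorm kernel_space (kernel_sum v)"
proof (cases "kernel_sum v s = 0")
  case True
  then show ?thesis
    using gram_pos[of v] by (simp add: kernel_space_hnorm less_eq_complex_def)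
next
  case False
  have n: "(norm (kernel_sum v s))\<^sup>2 = cmod (gram v [(- s, kernel_sum v s)])"
    using cinner_kernel_sum[of v s "kernel_sum v s"] cinner_self[of "kernel_sum v s"]
        by (metis norm_of_real abs_power2)
  have "Re (gram [(- s, kernel_sum v s)] [(- s, kernel_sum v s)]) = (norm (kernel_sum v s))\<^sup>2"
    by (simp add: gram_def at_zero cinner_self)
  then have "((norm (kernel_sum v s))\<^sup>2)\<^sup>2 \<le> Re (gram v v) * (norm (kernel_sum v s))\<^sup>2"
    using gram_cauchy_schwarz[of v "[(- s, kernel_sum v s)]"] unfolding n[symmetric] by (simp only:)
  then have "(norm (kernel_sum v s))\<^sup>2 \<le> Re (gram v v)"
    using False by (simp add: power2_eq_square mult_le_cancel_right)
  then show ?thesis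
    by (simp add: kernel_space_hnorm real_le_rsqrt)
qed

sublocale kernel: pointwise_space kernel_space "\<lambda>_. 1"
proof
  fix f g h :: "'g \<Rightarrow> 'a" and c d :: complex and s :: 'g
  have kernel_sum_range: "kernel_sum v + kernel_sum w \<in> range kernel_sum" "(\<lambda>s. c *\<^sub>C kernel_sum v
      s) \<in> range kernel_sum" for v w c
    by (simp_all flip: kernel_sum_append kernel_sum_scale)
  show "hzero kernel_space \<in> hcarrier kernel_space"
    by (metis kernel_sum_Nil kernel_space_simps(1,2) rangeI)
  show "hzero kernel_space = 0" "hadd kernel_space = (+)"
    "hscale kernel_space = (\<lambda>c f s. c *\<^sub>C f s)"
    by simp_all
  assume "f \<in> hcarrier kernel_space"
  then obtain v where v: "f = kernel_sum v"
    by auto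
  show "hscale kernel_space c f \<in> hcarrier kernel_space"
    using kernel_sum_range(2) by (simp add: v)
  show "hadd kernel_space f (hzero kernel_space) = f"
    "hadd kernel_space f (hscale kernel_space (-1) f) = hzero kernel_space"
    "hscale kernel_space (c + d) f = hadd kernel_space (hscale kernel_space c f) (hscale
        kernel_space d f)"
    "hscale kernel_space c (hscale kernel_space d f) = hscale kernel_space (c * d) f"
    "hscale kernel_space 1 f = f"
    by (simp_all add: fun_eq_iff scaleC_minus_one scaleC_add_left scaleC_scaleC)
  show le: "norm (f s) \<le> 1 * hnorm kernel_space f" for s
    using norm_kernel_sum_le by (simp add: v)
  show "0 < hinner kernel_space f f" if "f \<noteq> hzero kernel_space"
  proof -
    have "gram v v \<noteq> 0"
    proof
      assume "gram v v = 0"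
      then have "norm (kernel_sum v s) \<le> 0" for s
        using norm_kernel_sum_le[of v s] by (simp add: kernel_space_hnorm)
      then show False
        using that by (simp add: v fun_eq_iff)
    qed
    then show ?thesis
      using gram_pos[of v] by (simp add: v less_le)
  qed
  assume "g \<in> hcarrier kernel_space"
  then obtain w where w: "g = kernel_sum w"
    by auto
  show "hadd kernel_space f g \<in> hcarrier kernel_space"
    using kernel_sum_range(1) by (simp add: v w)
  show "hadd kernel_space f g = hadd kernel_space g f"
    "hscale kernel_space c (hadd kernel_space f g)
      = hadd kernel_space (hscale kernel_space c f) (hscale kernel_space c g)"
    by (simp_all add: fun_eq_iff scaleC_add_right add.commute)
  show "hinner kernel_space f g = cnj (hinner kernel_space g f)"
    by (simp add: v w gram_hermitian[of v w])
  show "hinner kernel_space (hscale kernel_space c f) g = c * hinner kernel_space f g"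
    by (simp add: v w gram_scale_left flip: kernel_sum_scale)
  assume "h \<in> hcarrier kernel_space"
  then obtain z where z: "h = kernel_sum z"
    by auto
  show "hadd kernel_space (hadd kernel_space f g) h = hadd kernel_space f (hadd kernel_space g h)"
    by (simp add: add.assoc)
  show "hinner kernel_space (hadd kernel_space f g) h
      = hinner kernel_space f h + hinner kernel_space g h"
    by (simp add: v w z gram_append_left flip: kernel_sum_append)
next
  fix u :: "nat \<Rightarrow> 'g \<Rightarrow> 'a" and g
  assume u: "\<And>n. u n \<in> hcarrier kernel_space" "\<And>s. (\<lambda>n. u n s) \<longlonglongrightarrow> 0"
    and "g \<in> hcarrier kernel_space"
  then obtain w where w: "g = kernel_sum w"
    by auto
  have "\<exists>v. u n = kernel_sum v" for n
    using u(1)[of n] by auto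
  then obtain v where v: "\<And>n. u n = kernel_sum (v n)"
    by metis
  \<comment> \<open>The inner product with a fixed kernel sum is a finite combination of
    evaluations, so pointwise null sequences are weakly null.\<close>
  have "(\<lambda>n. \<Sum>(t, y)\<leftarrow>w. cinner (u n (- t)) y) \<longlonglongrightarrow> 0"
  proof (induction w)
    case (Cons p w)
    have "(\<lambda>n. cinner (u n (- fst p)) (snd p)) \<longlonglongrightarrow> cinner 0 (snd p)"
      by (rule tendsto_cinner_left[OF u(2)])
    from tendsto_add[OF this Cons.IH] show ?case
      by (simp add: case_prod_beta)
  qed simp
  then show "(\<lambda>n. hinner kernel_space (u n) g) \<longlonglongrightarrow> 0"
    by (simp add: v w gram_kernel_sum)
qed

section \<open>Translations as unitary operators\<close>

definition translate :: "'g \<Rightarrow> ('g \<Rightarrow> 'a) \<Rightarrow> 'g \<Rightarrow> 'a" where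
  "translate a f = (\<lambda>s. f (s + a))"

lemma translate_simps:
  "translate a (f + g) = translate a f + translate a g"
  "translate a (f - g) = translate a f - translate a g"
  "translate a (\<lambda>s. c *\<^sub>C f s) = (\<lambda>s. c *\<^sub>C translate a f s)"
  "translate a (translate b f) = translate (a + b) f" "translate 0 f = f"
  by (simp_all add: translate_def fun_eq_iff add.assoc)

definition shift :: "'g \<Rightarrow> ('g \<times> 'a) list \<Rightarrow> ('g \<times> 'a) list" where
  "shift a = map (\<lambda>(t, x). (t + a, x))"

lemma translate_kernel_sum: "translate a (kernel_sum v) = kernel_sum (shift a v)"
proof
  show "translate a (kernel_sum v) s = kernel_sum (shift a v) s" for s
    by (induction v) (auto simp: translate_def kernel_sum_def shift_def add_ac)
qed

lemma gram_shift: "gram (shift a v) (shift a w) = gram v w"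
proof -
  have "(\<Sum>(h, y)\<leftarrow>shift a w. \<phi> (g + a - h) x y) = (\<Sum>(h, y)\<leftarrow>w. \<phi> (g - h) x y)" for g x
    by (induction w) (auto simp: shift_def)
  then show ?thesis
    by (induction v) (auto simp: gram_def shift_def)
qed

lemma translate_kernel_space:
  assumes "f \<in> hcarrier kernel_space"
  shows "translate a f \<in> hcarrier kernel_space"
    and "g \<in> hcarrier kernel_space \<Longrightarrow>
      hinner kernel_space (translate a f) (translate a g) = hinner kernel_space f g"
    and "hnorm kernel_space (translate a f) = hnorm kernel_space f"
  using assms by (auto simp: translate_kernel_sum gram_shift hnorm_def)

text \<open>Translation is defined on all functions from the start, so its extension to the
  completion consists only in keeping Cauchy sequences Cauchy.\<close>

lemma approx_translate:
  assumes "kernel.approx f u"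
  shows "kernel.approx (translate a f) (\<lambda>n. translate a (u n))"
proof -
  have "hnorm kernel_space (translate a (u m) - translate a (u n))
      = hnorm kernel_space (u m - u n)" for m n
    using translate_kernel_space(3) kernel.diff_closed kernel.approxD(1)[OF assms]
    by (metis translate_simps(2))
  then show ?thesis
    using assms translate_kernel_space(1) by (auto simp: kernel.approx_def translate_def)
qed

lemma translate_completion:
  assumes "f \<in> hcarrier kernel.completion"
  shows "translate a f \<in> hcarrier kernel.completion"
  using assms approx_translate by auto

lemma translate_completion_inner:
  assumes "f \<in> hcarrier kernel.completion" "g \<in> hcarrier kernel.completion"
  shows "hinner kernel.completion (translate a f) (translate a g) = hinner kernel.completion f g"
proof -
  obtain u v where u: "kernel.approx f u" and v: "kernel.approx g v"
    using assms by auto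
  have "hinner kernel_space (translate a (u n)) (translate a (v n))
      = hinner kernel_space (u n) (v n)" for n
    by (intro translate_kernel_space(2) kernel.approxD(1)[OF u] kernel.approxD(1)[OF v])
  then have "(\<lambda>n. hinner kernel_space (u n) (v n))
      \<longlonglongrightarrow> kernel.completion_inner (translate a f) (translate a g)"
    using kernel.completion_inner_tendsto[OF approx_translate[OF u] approx_translate[OF v], of a a]
        by simp
  then show ?thesis
    using kernel.completion_inner_tendsto[OF u v] LIMSEQ_unique by simp
qed

lemma unitary_translate: "unitary_on kernel.completion (translate a)"
  unfolding unitary_on_def
proof (intro conjI ballI allI)
  show "bij_betw (translate a) (hcarrier kernel.completion) (hcarrier kernel.completion)"
    by (rule bij_betw_byWitness[where f' = "translate (- a)"])
      (auto simp: translate_simps intro: translate_completion)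
qed (simp add: translate_simps, simp add: translate_simps, rule translate_completion_inner)

lemma hdist_translate:
  assumes "f \<in> hcarrier kernel.completion" "g \<in> hcarrier kernel.completion"
  shows "hdist kernel.completion (translate a f) (translate a g) = hdist kernel.completion f g"
proof -
  have d: "f - g \<in> hcarrier kernel.completion"
    using assms unfolding kernel.completion_simps by (blast intro: kernel.approx_diff)
  have "hdist kernel.completion (translate a f) (translate a g)
      = hnorm kernel.completion (translate a (f - g))"
    using assms by (simp only: kernel.completion_hdist translate_completion translate_simps)
  also have "\<dots> = hnorm kernel.completion (f - g)"
    by (simp only: hnorm_def translate_completion_inner[OF d d])
  finally show ?thesis
    using assms by (simp only: kernel.completion_hdist)
qed

definition incl :: "'a \<Rightarrow> 'g \<Rightarrow> 'a" where
  "incl x = kernel_sum [(0, x)]"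

lemma isometry_incl: "isometry_into kernel.completion incl"
  unfolding isometry_into_def
proof (intro conjI allI)
  fix x y :: 'a and c :: complex
  have incl: "incl x \<in> hcarrier kernel_space" for x
    by (simp add: incl_def)
  show "incl x \<in> hcarrier kernel.completion"
    by (rule kernel.completion_carrier_mono[OF incl])
  show "incl (x + y) = hadd kernel.completion (incl x) (incl y)"
    "incl (c *\<^sub>C x) = hscale kernel.completion c (incl x)"
    by (simp_all add: incl_def kernel_sum_def operator_at_linear fun_eq_iff)
  show "hnorm kernel.completion (incl x) = norm x"
    unfolding kernel.completion_hnorm_eq[OF incl]
    by (simp add: incl_def kernel_space_hnorm gram_def at_zero norm_eq_sqrt_cinner)
qed

lemma adjoint_from_incl:
  "adjoint_from kernel.completion incl (translate t (incl x)) = operator_at t x"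
proof -
  have *: "hinner kernel.completion (incl y) (translate t (incl x))
      = cinner y (operator_at t x)" for y
  proof -
    have "hinner kernel.completion (incl y) (translate t (incl x)) = gram [(0, y)] [(t, x)]"
      by (simp add: kernel.completion_inner_eq incl_def translate_kernel_sum shift_def)
    also have "\<dots> = cnj (\<phi> t x y)"
      using hermitian[of t x y] by (simp add: gram_def)
    also have "\<dots> = cinner y (operator_at t x)"
      using operator_at[of t x y] cinner_commute[of y "operator_at t x"] by simp
    finally show ?thesis .
  qed
  show ?thesis
    unfolding adjoint_from_def
  proof (rule the_equality)
    show "\<forall>y. hinner kernel.completion (incl y) (translate t (incl x)) = cinner y (operator_at t x)"
      using * by blast
    show "h = operator_at t x"
      if "\<forall>y. hinner kernel.completion (incl y) (translate t (incl x)) = cinner y h" for h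
      using that * by (intro cinner_eqI2) simp
  qed
qed

text \<open>For a single pair \<open>(t, x)\<close> the squared displacement is twice
  \<open>(norm x)\<^sup>2 - Re (\<phi> a x x)\<close>, with \<open>t\<close> cancelling because the
  group is abelian. The triangle inequality handles lists.\<close>

lemma translate_kernel_sum_diff_tendsto:
  assumes lim: "\<And>x. ((\<lambda>a. Re (\<phi> a x x)) \<longlongrightarrow> (norm x)\<^sup>2) F"
  shows "((\<lambda>a. hnorm kernel_space (translate a (kernel_sum v) - kernel_sum v)) \<longlongrightarrow> 0) F"
proof (induction v)
  case Nil
  have "translate a (kernel_sum []) - kernel_sum [] = kernel_sum []" for a
    by (simp add: translate_def fun_eq_iff)
  then have "hnorm kernel_space (translate a (kernel_sum []) - kernel_sum []) = 0" for a
    by (simp only: kernel_space_hnorm gram_Nil) simp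
  then show ?case
    by (simp only: tendsto_const)
next
  case (Cons p v)
  obtain t x where p: "p = (t, x)"
    by fastforce
  have diff: "translate a (kernel_sum [p]) - kernel_sum [p]
      = kernel_sum [(t + a, x), (t, - x)]" for a
    using operator_at_linear(2)[of _ "-1" x]
    by (simp add: p translate_kernel_sum shift_def kernel_sum_def fun_eq_iff scaleC_minus_one)
  have "hnorm kernel_space (translate a (kernel_sum [p]) - kernel_sum [p])
      = sqrt (2 * ((norm x)\<^sup>2 - Re (\<phi> a x x)))" for a
    unfolding diff kernel_space_hnorm using Re_uminus[of a x]
    by (simp add: gram_def minus_left minus_right at_zero cinner_self flip: of_real_power)
  moreover have "((\<lambda>a. sqrt (2 * ((norm x)\<^sup>2 - Re (\<phi> a x x))))
      \<longlongrightarrow> sqrt (2 * ((norm x)\<^sup>2 - (norm x)\<^sup>2))) F"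
    by (intro tendsto_intros lim)
  ultimately have 1: "((\<lambda>a. hnorm kernel_space (translate a (kernel_sum [p]) - kernel_sum [p]))
      \<longlongrightarrow> 0) F"
    by simp
  have carrier: "translate a (kernel_sum w) - kernel_sum w \<in> hcarrier kernel_space" for a w
    by (intro kernel.diff_closed translate_kernel_space) simp_all
  show ?case
  proof (rule tendsto_sandwich[OF _ _ tendsto_const])
    show "((\<lambda>a. hnorm kernel_space (translate a (kernel_sum [p]) - kernel_sum [p])
        + hnorm kernel_space (translate a (kernel_sum v) - kernel_sum v)) \<longlongrightarrow> 0) F"
      using tendsto_add[OF 1 Cons.IH] by (simp only: add_0_left)
    show "\<forall>\<^sub>F a in F. 0 \<le> hnorm kernel_space (translate a (kernel_sum (p # v))
        - kernel_sum (p # v))"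
      by (intro always_eventually allI kernel.hnorm_nonneg carrier)
    have "translate a (kernel_sum (p # v)) - kernel_sum (p # v)
        = (translate a (kernel_sum [p]) - kernel_sum [p])
        + (translate a (kernel_sum v) - kernel_sum v)" for a
      using kernel_sum_append[of "[p]" v] by (simp add: translate_simps)
    then show "\<forall>\<^sub>F a in F. hnorm kernel_space (translate a (kernel_sum (p # v))
        - kernel_sum (p # v))
        \<le> hnorm kernel_space (translate a (kernel_sum [p]) - kernel_sum [p])
            + hnorm kernel_space (translate a (kernel_sum v) - kernel_sum v)"
      using kernel.hnorm_sum_le[OF carrier carrier] by (intro always_eventually allI) (simp only:)
  qed
qed

text \<open>Translations are isometric, so an approximation of \<open>f\<close> by a kernel sum is
  equally good after every translation.\<close>

lemma translate_diff_small:
  assumes lim: "\<And>x. ((\<lambda>a. Re (\<phi> a x x)) \<longlongrightarrow> (norm x)\<^sup>2) F"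
    and f: "f \<in> hcarrier kernel.completion" and e: "0 < e"
  shows "\<forall>\<^sub>F a in F. hdist kernel.completion (translate a f) f < e"
proof -
  obtain u where u: "kernel.approx f u"
    using f by auto
  have "\<forall>\<^sub>F m in sequentially. hdist kernel.completion f (u m) < e / 3"
    using kernel.completion_dense[OF u] by (rule order_tendstoD) (use e in simp)
  then obtain m where m: "hdist kernel.completion f (u m) < e / 3"
    using eventually_happens' sequentially_bot by blast
  have um: "u m \<in> hcarrier kernel_space"
    by (rule kernel.approxD(1)[OF u])
  then obtain v where v: "u m = kernel_sum v"
    by auto
  note um' = kernel.completion_carrier_mono[OF um]
  have "\<forall>\<^sub>F a in F. hnorm kernel_space (translate a (u m) - u m) < e / 3"
    unfolding v using translate_kernel_sum_diff_tendsto[OF lim]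
        by (rule order_tendstoD) (use e in simp)
  then show ?thesis
  proof eventually_elim
    case (elim a)
    have "hdist kernel.completion (translate a (u m)) (u m)
        = hnorm kernel_space (translate a (u m) - u m)"
      using kernel.completion_hdist[OF translate_completion[OF um', of a] um']
        kernel.completion_hnorm_eq[OF kernel.diff_closed[OF translate_kernel_space(1)[OF um, of a]
            um]] by simp
    moreover have "hdist kernel.completion (translate a f) f
      \<le> hdist kernel.completion (translate a f) (translate a (u m))
          + (hdist kernel.completion (translate a (u m)) (u m) + hdist kernel.completion (u m) f)"
      using kernel.compl.triangle[OF translate_completion[OF f, of a] translate_completion[OF um',
          of a] f]
        kernel.compl.triangle[OF translate_completion[OF um', of a] um' f] by linarith
    ultimately show ?case
      using elim m hdist_translate[OF f um', of a] kernel.compl.commute[of "u m" f] by simp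
  qed
qed

end

theorem dilation_of_positive_definite:
  fixes \<phi> :: "real \<times> real \<Rightarrow> 'a::complex_hilbert_space \<Rightarrow> 'a \<Rightarrow> complex"
  assumes "positive_definite \<phi>" and lim: "\<And>x. ((\<lambda>a. Re (\<phi> a x x)) \<longlongrightarrow> (norm x)\<^sup>2) (nhds 0)"
    and T: "\<And>t1 t2 x y. 0 \<le> t1 \<Longrightarrow> 0 \<le> t2 \<Longrightarrow> \<phi> (t1, t2) x y = cinner (T (t1, t2) x) y"
  shows "admits_commutative_unitary_dilation T"
proof -
  interpret positive_definite \<phi> by fact
  have "continuous_map euclidean (htopology kernel.completion) (\<lambda>t. translate t f)"
    if f: "f \<in> hcarrier kernel.completion" for f
    unfolding kernel.compl.continuous_map_to_metric
  proof (intro ballI allI impI)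
    fix t :: "real \<times> real" and e :: real assume e: "0 < e"
    obtain S where S: "open S" "0 \<in> S" "\<And>a. a \<in> S \<Longrightarrow> hdist kernel.completion (translate a f) f < e"
      using translate_diff_small[OF lim f e] unfolding eventually_nhds by blast
    define U where "U = (\<lambda>s. s - t) -` S"
    have "open U"
      unfolding U_def by (intro open_vimage S continuous_intros)
    moreover have "t \<in> U"
      using S(2) by (simp add: U_def)
    moreover have "translate s f \<in> kernel.compl.mball (translate t f) e" if "s \<in> U" for s
    proof -
      \<comment> \<open>Continuity at \<open>t\<close> is continuity at zero, moved by the isometry
        \<open>translate t\<close>.\<close>
      have "translate s f = translate t (translate (s - t) f)"
        by (simp add: translate_simps)
      then have "hdist kernel.completion (translate t f) (translate s f)
          = hdist kernel.completion f (translate (s - t) f)"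
        using hdist_translate[OF f translate_completion[OF f]] by simp
      also have "\<dots> < e"
        using S(3)[of "s - t"] that kernel.compl.commute by (simp add: U_def)
      finally show ?thesis
        using translate_completion[OF f] by (simp only: kernel.compl.in_mball simp_thms)
    qed
    ultimately have U: "openin euclidean U \<and> t \<in> U \<and> (\<forall>s\<in>U. translate s f \<in> kernel.compl.mball
        (translate t f) e)"
      using open_openin[of U] by blast
    show "\<exists>U. openin euclidean U \<and> t \<in> U \<and> (\<forall>s\<in>U. translate s f \<in> kernel.compl.mball (translate t f)
        e)"
      using U by (rule exI)
  qed
  then have "unitary_representation kernel.completion translate"
    by (simp add: unitary_representation_def unitary_translate translate_simps)
  moreover have "adjoint_from kernel.completion incl (translate (t1, t2) (incl x)) = T (t1, t2) x"
    if "0 \<le> t1" "0 \<le> t2" for t1 t2 x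
    unfolding adjoint_from_incl by (rule cinner_eqI) (simp add: operator_at T that)
  ultimately have "commutative_unitary_dilation T kernel.completion incl translate"
    unfolding commutative_unitary_dilation_def
    using kernel.hilbert_space_completion isometry_incl by blast
  then show ?thesis
    unfolding admits_commutative_unitary_dilation_def by blast
qed

section \<open>The scaling limit\<close>

text \<open>Tychonoff for a product of closed balls. The index set may be uncountable, so a proper
  filter finer than \<open>sequentially\<close> takes the place of a subsequence.\<close>

lemma bounded_functions_cluster:
  fixes F :: "nat \<Rightarrow> 'i \<Rightarrow> complex"
  assumes bound: "\<And>n i. cmod (F n i) \<le> B i"
  obtains G \<phi> where "G \<noteq> bot" "G \<le> sequentially" "\<And>i. ((\<lambda>n. F n i) \<longlongrightarrow> \<phi> i) G"
proof -
  define S where "S = PiE UNIV (\<lambda>i. cball (0::complex) (B i))"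
  have "compactin (product_topology (\<lambda>i. euclidean) UNIV) S"
    unfolding S_def compactin_PiE by simp
  then have "compact S"
    by (simp add: euclidean_product_topology)
  moreover have "eventually (\<lambda>f. f \<in> S) (filtermap F sequentially)"
    using bound by (simp add: S_def eventually_filtermap PiE_UNIV_domain)
  ultimately obtain \<phi> where \<phi>: "inf (nhds \<phi>) (filtermap F sequentially) \<noteq> bot"
    unfolding compact_filter by (metis filtermap_bot_iff sequentially_bot)
  \<comment> \<open>Eventually large indices at which \<open>F n\<close> is close to
    \<open>\<phi>\<close>; that \<open>\<phi>\<close> is a cluster point says that this filter is
    proper.\<close>
  define G where "G = inf sequentially (filtercomap F (nhds \<phi>))"
  have "G \<noteq> bot"
  proof
    assume "G = bot"
    then obtain P Q where P: "eventually P sequentially" and Q: "eventually Q (nhds \<phi>)"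
      and PQ: "\<And>n. P n \<Longrightarrow> \<not> Q (F n)"
      unfolding G_def eventually_False[symmetric] eventually_inf eventually_filtercomap by metis
    have "eventually (\<lambda>f. \<not> Q f) (filtermap F sequentially)"
      unfolding eventually_filtermap by (rule eventually_mono[OF P PQ])
    then have "eventually (\<lambda>_. False) (inf (nhds \<phi>) (filtermap F sequentially))"
      using Q unfolding eventually_inf by blast
    then show False
      using \<phi> by (simp add: eventually_False)
  qed
  moreover have "G \<le> sequentially"
    by (simp add: G_def)
  moreover have "((\<lambda>n. F n i) \<longlongrightarrow> \<phi> i) G" for i
  proof -
    have "(F \<longlongrightarrow> \<phi>) G"
      unfolding G_def filterlim_def by (metis filtermap_filtercomap filtermap_mono inf.cobounded2
          order_trans)
    moreover have "open ((\<lambda>f. f i) -` U)" if "open U" for U :: "complex set"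
      by (intro open_vimage that continuous_on_product_coordinates)
    ultimately have "eventually (\<lambda>n. F n \<in> (\<lambda>f. f i) -` U) G" if "open U" "\<phi> i \<in> U" for U
      using topological_tendstoD that by (metis vimageI)
    then show ?thesis
      by (intro topological_tendstoI) simp
  qed
  ultimately show ?thesis
    using that by blast
qed

lemma floor_diff_cases:
  fixes a b :: real
  obtains c where "c \<in> {0, 1}" "\<lfloor>a\<rfloor> - \<lfloor>b\<rfloor> = \<lfloor>a - b\<rfloor> + c"
proof
  show "\<lfloor>a\<rfloor> - \<lfloor>b\<rfloor> - \<lfloor>a - b\<rfloor> \<in> {0, 1}"
    by (simp; linarith)
qed simp

text \<open>The integers \<open>\<lfloor>n s\<rfloor> - \<lfloor>n t\<rfloor>\<close> and \<open>\<lfloor>n (s - t)\<rfloor>\<close> differ by at most one, and a unit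
  shift of the argument of \<open>\<psi> n\<close> becomes negligible by the hypotheses \<open>small\<close>. Hence any cluster
  point is positive definite.\<close>

theorem positive_definite_scaling_limit:
  fixes \<psi> :: "nat \<Rightarrow> int \<times> int \<Rightarrow> 'a::complex_hilbert_space \<Rightarrow> 'a \<Rightarrow> complex"
  assumes pd: "\<And>n. positive_definite (\<psi> n)"
    and small: "\<And>x. (\<lambda>n. Re (\<psi> n (1, 0) x x)) \<longlonglongrightarrow> (norm x)\<^sup>2"
      "\<And>x. (\<lambda>n. Re (\<psi> n (0, 1) x x)) \<longlonglongrightarrow> (norm x)\<^sup>2"
  obtains \<phi> :: "real \<times> real \<Rightarrow> 'a \<Rightarrow> 'a \<Rightarrow> complex"
  where "positive_definite \<phi>"
    "\<And>s t x y l. (\<lambda>n. \<psi> n (\<lfloor>real n * s\<rfloor>, \<lfloor>real n * t\<rfloor>) x y) \<longlonglongrightarrow> l \<Longrightarrow> \<phi> (s, t) x y = l"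
proof -
  define fl :: "nat \<Rightarrow> real \<times> real \<Rightarrow> int \<times> int" where
    "fl n t = (\<lfloor>real n * fst t\<rfloor>, \<lfloor>real n * snd t\<rfloor>)" for n t
  have "cmod (case i of (t, x, y) \<Rightarrow> \<psi> n (fl n t) x y)
      \<le> (case i of (t, x, y) \<Rightarrow> norm x * norm y)" for n i
    using positive_definite.norm_bound[OF pd] by (simp split: prod.split)
  from bounded_functions_cluster[of "\<lambda>n (t, x, y). \<psi> n (fl n t) x y", OF this]
  obtain G \<phi>0 where G: "G \<noteq> bot" "G \<le> sequentially"
    and \<phi>0: "\<And>i. ((\<lambda>n. case i of (t, x, y) \<Rightarrow> \<psi> n (fl n t) x y) \<longlongrightarrow> \<phi>0 i) G"
    by blast
  define \<phi> where "\<phi> t x y = \<phi>0 (t, x, y)" for t x y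
  have \<phi>: "((\<lambda>n. \<psi> n (fl n t) x y) \<longlongrightarrow> \<phi> t x y) G" for t x y
    using \<phi>0[of "(t, x, y)"] by (simp add: \<phi>_def)
  \<comment> \<open>The roots from \<open>shift_bound\<close> for a unit move in either coordinate;
    their sum covers a move in both.\<close>
  define \<delta> where "\<delta> x n = sqrt (2 * ((norm x)\<^sup>2 - Re (\<psi> n (1, 0) x x)))
      + sqrt (2 * ((norm x)\<^sup>2 - Re (\<psi> n (0, 1) x x)))"
    for x n
  have "(\<lambda>n. \<delta> x n) \<longlonglongrightarrow> sqrt (2 * ((norm x)\<^sup>2 - (norm x)\<^sup>2)) + sqrt (2 * ((norm x)\<^sup>2 - (norm x)\<^sup>2))"
      for x
    unfolding \<delta>_def by (intro tendsto_intros small)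
  then have \<delta>: "(\<lambda>n. \<delta> x n) \<longlonglongrightarrow> 0" for x
    by simp
  have step: "cmod (\<psi> n (m + (c, d)) x y - \<psi> n m x y) \<le> \<delta> x n * norm y"
    if "c \<in> {0, 1}" "d \<in> {0, 1}" for n m c d x y
  proof -
    interpret positive_definite "\<psi> n" by (rule pd)
    have one: "cmod (\<psi> n (m + e) x y - \<psi> n m x y)
        \<le> sqrt (2 * ((norm x)\<^sup>2 - Re (\<psi> n e x x))) * norm y" for m e
    proof -
      have "cmod (\<psi> n (m + e) x y - \<psi> n m x y)
          \<le> sqrt (2 * ((norm x)\<^sup>2 - Re (\<psi> n e x x)) * (norm y)\<^sup>2)"
        using shift_bound[of "m + e" x y m] by (intro real_le_rsqrt) simp
      then show ?thesis
        by (simp only: real_sqrt_mult real_sqrt_abs abs_norm_cancel)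
    qed
    have nonneg: "0 \<le> sqrt (2 * ((norm x)\<^sup>2 - Re (\<psi> n e x x))) * norm y" for e
      by (rule order_trans[OF norm_ge_zero one])
    have c: "cmod (\<psi> n (m + (c, 0)) x y - \<psi> n m x y)
        \<le> sqrt (2 * ((norm x)\<^sup>2 - Re (\<psi> n (1, 0) x x))) * norm y" for m
      using that(1) one[of m "(1, 0)"] nonneg[of "(1, 0)"] by (auto simp: zero_prod_def[symmetric])
    have d: "cmod (\<psi> n (m + (0, d)) x y - \<psi> n m x y)
        \<le> sqrt (2 * ((norm x)\<^sup>2 - Re (\<psi> n (0, 1) x x))) * norm y" for m
      using that(2) one[of m "(0, 1)"] nonneg[of "(0, 1)"] by (auto simp: zero_prod_def[symmetric])
    have eq: "m + (c, d) = m + (0, d) + (c, 0)"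
      by (simp add: prod_eq_iff)
    have "cmod (\<psi> n (m + (c, d)) x y - \<psi> n m x y)
        \<le> cmod (\<psi> n (m + (0, d) + (c, 0)) x y - \<psi> n (m + (0, d)) x y) + cmod (\<psi> n (m
            + (0, d)) x y - \<psi> n m x y)"
      using norm_triangle_ineq[of "\<psi> n (m + (0, d) + (c, 0)) x y - \<psi> n (m + (0, d)) x y"
          "\<psi> n (m + (0, d)) x y - \<psi> n m x y"] unfolding eq by simp
    also have "\<dots> \<le> sqrt (2 * ((norm x)\<^sup>2 - Re (\<psi> n (1, 0) x x))) * norm y
        + sqrt (2 * ((norm x)\<^sup>2 - Re (\<psi> n (0, 1) x x))) * norm y"
      by (intro add_mono c d)
    finally show ?thesis
      by (simp add: \<delta>_def distrib_right)
  qed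
  have diff: "((\<lambda>n. \<psi> n (fl n s - fl n t) x y) \<longlongrightarrow> \<phi> (s - t) x y) G" for s t x y
  proof -
    have le: "cmod (\<psi> n (fl n s - fl n t) x y - \<psi> n (fl n (s - t)) x y) \<le> \<delta> x n * norm y" for n
    proof -
      obtain c where c: "c \<in> {0, 1}" "\<lfloor>real n * fst s\<rfloor> - \<lfloor>real n * fst t\<rfloor>
          = \<lfloor>real n * fst s - n * fst t\<rfloor> + c"
        by (rule floor_diff_cases)
      obtain d where d: "d \<in> {0, 1}" "\<lfloor>real n * snd s\<rfloor> - \<lfloor>real n * snd t\<rfloor>
          = \<lfloor>real n * snd s - n * snd t\<rfloor> + d"
        by (rule floor_diff_cases)
      have "fl n s - fl n t = fl n (s - t) + (c, d)"
        using c d by (simp add: fl_def right_diff_distrib)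
      then show ?thesis
        using step[OF c(1) d(1)] by simp
    qed
    have \<delta>y: "(\<lambda>n. \<delta> x n * norm y) \<longlonglongrightarrow> 0"
      using tendsto_mult_left_zero[OF \<delta>] .
    have "\<forall>\<^sub>F n in sequentially. cmod (\<psi> n (fl n s - fl n t) x y - \<psi> n (fl n (s - t)) x y)
        \<le> \<delta> x n * norm y"
      by (rule always_eventually) (rule allI, rule le)
    then have "(\<lambda>n. \<psi> n (fl n s - fl n t) x y - \<psi> n (fl n (s - t)) x y) \<longlonglongrightarrow> 0"
      using \<delta>y by (rule Lim_null_comparison)
    then have "((\<lambda>n. \<psi> n (fl n s - fl n t) x y - \<psi> n (fl n (s - t)) x y) \<longlongrightarrow> 0) G"
      by (rule tendsto_mono[OF G(2)])
    then show ?thesis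
      by (rule Lim_transform[OF \<phi>])
  qed
  have fl_zero: "fl n 0 = 0" for n
    by (simp add: fl_def zero_prod_def)
  show ?thesis
  proof
    show "\<phi> (s, t) x y = l" if "(\<lambda>n. \<psi> n (\<lfloor>real n * s\<rfloor>, \<lfloor>real n * t\<rfloor>) x y) \<longlonglongrightarrow> l" for s t x y l
      using tendsto_unique[OF G(1) \<phi> tendsto_mono[OF G(2)], of "(s, t)" x y l] that
          by (simp add: fl_def)
    show "positive_definite \<phi>"
    proof
      fix t :: "real \<times> real" and x y z :: 'a and c :: complex and v :: "((real \<times> real) \<times> 'a) list"
      have "((\<lambda>n. \<psi> n (fl n t) (x + y) z) \<longlongrightarrow> \<phi> t x z + \<phi> t y z) G"
        unfolding positive_definite.add_left[OF pd] by (intro tendsto_add \<phi>)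
      then show "\<phi> t (x + y) z = \<phi> t x z + \<phi> t y z"
        by (rule tendsto_unique[OF G(1) \<phi>])
      have "((\<lambda>n. \<psi> n (fl n t) (c *\<^sub>C x) z) \<longlongrightarrow> c * \<phi> t x z) G"
        unfolding positive_definite.scale_left[OF pd] by (intro tendsto_mult_left \<phi>)
      then show "\<phi> t (c *\<^sub>C x) z = c * \<phi> t x z"
        by (rule tendsto_unique[OF G(1) \<phi>])
      \<comment> \<open>\<open>- fl n t\<close> need not be \<open>fl n (- t)\<close>, so the limit
        is taken through \<open>diff\<close> with first argument zero.\<close>
      have "cnj (\<psi> n (fl n 0 - fl n t) y x) = \<psi> n (fl n t) x y" for n
        using positive_definite.hermitian[OF pd, of n "fl n t" x y] by (simp only: fl_zero diff_0)
      then have "((\<lambda>n. \<psi> n (fl n t) x y) \<longlongrightarrow> cnj (\<phi> (0 - t) y x)) G"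
        using tendsto_cnj[OF diff[of 0 t y x]] by (simp only:)
      then show "\<phi> t x y = cnj (\<phi> (- t) y x)"
        using tendsto_unique[OF G(1) \<phi>] by simp
      have "\<psi> n (fl n 0) x y = cinner x y" for n
        by (simp add: fl_zero positive_definite.at_zero[OF pd])
      then have "((\<lambda>n. \<psi> n (fl n 0) x y) \<longlongrightarrow> cinner x y) G"
        by simp
      then show "\<phi> 0 x y = cinner x y"
        using tendsto_unique[OF G(1) \<phi>] by blast
      have inner: "((\<lambda>n. \<Sum>(t, y)\<leftarrow>w. \<psi> n (fl n s - fl n t) x y)
          \<longlongrightarrow> (\<Sum>(t, y)\<leftarrow>w. \<phi> (s - t) x y)) G" for s x w
        by (induction w) (auto intro!: tendsto_add diff)
      have "((\<lambda>n. \<Sum>(s, x)\<leftarrow>v. \<Sum>(t, y)\<leftarrow>w. \<psi> n (fl n s - fl n t) x y)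
          \<longlongrightarrow> (\<Sum>(s, x)\<leftarrow>v. \<Sum>(t, y)\<leftarrow>w. \<phi> (s - t) x y)) G" for w
        by (induction v) (auto intro!: tendsto_add inner)
      then have lim: "((\<lambda>n. Re (\<Sum>(s, x)\<leftarrow>v. \<Sum>(t, y)\<leftarrow>v. \<psi> n (fl n s - fl n t) x y))
          \<longlongrightarrow> Re (\<Sum>(s, x)\<leftarrow>v. \<Sum>(t, y)\<leftarrow>v. \<phi> (s - t) x y)) G"
        by (intro tendsto_Re)
      \<comment> \<open>Different points may be rounded to the same integers; positivity for lists
        allows such repetitions.\<close>
      have nonneg: "0 \<le> Re (\<Sum>(s, x)\<leftarrow>v. \<Sum>(t, y)\<leftarrow>v. \<psi> n (fl n s - fl n t) x y)" for n
      proof -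
        have "(\<Sum>(s, x)\<leftarrow>map (\<lambda>(s, x). (fl n s, x)) v. \<Sum>(t, y)\<leftarrow>map (\<lambda>(s, x). (fl n s, x)) v. \<psi> n (s
            - t) x y)
          = (\<Sum>(s, x)\<leftarrow>v. \<Sum>(t, y)\<leftarrow>v. \<psi> n (fl n s - fl n t) x y)"
          by (simp add: comp_def split_def)
        then show ?thesis
          using positive_definite.pos[OF pd] by metis
      qed
      show "0 \<le> Re (\<Sum>(s, x)\<leftarrow>v. \<Sum>(t, y)\<leftarrow>v. \<phi> (s - t) x y)"
        by (rule tendsto_lowerbound[OF lim always_eventually G(1)]) (rule allI, rule nonneg)
    qed
  qed
qed

lemma nat_floor_over_tendsto:
  assumes "0 \<le> t"
  shows "(\<lambda>n. real (nat \<lfloor>real n * t\<rfloor>) / n) \<longlonglongrightarrow> t"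
proof -
  have "norm (real (nat \<lfloor>real n * t\<rfloor>) / n - t) \<le> inverse (real n)" if "n \<ge> 1" for n
  proof -
    have "real (nat \<lfloor>real n * t\<rfloor>) = of_int \<lfloor>real n * t\<rfloor>"
      using assms by simp
    then have "\<bar>real (nat \<lfloor>real n * t\<rfloor>) - n * t\<bar> \<le> 1"
      by linarith
    moreover have "real (nat \<lfloor>real n * t\<rfloor>) / n - t = (real (nat \<lfloor>real n * t\<rfloor>) - n * t) / n"
      using that by (simp add: field_simps)
    ultimately show ?thesis
      using that by (simp add: divide_inverse abs_mult mult_left_le_one_le)
  qed
  then have "\<forall>\<^sub>F n in sequentially. norm (real (nat \<lfloor>real n * t\<rfloor>) / n - t) \<le> inverse (real n)"
    by (rule eventually_sequentiallyI)
  then have "(\<lambda>n. real (nat \<lfloor>real n * t\<rfloor>) / n - t) \<longlonglongrightarrow> 0"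
    using lim_inverse_n by (rule Lim_null_comparison)
  then show ?thesis
    by (rule LIM_zero_cancel)
qed

lemma op_exp_scaleR_continuous:
  fixes B :: "'a::complex_hilbert_space \<Rightarrow> 'a"
  assumes "bounded_linear B"
  shows "isCont (\<lambda>r. op_exp (\<lambda>x. r *\<^sub>R B x) x) t" "op_exp (\<lambda>x. 0) x = x"
proof -
  obtain C where C: "blinfun_apply C = B"
    using assms bounded_linear_Blinfun_apply by metis
  have eq: "op_exp (\<lambda>x. r *\<^sub>R B x) x = corner (exp (r *\<^sub>R extend_operator C)) x" for r
    unfolding extend_operator_scaleR[symmetric] corner_exp_extend
    by (rule arg_cong[of _ _ "\<lambda>B. op_exp B x"]) (simp add: fun_eq_iff blinfun.bilinear_simps C)
  have "isCont (\<lambda>r. exp (r *\<^sub>R extend_operator C)) t"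
    using exp_scaleR_has_vector_derivative_right[of "extend_operator C" t UNIV]
    by (rule has_vector_derivative_continuous)
  then show "isCont (\<lambda>r. op_exp (\<lambda>x. r *\<^sub>R B x) x) t"
    unfolding eq by (rule bounded_linear.isCont[OF bounded_linear_corner])
  show "op_exp (\<lambda>x. 0) x = x"
    using eq[of 0] by (simp add: corner_one)
qed

text \<open>Values are known on the closed quadrant only. Hermitian symmetry reaches the negative
  half axes, and any other point, including those with coordinates of opposite sign, is reached by
  two moves parallel to the axes, each controlled by \<open>shift_bound\<close>.\<close>

lemma positive_definite_continuous:
  fixes \<phi> :: "real \<times> real \<Rightarrow> 'a::complex_hilbert_space \<Rightarrow> 'a \<Rightarrow> complex"
  assumes "positive_definite \<phi>"
    and 1: "((\<lambda>r. Re (\<phi> (\<bar>r\<bar>, 0) x x)) \<longlongrightarrow> (norm x)\<^sup>2) (nhds 0)"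
    and 2: "((\<lambda>r. Re (\<phi> (0, \<bar>r\<bar>) x x)) \<longlongrightarrow> (norm x)\<^sup>2) (nhds 0)"
  shows "((\<lambda>a. Re (\<phi> a x x)) \<longlongrightarrow> (norm x)\<^sup>2) (nhds 0)"
proof -
  interpret positive_definite \<phi> by fact
  define h where "h a = sqrt (2 * ((norm x)\<^sup>2 - Re (\<phi> (\<bar>fst a\<bar>, 0) x x)) * (norm x)\<^sup>2)
    + sqrt (2 * ((norm x)\<^sup>2 - Re (\<phi> (0, \<bar>snd a\<bar>) x x)) * (norm x)\<^sup>2)" for a :: "real \<times> real"
  have abs: "Re (\<phi> (\<bar>r\<bar>, 0) x x) = Re (\<phi> (r, 0) x x)" "Re (\<phi> (0, \<bar>r\<bar>) x x)
      = Re (\<phi> (0, r) x x)" for r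
    using Re_uminus[of "(r, 0)" x] Re_uminus[of "(0, r)" x] by (simp_all add: abs_if)
  have le: "norm (Re (\<phi> a x x) - (norm x)\<^sup>2) \<le> h a" for a
  proof -
    obtain r s where a: "a = (r, s)"
      by fastforce
    have "cmod (\<phi> (r, 0) x x - \<phi> 0 x x) \<le> sqrt (2 * ((norm x)\<^sup>2 - Re (\<phi> (r, 0) x x)) * (norm x)\<^sup>2)"
      using shift_bound[of "(r, 0)" x x 0] by (intro real_le_rsqrt) simp
    moreover have "cmod (\<phi> (r, s) x x - \<phi> (r, 0) x x)
        \<le> sqrt (2 * ((norm x)\<^sup>2 - Re (\<phi> (0, s) x x)) * (norm x)\<^sup>2)"
      using shift_bound[of "(r, s)" x x "(r, 0)"] by (intro real_le_rsqrt) simp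
    moreover have "cmod (\<phi> (r, s) x x - \<phi> 0 x x)
        \<le> cmod (\<phi> (r, s) x x - \<phi> (r, 0) x x) + cmod (\<phi> (r, 0) x x - \<phi> 0 x x)"
      using norm_triangle_ineq[of "\<phi> (r, s) x x - \<phi> (r, 0) x x" "\<phi> (r, 0) x x - \<phi> 0 x x"] by simp
    moreover have "\<bar>Re (\<phi> a x x) - (norm x)\<^sup>2\<bar> \<le> cmod (\<phi> (r, s) x x - \<phi> 0 x x)"
      using abs_Re_le_cmod[of "\<phi> (r, s) x x - \<phi> 0 x x"]
          by (simp add: a at_zero cinner_self flip: of_real_power)
    ultimately show ?thesis
      by (simp add: h_def a abs)
  qed
  have h: "(h \<longlongrightarrow> 0) (nhds 0)"
  proof -
    have "filterlim fst (nhds (0::real)) (nhds (0 :: real \<times> real))" "filterlim snd (nhds (0::real))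
        (nhds (0 :: real \<times> real))"
      using tendsto_fst[OF filterlim_ident, of "0 :: real \<times> real"] tendsto_snd[OF filterlim_ident,
          of "0 :: real \<times> real"]
      by simp_all
    from filterlim_compose[OF 1 this(1)] filterlim_compose[OF 2 this(2)]
    have "(h \<longlongrightarrow> sqrt (2 * ((norm x)\<^sup>2 - (norm x)\<^sup>2) * (norm x)\<^sup>2)
        + sqrt (2 * ((norm x)\<^sup>2 - (norm x)\<^sup>2) * (norm x)\<^sup>2)) (nhds 0)"
      unfolding h_def by (intro tendsto_intros)
    then show ?thesis
      by simp
  qed
  have "\<forall>\<^sub>F a in nhds 0. norm (Re (\<phi> a x x) - (norm x)\<^sup>2) \<le> h a"
    by (rule always_eventually) (rule allI, rule le)
  then have "((\<lambda>a. Re (\<phi> a x x) - (norm x)\<^sup>2) \<longlongrightarrow> 0) (nhds 0)"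
    using h by (rule Lim_null_comparison)
  then show ?thesis
    by (rule LIM_zero_cancel)
qed

text \<open>Dissipativity makes the cross term of the squared norm nonpositive, which leaves only
  the excess \<open>C\<^sup>2 / n\<^sup>2\<close> to be damped. For \<open>n = 0\<close> the damping
  factor is zero.\<close>

lemma euler_step_strict_contraction:
  fixes B :: "'a::complex_hilbert_space \<Rightarrow> 'a"
  assumes diss: "Re (cinner (B x) x) \<le> 0" and C: "norm (B x) \<le> C * norm x"
  shows "norm (((real n)\<^sup>2 / ((real n)\<^sup>2 + C\<^sup>2 + 1)) *\<^sub>R (x + B x /\<^sub>R real n))
      \<le> ((real n)\<^sup>2 + C\<^sup>2) / ((real n)\<^sup>2 + C\<^sup>2 + 1) * norm x"
proof (cases "n = 0")
  case False
  have Re: "Re (cinner x (B x)) \<le> 0"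
    using diss cinner_commute[of x "B x"] by simp
  define k where "k = inverse (real n)"
  have k: "0 \<le> k"
    by (simp add: k_def)
  have "(norm (x + k *\<^sub>R B x))\<^sup>2 = (norm x)\<^sup>2 + 2 * k * Re (cinner x (B x)) + (k * norm (B x))\<^sup>2"
    by (simp add: norm_add_sq cinner_scaleR_right power_mult_distrib)
  also have "\<dots> \<le> (norm x)\<^sup>2 + 0 + (k * (C * norm x))\<^sup>2"
    using Re C k by (intro add_mono power_mono mult_left_mono order_refl) (auto simp:
        mult_nonneg_nonpos)
  also have "\<dots> = (1 + (k * C)\<^sup>2) * (norm x)\<^sup>2"
    by (simp add: power_mult_distrib distrib_right)
  \<comment> \<open>Squaring the factor loses little and lets the root be taken exactly. The damping
    then cancels the denominator \<open>n\<^sup>2\<close>, and the added \<open>1\<close> makes the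
    final factor less than one.\<close>
  also have "\<dots> \<le> (1 + (k * C)\<^sup>2)\<^sup>2 * (norm x)\<^sup>2"
    using self_le_power[of "1 + (k * C)\<^sup>2" 2] by (intro mult_right_mono) auto
  finally have "norm (x + k *\<^sub>R B x) \<le> (1 + (k * C)\<^sup>2) * norm x"
    by (intro power2_le_imp_le[of "norm (x + k *\<^sub>R B x)"]) (auto simp: power_mult_distrib)
  moreover have "(k * C)\<^sup>2 = C\<^sup>2 / (real n)\<^sup>2"
    by (simp add: k_def power_mult_distrib power_inverse divide_inverse)
  ultimately have le: "norm (x + B x /\<^sub>R real n) \<le> (1 + C\<^sup>2 / (real n)\<^sup>2) * norm x"
    by (simp add: k_def)
  have "norm (((real n)\<^sup>2 / ((real n)\<^sup>2 + C\<^sup>2 + 1)) *\<^sub>R (x + B x /\<^sub>R real n))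
      \<le> (real n)\<^sup>2 / ((real n)\<^sup>2 + C\<^sup>2 + 1) * ((1 + C\<^sup>2 / (real n)\<^sup>2) * norm x)"
  proof -
    have c: "0 \<le> (real n)\<^sup>2 / ((real n)\<^sup>2 + C\<^sup>2 + 1)"
      by simp
    show ?thesis
      unfolding norm_scaleR abs_of_nonneg[OF c] by (rule mult_left_mono[OF le c])
  qed
  also have "\<dots> = ((real n)\<^sup>2 + C\<^sup>2) / ((real n)\<^sup>2 + C\<^sup>2 + 1) * norm x"
  proof -
    have "(real n)\<^sup>2 * (1 + C\<^sup>2 / (real n)\<^sup>2) = (real n)\<^sup>2 + C\<^sup>2"
      using False by (simp add: distrib_left)
    then show ?thesis
      by (metis (no_types, lifting) mult.assoc times_divide_eq_left)
  qed
  finally show ?thesis .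
qed simp

text \<open>The damping differs from \<open>1\<close> by the order of \<open>1 / n\<^sup>2\<close>,
  so it disappears in products of order \<open>n\<close> many steps.\<close>

lemma damping_tendsto:
  fixes C :: real
  shows "(\<lambda>n. real n * ((real n)\<^sup>2 / ((real n)\<^sup>2 + C\<^sup>2 + 1) - 1)) \<longlonglongrightarrow> (0::real)"
proof -
  have bound: "norm (real n * ((real n)\<^sup>2 / ((real n)\<^sup>2 + C\<^sup>2 + 1) - 1))
      \<le> (C\<^sup>2 + 1) * inverse (real n)" if "n \<ge> 1" for n
  proof -
    have pos: "0 < (real n)\<^sup>2 + C\<^sup>2 + 1"
      by (simp add: add_nonneg_pos)
    have z: "(real n)\<^sup>2 / ((real n)\<^sup>2 + C\<^sup>2 + 1) - 1 = - ((C\<^sup>2 + 1) / ((real n)\<^sup>2 + C\<^sup>2 + 1))"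
      using pos by (simp add: field_simps)
    have "0 \<le> (C\<^sup>2 + 1) / ((real n)\<^sup>2 + C\<^sup>2 + 1)"
      by simp
    then have "norm (real n * ((real n)\<^sup>2 / ((real n)\<^sup>2 + C\<^sup>2 + 1) - 1))
        = real n * (C\<^sup>2 + 1) / ((real n)\<^sup>2 + C\<^sup>2 + 1)"
      unfolding z real_norm_def abs_mult abs_minus_cancel
          by (simp only: abs_of_nonneg of_nat_0_le_iff times_divide_eq_right)
    also have "\<dots> \<le> real n * (C\<^sup>2 + 1) / (real n)\<^sup>2"
      using that pos by (intro divide_left_mono mult_nonneg_nonneg mult_pos_pos) auto
    also have "\<dots> = (C\<^sup>2 + 1) * inverse (real n)"
      using that by (simp add: power2_eq_square field_simps)
    finally show ?thesis .
  qed
  have "\<forall>\<^sub>F n in sequentially. norm (real n * ((real n)\<^sup>2 / ((real n)\<^sup>2 + C\<^sup>2 + 1) - 1))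
      \<le> (C\<^sup>2 + 1) * inverse (real n)"
    using bound by (rule eventually_sequentiallyI)
  moreover have "(\<lambda>n. (C\<^sup>2 + 1) * inverse (real n)) \<longlonglongrightarrow> 0"
    using tendsto_mult_right_zero[OF lim_inverse_n] .
  ultimately show ?thesis
    by (rule Lim_null_comparison)
qed

theorem corollary6p5:
  fixes A1 A2 :: "'a::complex_hilbert_space \<Rightarrow> 'a"
  assumes "separable_space (euclidean :: 'a topology)"
    and "bounded_clinear A1" and "bounded_clinear A2"
    and "A1 \<circ> A2 = A2 \<circ> A1"
    and "dissipative A1" and "dissipative A2"
    and "closed {u + v | u v. u \<in> range (\<lambda>x. A1 x - cadjoint A1 x) \<and>
                              v \<in> range (\<lambda>x. A2 x - cadjoint A2 x)}"
  shows "admits_commutative_unitary_dilation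
           (\<lambda>(t1, t2). op_exp (\<lambda>x. \<i> *\<^sub>C (t1 *\<^sub>R A1 x + t2 *\<^sub>R A2 x)))"
proof -
  note A1 = bounded_clinear_simps[OF assms(2)] and A2 = bounded_clinear_simps[OF assms(3)]
  \<comment> \<open>With the factor \<open>\<i>\<close> absorbed, dissipativity reads
    \<open>Re (cinner (B x) x) \<le> 0\<close>, the form in which it enters the Euler steps.\<close>
  define B1 B2 where "B1 x = \<i> *\<^sub>C A1 x" and "B2 x = \<i> *\<^sub>C A2 x" for x
  have comm: "B1 (B2 x) = B2 (B1 x)" for x
    using fun_cong[OF assms(4), of x] by (simp add: B1_def B2_def A1 A2 scaleC_scaleC)
  have B: "bounded_linear B1" "bounded_linear B2"
    using assms(2,3) unfolding B1_def B2_def bounded_clinear_def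
    by (auto intro: bounded_linear_compose[OF bounded_linear_scaleC])
  have diss: "Re (cinner (B1 x) x) \<le> 0" "Re (cinner (B2 x) x) \<le> 0" for x
    using dissipative_Im_nonneg[OF assms(2,5)] dissipative_Im_nonneg[OF assms(3,6)]
    by (simp_all add: B1_def B2_def cinner_scaleC_left)
  define B1' B2' where "B1' x = (- \<i>) *\<^sub>C cadjoint A1 x" and "B2' x = (- \<i>) *\<^sub>C cadjoint A2 x" for x
  have adj: "adjoint_pair B1 B1'" "adjoint_pair B2 B2'"
    by (simp_all add: adjoint_pair_def B1_def B2_def B1'_def B2'_def cinner_scaleC_left
        cinner_scaleC_right cadjoint[OF assms(2)] cadjoint[OF assms(3)])
  \<comment> \<open>One bound for both operators, so that the same damping serves both.\<close>
  obtain C where C: "norm (B1 x) \<le> C * norm x" "norm (B2 x) \<le> C * norm x" for x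
  proof -
    obtain K1 K2 where "norm (B1 x) \<le> norm x * K1" "norm (B2 x) \<le> norm x * K2" for x
      using bounded_linear.bounded[OF B(1)] bounded_linear.bounded[OF B(2)] by blast
    then have "norm (B1 x) \<le> max K1 K2 * norm x" "norm (B2 x) \<le> max K1 K2 * norm x" for x
      by (metis max.cobounded1 mult.commute mult_left_mono norm_ge_zero order_trans,
          metis max.cobounded2 mult.commute mult_left_mono norm_ge_zero order_trans)
    then show ?thesis
      by (rule that)
  qed
  define r where "r n = (real n)\<^sup>2 / ((real n)\<^sup>2 + C\<^sup>2 + 1)" for n :: nat
  define E where "E B n x = r n *\<^sub>R (x + B x /\<^sub>R real n)" for B :: "'a \<Rightarrow> 'a" and n x
  define T where "T = (\<lambda>(s, t). op_exp (\<lambda>x. s *\<^sub>R B1 x + t *\<^sub>R B2 x))"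
  have E_tendsto: "(\<lambda>n. (E B1 n ^^ a n) ((E B2 n ^^ b n) x)) \<longlonglongrightarrow> T (s, t) x"
    if "(\<lambda>n. a n / n) \<longlonglongrightarrow> s" "(\<lambda>n. b n / n) \<longlonglongrightarrow> t" for a b s t x
    using euler_products_tendsto_op_exp[OF B comm damping_tendsto that]
        by (simp add: E_def[abs_def] r_def T_def)
  have E_adj: "adjoint_pair (E B n) (E B' n)" if "adjoint_pair B B'" for B B' n
    using that by (simp add: adjoint_pair_def E_def cinner_scaleR_left cinner_scaleR_right
        cinner_add_left cinner_add_right)
  have E_comm: "E B1 n (E B2 n x) = E B2 n (E B1 n x)" for n x
    using adjoint_pair_linear[OF adj(1)] adjoint_pair_linear[OF adj(2)]
    by (simp add: E_def comm scaleR_add_right add_ac mult_ac)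
  have "\<exists>\<psi>. positive_definite \<psi> \<and>
      (\<forall>a b x y. \<psi> (int a, int b) x y = cinner ((E B1 n ^^ a) ((E B2 n ^^ b) x)) y)" for n
  proof -
    define q where "q = ((real n)\<^sup>2 + C\<^sup>2) / ((real n)\<^sup>2 + C\<^sup>2 + 1)"
    have pos: "0 < (real n)\<^sup>2 + C\<^sup>2 + 1"
      by (simp add: add_nonneg_pos)
    have q: "0 \<le> q" "q < 1"
      using pos by (simp_all add: q_def)
    have "norm (E B1 n x) \<le> q * norm x" "norm (E B2 n x) \<le> q * norm x" for x
      unfolding E_def r_def q_def by (rule euler_step_strict_contraction[OF diss(1) C(1)], rule
          euler_step_strict_contraction[OF diss(2) C(2)])
    note bound = this
    show ?thesis
    proof (rule ando_positive_definite[OF E_adj[OF adj(1)] E_adj[OF adj(2)] E_comm q bound])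
      fix \<psi> :: "int \<times> int \<Rightarrow> 'a \<Rightarrow> 'a \<Rightarrow> complex"
      assume "positive_definite \<psi>"
        "\<And>a b x y. \<psi> (int a, int b) x y = cinner ((E B1 n ^^ a) ((E B2 n ^^ b) x)) y"
      then show ?thesis
        by (intro exI[of _ \<psi>] conjI allI)
    qed
  qed
  then obtain \<psi> where \<psi>: "\<And>n. positive_definite (\<psi> n)"
    "\<And>n a b x y. \<psi> n (int a, int b) x y = cinner ((E B1 n ^^ a) ((E B2 n ^^ b) x)) y"
    by metis
  have T_zero: "T (0, 0) x = x" for x
    using op_exp_scaleR_continuous(2)[OF B(1)] by (simp add: T_def)
  \<comment> \<open>A single step, or none, covers a time that tends to zero.
    \<open>E_tendsto\<close> with constant exponents therefore makes unit shifts negligible in the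
    limit.\<close>
  have inv: "(\<lambda>n. real 1 / n) \<longlonglongrightarrow> 0" "(\<lambda>n. real 0 / n) \<longlonglongrightarrow> 0"
    using lim_inverse_n by (simp_all add: divide_inverse)
  have small: "(\<lambda>n. Re (\<psi> n (1, 0) x x)) \<longlonglongrightarrow> (norm x)\<^sup>2" "(\<lambda>n. Re (\<psi> n (0, 1) x x))
      \<longlonglongrightarrow> (norm x)\<^sup>2" for x
  proof -
    have *: "Re (cinner (T (0, 0) x) x) = (norm x)\<^sup>2"
      by (simp add: T_zero cinner_self)
    show "(\<lambda>n. Re (\<psi> n (1, 0) x x)) \<longlonglongrightarrow> (norm x)\<^sup>2"
      using tendsto_Re[OF tendsto_cinner_left[OF E_tendsto[OF inv], of x x]] \<psi>(2)[of _ 1 0 x x]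
          by (simp add: *)
    show "(\<lambda>n. Re (\<psi> n (0, 1) x x)) \<longlonglongrightarrow> (norm x)\<^sup>2"
      using tendsto_Re[OF tendsto_cinner_left[OF E_tendsto[OF inv(2,1)], of x x]] \<psi>(2)[of _ 0 1 x x]
          by (simp add: *)
  qed
  obtain \<phi> :: "real \<times> real \<Rightarrow> 'a \<Rightarrow> 'a \<Rightarrow> complex" where \<phi>: "positive_definite \<phi>"
    and \<phi>_lim: "\<And>s t x y l. (\<lambda>n. \<psi> n (\<lfloor>real n * s\<rfloor>, \<lfloor>real n * t\<rfloor>) x y) \<longlonglongrightarrow> l \<Longrightarrow> \<phi> (s, t) x y = l"
    using positive_definite_scaling_limit[OF \<psi>(1) small] by blast
  have \<phi>_T: "\<phi> (s, t) x y = cinner (T (s, t) x) y" if "0 \<le> s" "0 \<le> t" for s t x y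
  proof (rule \<phi>_lim)
    \<comment> \<open>For nonnegative times the rounded arguments are natural numbers, at which
      \<open>\<psi> n\<close> is an Euler product. Its convergence fixes the value of
      \<open>\<phi>\<close>.\<close>
    have "(\<lambda>n. cinner ((E B1 n ^^ nat \<lfloor>real n * s\<rfloor>) ((E B2 n ^^ nat \<lfloor>real n * t\<rfloor>) x)) y)
        \<longlonglongrightarrow> cinner (T (s, t) x) y"
      by (intro tendsto_cinner_left E_tendsto nat_floor_over_tendsto that)
    then show "(\<lambda>n. \<psi> n (\<lfloor>real n * s\<rfloor>, \<lfloor>real n * t\<rfloor>) x y) \<longlonglongrightarrow> cinner (T (s, t) x) y"
      using that by (simp flip: \<psi>(2))
  qed
  have T_axis: "((\<lambda>r. Re (cinner (T (\<bar>r\<bar>, 0) x) x)) \<longlongrightarrow> (norm x)\<^sup>2) (nhds 0)"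
    "((\<lambda>r. Re (cinner (T (0, \<bar>r\<bar>) x) x)) \<longlongrightarrow> (norm x)\<^sup>2) (nhds 0)" for x
  proof -
    have abs: "((\<lambda>r::real. \<bar>r\<bar>) \<longlongrightarrow> 0) (nhds 0)"
      using tendsto_rabs[OF filterlim_ident, of "0::real"] by simp
    have *: "((\<lambda>r. Re (cinner (op_exp (\<lambda>x. \<bar>r\<bar> *\<^sub>R B x) x) x)) \<longlongrightarrow> (norm x)\<^sup>2) (nhds 0)"
      if "bounded_linear B" for B
    proof -
      have "((\<lambda>r. op_exp (\<lambda>x. \<bar>r\<bar> *\<^sub>R B x) x) \<longlongrightarrow> op_exp (\<lambda>x. 0 *\<^sub>R B x) x) (nhds 0)"
        by (rule isCont_tendsto_compose[OF op_exp_scaleR_continuous(1)[OF that] abs])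
      from tendsto_Re[OF tendsto_cinner_left[OF this, of x]] show ?thesis
        by (simp add: op_exp_scaleR_continuous(2)[OF that] cinner_self)
    qed
    show "((\<lambda>r. Re (cinner (T (\<bar>r\<bar>, 0) x) x)) \<longlongrightarrow> (norm x)\<^sup>2) (nhds 0)"
      "((\<lambda>r. Re (cinner (T (0, \<bar>r\<bar>) x) x)) \<longlongrightarrow> (norm x)\<^sup>2) (nhds 0)"
      using *[OF B(1)] *[OF B(2)] by (simp_all add: T_def)
  qed
  have "((\<lambda>a. Re (\<phi> a x x)) \<longlongrightarrow> (norm x)\<^sup>2) (nhds 0)" for x
    by (rule positive_definite_continuous[OF \<phi>]) (simp_all add: \<phi>_T T_axis)
  then have "admits_commutative_unitary_dilation T"
    by (rule dilation_of_positive_definite[OF \<phi>]) (rule \<phi>_T)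
  moreover have "T = (\<lambda>(t1, t2). op_exp (\<lambda>x. \<i> *\<^sub>C (t1 *\<^sub>R A1 x + t2 *\<^sub>R A2 x)))"
    by (simp add: T_def B1_def B2_def scaleC_add_right scaleC_scaleR_commute)
  ultimately show ?thesis
    by (simp only:)
qed

end
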